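(* Assume the 3-SUM conjecture: there is a constant $q$ such that, in the word-RAM model with $O(\log n)$-bit words, given three sets $A,B,C$ of $n$ integers each in $[-n^q,n^q]$, deciding whether there exist $a\in A$, $b\in B$, $c\in C$ with $a+b+c=0$ requires $n^{2-o(1)}$ time. Then there exists a data structure problem that has a partially retroactive data structure with operation time $O(\sqrt n)$, but for which any fully retroactive data structure requires (amortized) $\Omega(n^{1-o(1)})$ time per operation (update or fully retroactive query) when $m=\Theta(n)$.
   Context: A data structure is viewed as a sequence of updates (the timeline) applied to an initial state; its size is $n$ and the timeline contains $m$ operations. A retroactive data structure allows inserting or deleting an update at any point of the timeline. It is partially retroactive if queries may only be asked about the present, i.e., the state resulting from applying the whole timeline; it is fully retroactive if queries may also be asked about the state resulting from any prefix of the timeline. The model of computation is the word-RAM with word size $\Theta(\log \max\{n,m\})$. *)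

theory Defs
  imports Complex_Main "HOL-Library.Landau_Symbols" "HOL-Library.Discrete_Functions"
begin

section \<open>The word-RAM\<close>

text \<open>
  A word of a machine with word size \<open>w\<close> is a natural number below \<open>2 ^ w\<close>. All results of
  arithmetic are reduced modulo \<open>2 ^ w\<close>, so only the \<open>2 ^ w\<close> addressable cells of the memory can
  be used. A program mentions finitely many registers. Control flow is structured, which costs at
  most a constant factor compared with jumps. Every instruction and every test takes unit time.
\<close>

datatype binop = Add | Sub | Mul | Div | Mod | And | Or | Xor | Shl | Shr | Equal | Less

fun eval_binop :: "nat \<Rightarrow> binop \<Rightarrow> nat \<Rightarrow> nat \<Rightarrow> nat" where
  "eval_binop w Add a b = (a + b) mod 2 ^ w"
| "eval_binop w Sub a b = nat ((int a - int b) mod 2 ^ w)"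
| "eval_binop w Mul a b = (a * b) mod 2 ^ w"
| "eval_binop w Div a b = a div b"
| "eval_binop w Mod a b = a mod b"
| "eval_binop w And a b = Bit_Operations.and a b"
| "eval_binop w Or a b = Bit_Operations.or a b"
| "eval_binop w Xor a b = Bit_Operations.xor a b"
| "eval_binop w Shl a b = (a * 2 ^ b) mod 2 ^ w"
| "eval_binop w Shr a b = a div 2 ^ b"
| "eval_binop w Equal a b = (if a = b then 1 else 0)"
| "eval_binop w Less a b = (if a < b then 1 else 0)"

type_synonym register = nat

datatype com =
    Skip
  | Const register nat
  | Oper register binop register register
  | Load register register      \<comment> \<open>target, register holding the address\<close>
  | Store register register     \<comment> \<open>register holding the address, source\<close>
  | Seq com com
  | If register com com         \<comment> \<open>registers are tested for being nonzero\<close>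
  | While register com

record config =
  reg :: "register \<Rightarrow> nat"
  mem :: "nat \<Rightarrow> nat"

text \<open>\<open>exec w p s k s'\<close>: with word size \<open>w\<close>, program \<open>p\<close> started in \<open>s\<close> halts in \<open>s'\<close> after \<open>k\<close> steps.\<close>

inductive exec :: "nat \<Rightarrow> com \<Rightarrow> config \<Rightarrow> nat \<Rightarrow> config \<Rightarrow> bool" for w :: nat where
  Skip: "exec w Skip s 1 s"
| Const: "exec w (Const r a) s 1 (s\<lparr>reg := (reg s)(r := a mod 2 ^ w)\<rparr>)"
| Oper: "exec w (Oper r f x y) s 1 (s\<lparr>reg := (reg s)(r := eval_binop w f (reg s x) (reg s y))\<rparr>)"
| Load: "exec w (Load r x) s 1 (s\<lparr>reg := (reg s)(r := mem s (reg s x))\<rparr>)"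
| Store: "exec w (Store x y) s 1 (s\<lparr>mem := (mem s)(reg s x := reg s y)\<rparr>)"
| Seq: "exec w p s k s' \<Longrightarrow> exec w p' s' k' s'' \<Longrightarrow> exec w (Seq p p') s (k + k') s''"
| IfTrue: "reg s x \<noteq> 0 \<Longrightarrow> exec w p s k s' \<Longrightarrow> exec w (If x p p') s (1 + k) s'"
| IfFalse: "reg s x = 0 \<Longrightarrow> exec w p' s k s' \<Longrightarrow> exec w (If x p p') s (1 + k) s'"
| WhileFalse: "reg s x = 0 \<Longrightarrow> exec w (While x p) s 1 s"
| WhileTrue: "reg s x \<noteq> 0 \<Longrightarrow> exec w p s k s' \<Longrightarrow> exec w (While x p) s' k' s''
    \<Longrightarrow> exec w (While x p) s (1 + k + k') s''"

text \<open>\<open>c\<close> times the number of binary digits of \<open>N\<close>, that is, \<open>\<Theta>(log N)\<close> bits.\<close>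

definition word_size :: "nat \<Rightarrow> nat \<Rightarrow> nat" where
  "word_size c N = c * (floor_log N + 1)"

text \<open>The memory is initially zero, except for an input, and register 0 holds the size parameter.\<close>

definition start_config :: "nat \<Rightarrow> nat \<Rightarrow> nat list \<Rightarrow> config" where
  "start_config w n input =
     \<lparr>reg = (\<lambda>r. if r = 0 then n mod 2 ^ w else 0),
      mem = (\<lambda>a. if a < length input \<and> a < 2 ^ w then input ! a mod 2 ^ w else 0)\<rparr>"


section \<open>The 3-SUM conjecture\<close>

definition enumerates :: "int list \<Rightarrow> int set \<Rightarrow> bool" where
  "enumerates xs A \<longleftrightarrow> set xs = A \<and> distinct xs"

text \<open>Integers are stored in two's complement: \<open>x\<close> is represented by \<open>x mod 2 ^ w\<close>.\<close>

definition word_of_int :: "nat \<Rightarrow> int \<Rightarrow> nat" where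
  "word_of_int w x = nat (x mod 2 ^ w)"

text \<open>
  \<open>T n\<close> bounds the running time of \<open>p\<close> on all inputs of size \<open>n\<close>, each consisting of three arrays
  that list the elements of the three sets in any order. The verdict is left in register 0.
\<close>

definition solves_three_sum :: "nat \<Rightarrow> com \<Rightarrow> nat \<Rightarrow> (nat \<Rightarrow> real) \<Rightarrow> bool" where
  "solves_three_sum q p c T \<longleftrightarrow>
    (\<forall>n\<ge>1. \<forall>A B C as bs cs.
       card A = n \<and> card B = n \<and> card C = n \<and>
       A \<subseteq> {- (int n ^ q)..int n ^ q} \<and> B \<subseteq> {- (int n ^ q)..int n ^ q} \<and>
       C \<subseteq> {- (int n ^ q)..int n ^ q} \<and>
       enumerates as A \<and> enumerates bs B \<and> enumerates cs C \<longrightarrow>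
       (let w = word_size c n in
        \<exists>k s. exec w p (start_config w n (map (word_of_int w) (as @ bs @ cs))) k s \<and>
              real k \<le> T n \<and>
              reg s 0 = (if \<exists>x\<in>A. \<exists>y\<in>B. \<exists>z\<in>C. x + y + z = 0 then 1 else 0)))"

text \<open>
  As usual, requiring \<open>n\<^bsup>2-o(1)\<^esup>\<close> time means that no algorithm runs in time \<open>O(n\<^bsup>2-\<epsilon>\<^esup>)\<close> for a
  constant \<open>\<epsilon> > 0\<close>.
\<close>

definition three_sum_conjecture :: bool where
  "three_sum_conjecture \<longleftrightarrow>
    (\<exists>q. \<forall>p c T. solves_three_sum q p c T \<longrightarrow>
      (\<forall>\<epsilon>>0. T \<notin> O(\<lambda>n. real n powr (2 - \<epsilon>))))"


section \<open>Data structure problems\<close>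

text \<open>
  The states of a data structure of size \<open>n\<close> are sequences of \<open>n\<close> words; updates and queries are
  encoded by constantly many words and answers by one word. All these words are polynomially
  bounded in \<open>n\<close>.
\<close>

record ds_problem =
  states :: "nat \<Rightarrow> nat list set"
  initial :: "nat \<Rightarrow> nat list"
  updates :: "nat \<Rightarrow> nat list set"
  effect :: "nat list \<Rightarrow> nat list \<Rightarrow> nat list"   \<comment> \<open>update, old state\<close>
  queries :: "nat \<Rightarrow> nat list set"
  answer :: "nat list \<Rightarrow> nat list \<Rightarrow> nat"        \<comment> \<open>query, state\<close>

definition words_of_length :: "nat \<Rightarrow> nat \<Rightarrow> nat list set" where
  "words_of_length bound l = {xs. length xs = l \<and> set xs \<subseteq> {..<bound}}"

definition ds_problem :: "ds_problem \<Rightarrow> bool" where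
  "ds_problem P \<longleftrightarrow>
    (\<exists>d a b. \<forall>n\<ge>1.
       states P n \<subseteq> words_of_length ((n + 1) ^ d) n \<and>
       updates P n \<subseteq> words_of_length ((n + 1) ^ d) a \<and>
       queries P n \<subseteq> words_of_length ((n + 1) ^ d) b \<and>
       initial P n \<in> states P n \<and>
       (\<forall>u\<in>updates P n. \<forall>x\<in>states P n. effect P u x \<in> states P n) \<and>
       (\<forall>q\<in>queries P n. \<forall>x\<in>states P n. answer P q x < (n + 1) ^ d))"


section \<open>Retroactive data structures\<close>

text \<open>A timeline assigns updates to finitely many points in time, at most one to each.\<close>

type_synonym timeline = "nat \<rightharpoonup> nat list"

definition prefix_state :: "ds_problem \<Rightarrow> nat \<Rightarrow> timeline \<Rightarrow> nat \<Rightarrow> nat list" where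
  "prefix_state P n \<tau> t =
     fold (effect P) (map (\<lambda>t'. the (\<tau> t')) (sorted_list_of_set {t' \<in> dom \<tau>. t' < t})) (initial P n)"

definition present_state :: "ds_problem \<Rightarrow> nat \<Rightarrow> timeline \<Rightarrow> nat list" where
  "present_state P n \<tau> =
     fold (effect P) (map (\<lambda>t. the (\<tau> t)) (sorted_list_of_set (dom \<tau>))) (initial P n)"

datatype retro_op =
    Insert nat "nat list"
  | Delete nat
  | Query_Present "nat list"
  | Query_Prefix nat "nat list"   \<comment> \<open>state resulting from all updates before the given time\<close>

fun timeline_after :: "retro_op \<Rightarrow> timeline \<Rightarrow> timeline" where
  "timeline_after (Insert t u) \<tau> = \<tau>(t \<mapsto> u)"
| "timeline_after (Delete t) \<tau> = \<tau>(t := None)"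
| "timeline_after (Query_Present q) \<tau> = \<tau>"
| "timeline_after (Query_Prefix t q) \<tau> = \<tau>"

text \<open>
  \<open>m\<close> is the maximal number of updates in the timeline; points in time are the integers below
  \<open>H\<close>, and \<open>H\<close> itself lies after all of them.
\<close>

fun legal_op :: "ds_problem \<Rightarrow> nat \<Rightarrow> nat \<Rightarrow> nat \<Rightarrow> timeline \<Rightarrow> retro_op \<Rightarrow> bool" where
  "legal_op P n m H \<tau> (Insert t u) \<longleftrightarrow>
     t < H \<and> t \<notin> dom \<tau> \<and> card (dom \<tau>) < m \<and> u \<in> updates P n"
| "legal_op P n m H \<tau> (Delete t) \<longleftrightarrow> t \<in> dom \<tau>"
| "legal_op P n m H \<tau> (Query_Present q) \<longleftrightarrow> q \<in> queries P n"
| "legal_op P n m H \<tau> (Query_Prefix t q) \<longleftrightarrow> t \<le> H \<and> q \<in> queries P n"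

fun legal_ops :: "ds_problem \<Rightarrow> nat \<Rightarrow> nat \<Rightarrow> nat \<Rightarrow> timeline \<Rightarrow> retro_op list \<Rightarrow> bool" where
  "legal_ops P n m H \<tau> [] \<longleftrightarrow> True"
| "legal_ops P n m H \<tau> (x # xs) \<longleftrightarrow>
     legal_op P n m H \<tau> x \<and> legal_ops P n m H (timeline_after x \<tau>) xs"

fun partial_op :: "retro_op \<Rightarrow> bool" where
  "partial_op (Query_Prefix t q) \<longleftrightarrow> False"
| "partial_op _ \<longleftrightarrow> True"

fun full_op :: "retro_op \<Rightarrow> bool" where
  "full_op (Query_Present q) \<longleftrightarrow> False"   \<comment> \<open>subsumed by prefix queries at time \<open>H\<close>\<close>
| "full_op _ \<longleftrightarrow> True"

text \<open>
  An implementation consists of one program for the initialization and one for each kind of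
  operation. Registers and memory persist between the operations. The arguments of an operation
  are passed in the registers 0, 1, \<open>\<dots>\<close>, the answer to a query is returned in register 0.
  Arguments that do not fit into a word are truncated, so the constant factor in the word size
  has to be chosen large enough for the problem at hand.
\<close>

record implementation =
  init_code :: com
  insert_code :: com
  delete_code :: com
  query_code :: com

fun op_code :: "implementation \<Rightarrow> retro_op \<Rightarrow> com" where
  "op_code D (Insert t u) = insert_code D"
| "op_code D (Delete t) = delete_code D"
| "op_code D (Query_Present q) = query_code D"
| "op_code D (Query_Prefix t q) = query_code D"

fun op_args :: "retro_op \<Rightarrow> nat list" where
  "op_args (Insert t u) = t # u"
| "op_args (Delete t) = [t]"
| "op_args (Query_Present q) = q"
| "op_args (Query_Prefix t q) = t # q"

definition pass_args :: "nat \<Rightarrow> nat list \<Rightarrow> config \<Rightarrow> config" where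
  "pass_args w xs s =
     s\<lparr>reg := (\<lambda>r. if r < length xs then xs ! r mod 2 ^ w else reg s r)\<rparr>"

fun answered :: "ds_problem \<Rightarrow> nat \<Rightarrow> timeline \<Rightarrow> retro_op \<Rightarrow> nat \<Rightarrow> bool" where
  "answered P n \<tau> (Insert t u) v \<longleftrightarrow> True"
| "answered P n \<tau> (Delete t) v \<longleftrightarrow> True"
| "answered P n \<tau> (Query_Present q) v \<longleftrightarrow> v = answer P q (present_state P n \<tau>)"
| "answered P n \<tau> (Query_Prefix t q) v \<longleftrightarrow> v = answer P q (prefix_state P n \<tau> t)"

text \<open>The last argument of \<open>serves\<close> lists the running times of the individual operations.\<close>

fun serves :: "ds_problem \<Rightarrow> implementation \<Rightarrow> nat \<Rightarrow> nat \<Rightarrow> timeline \<Rightarrow> config \<Rightarrow>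
    retro_op list \<Rightarrow> nat list \<Rightarrow> bool" where
  "serves P D w n \<tau> s [] ks \<longleftrightarrow> ks = []"
| "serves P D w n \<tau> s (x # xs) ks \<longleftrightarrow>
     (\<exists>k s' ks'. ks = k # ks' \<and>
        exec w (op_code D x) (pass_args w (op_args x) s) k s' \<and>
        answered P n \<tau> x (reg s' 0) \<and>
        serves P D w n (timeline_after x \<tau>) s' xs ks')"

definition serves_from_start ::
    "ds_problem \<Rightarrow> implementation \<Rightarrow> nat \<Rightarrow> nat \<Rightarrow> retro_op list \<Rightarrow> nat \<Rightarrow> nat list \<Rightarrow> bool" where
  "serves_from_start P D w n xs k ks \<longleftrightarrow>
     (\<exists>s. exec w (init_code D) (start_config w n []) k s \<and> serves P D w n Map.empty s xs ks)"

text \<open>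
  \<open>h\<close> is the degree of the polynomial range \<open>{0..<max n m ^ h}\<close> of the time stamps. The bound
  \<open>T n\<close> on the time of every single operation does not depend on \<open>m\<close>. Setting up the initial
  state of size \<open>n\<close> counts like \<open>n\<close> operations, here and in the amortized version below.
\<close>

definition partially_retroactive ::
    "ds_problem \<Rightarrow> nat \<Rightarrow> implementation \<Rightarrow> nat \<Rightarrow> (nat \<Rightarrow> real) \<Rightarrow> bool" where
  "partially_retroactive P h D c T \<longleftrightarrow>
    (\<forall>n\<ge>1. \<forall>m xs.
       list_all partial_op xs \<and> legal_ops P n m (max n m ^ h) Map.empty xs \<longrightarrow>
       (\<exists>k ks. serves_from_start P D (word_size c (max n m)) n xs k ks \<and>
               real k \<le> T n * real n \<and> (\<forall>k'\<in>set ks. real k' \<le> T n)))"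

text \<open>
  The amortized time bound, like correctness itself, is only required for timelines whose maximal
  length \<open>m\<close> lies in a given range that may depend on \<open>n\<close>.
\<close>

definition fully_retroactive_amortized ::
    "ds_problem \<Rightarrow> nat \<Rightarrow> (nat \<Rightarrow> nat set) \<Rightarrow> implementation \<Rightarrow> nat \<Rightarrow> (nat \<Rightarrow> real) \<Rightarrow> bool" where
  "fully_retroactive_amortized P h M D c T \<longleftrightarrow>
    (\<forall>n\<ge>1. \<forall>m\<in>M n. \<forall>xs.
       list_all full_op xs \<and> legal_ops P n m (max n m ^ h) Map.empty xs \<longrightarrow>
       (\<exists>k ks. serves_from_start P D (word_size c (max n m)) n xs k ks \<and>
               real (k + sum_list ks) \<le> T n * real (n + length xs)))"

end

theory Submission
  imports Defs
begin

text \<open>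
  The state is an array of \<open>n\<close> words modulo \<open>M = (n + 1) ^ d\<close>, divided into two groups of
  \<open>s = \<lfloor>sqrt (n / 4)\<rfloor>\<close> words and a large group containing the rest. An update adds a number to one
  word, and the only query asks for the number of triples, one word from each group, whose sum is
  congruent to 1. Updates commute, so the present state does not depend on their times, and changing
  one word changes the answer by a sum over at most \<open>s\<close> entries of a table that counts the
  occurrences of every value. This gives partial retroactivity in time \<open>O(sqrt n)\<close>.

  A 3-SUM instance \<open>A, B, C\<close> of size \<open>N\<close> is solved by \<open>O(N)\<close> fully retroactive operations on a
  structure of size \<open>n = k\<^sup>2 N\<close>. Split \<open>A\<close> and \<open>B\<close> into \<open>O(sqrt N)\<close> blocks of length \<open>s\<close>. Load \<open>C\<close>
  into the large group. Updates at increasing times let the first group run through the blocks of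
  \<open>A\<close>: each adds the difference to the corresponding element of the next block. For every block of
  \<open>B\<close>, insert it into the second group at the beginning of time, ask one prefix query for every
  block of \<open>A\<close>, and delete it again. So \<open>N\<close> queries evaluate all pairs of blocks. If every operation
  took amortized time \<open>O(n powr (1 - \<epsilon>))\<close>, 3-SUM would take time \<open>O(N powr (2 - \<epsilon>))\<close>. The
  implementation is run inside the 3-SUM program by simulating its smaller words.
\<close>

section \<open>Verifying programs\<close>

text \<open>If \<open>U = N ^ q\<close> bounds the inputs, the offsets \<open>U + 2\<close>,
  \<open>U\<close> and \<open>M - (2 * U + 1)\<close> add up to \<open>M + 1\<close>, so a triple
  hits exactly when its integers sum to 0, whereas a padding word 0 would need two entries with sum
  1 modulo \<open>M\<close>, and theirs is at least 2 and below \<open>M\<close>. The exponent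
  \<open>q + 3\<close> of the modulus leaves room for these offsets and for counts up to
  \<open>n ^ 3\<close>. The factor \<open>k ^ 2\<close> in \<open>n\<close> answers the demand for a
  lower bound in every window from \<delta> \<open>* n\<close> to \<Delta> \<open>* n\<close> for
  \<open>m\<close>, however low: the reduction never holds more than \<open>(k + 2) * N\<close>
  updates at once, a fraction of order \<open>1 / k\<close> of \<open>n\<close>. The word-size
  constant \<open>c\<close> of the given implementation is arbitrary, possibly 0, and its programs
  may rely on wrap-around modulo \<open>2 ^ w\<close>. Hence they are simulated instruction by
  instruction, at the price of a factor 2.\<close>

definition wp :: "nat \<Rightarrow> com \<Rightarrow> (nat \<Rightarrow> config \<Rightarrow> bool) \<Rightarrow> config \<Rightarrow> bool" where
  "wp w p Q s \<longleftrightarrow> (\<exists>k s'. exec w p s k s' \<and> Q k s')"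

lemma wp_mono: "wp w p Q s \<Longrightarrow> (\<And>k s'. Q k s' \<Longrightarrow> Q' k s') \<Longrightarrow> wp w p Q' s"
  by (auto simp: wp_def)

inductive_cases exec_SkipE: "exec w Skip s k s'"
inductive_cases exec_ConstE: "exec w (Const r a) s k s'"
inductive_cases exec_OperE: "exec w (Oper r f x y) s k s'"
inductive_cases exec_LoadE: "exec w (Load r x) s k s'"
inductive_cases exec_StoreE: "exec w (Store x y) s k s'"
inductive_cases exec_SeqE: "exec w (Seq p p') s k s'"
inductive_cases exec_IfE: "exec w (If x p p') s k s'"

lemma wp_Skip: "wp w Skip Q s \<longleftrightarrow> Q 1 s"
  unfolding wp_def by (metis exec.Skip exec_SkipE)

lemma wp_Const: "wp w (Const r a) Q s \<longleftrightarrow> Q 1 (s\<lparr>reg := (reg s)(r := a mod 2 ^ w)\<rparr>)"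
  unfolding wp_def by (metis exec.Const exec_ConstE)

lemma wp_Oper:
  "wp w (Oper r f x y) Q s \<longleftrightarrow> Q 1 (s\<lparr>reg := (reg s)(r := eval_binop w f (reg s x) (reg s y))\<rparr>)"
  unfolding wp_def by (metis exec.Oper exec_OperE)

lemma wp_Load: "wp w (Load r x) Q s \<longleftrightarrow> Q 1 (s\<lparr>reg := (reg s)(r := mem s (reg s x))\<rparr>)"
  unfolding wp_def by (metis exec.Load exec_LoadE)

lemma wp_Store: "wp w (Store x y) Q s \<longleftrightarrow> Q 1 (s\<lparr>mem := (mem s)(reg s x := reg s y)\<rparr>)"
  unfolding wp_def by (metis exec.Store exec_StoreE)

lemma wp_Seq: "wp w (Seq p p') Q s \<longleftrightarrow> wp w p (\<lambda>k s'. wp w p' (\<lambda>k'. Q (k + k')) s') s"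
  unfolding wp_def by (blast elim!: exec_SeqE intro: exec.Seq)

lemma wp_If: "wp w (If x p p') Q s \<longleftrightarrow>
    (if reg s x \<noteq> 0 then wp w p (\<lambda>k. Q (1 + k)) s else wp w p' (\<lambda>k. Q (1 + k)) s)"
proof -
  have "exec w (If x p p') s k s' \<longleftrightarrow>
    (\<exists>k'. k = Suc k' \<and> exec w (if reg s x \<noteq> 0 then p else p') s k' s')" for k s'
    by (auto elim!: exec_IfE intro: exec.IfTrue[unfolded plus_1_eq_Suc]
        exec.IfFalse[unfolded plus_1_eq_Suc])
  then show ?thesis by (auto simp: wp_def)
qed

text \<open>
  With this congruence rule the simplifier evaluates a program from the front and normalizes every
  intermediate configuration before it is duplicated.
\<close>

lemma wp_cong: "p = p' \<Longrightarrow> s = s' \<Longrightarrow> wp w p Q s = wp w p' Q s'"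
  by simp

lemmas wp_simps = wp_Skip wp_Const wp_Oper wp_Load wp_Store wp_Seq wp_If

lemma wp_WhileFalse: "reg s x = 0 \<Longrightarrow> Q 1 s \<Longrightarrow> wp w (While x p) Q s"
  unfolding wp_def by (blast intro: exec.WhileFalse)

lemma wp_WhileTrue:
  assumes "reg s x \<noteq> 0" "wp w p (\<lambda>k s'. wp w (While x p) (\<lambda>k'. Q (1 + k + k')) s') s"
  shows "wp w (While x p) Q s"
  using assms unfolding wp_def by (blast intro: exec.WhileTrue)

fun seqs :: "com list \<Rightarrow> com" where
  "seqs [] = Skip"
| "seqs [p] = p"
| "seqs (p # q # ps) = Seq p (seqs (q # ps))"

definition for_loop :: "register \<Rightarrow> register \<Rightarrow> register \<Rightarrow> com \<Rightarrow> com" where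
  "for_loop i b t p =
     seqs [Const i 0, Oper t Less i b,
       While t (seqs [p, Const t 1, Oper i Add i t, Oper t Less i b])]"

text \<open>
  The parameter \<open>e\<close> of the invariant is a supply of time credits, from which the body pays all but
  \<open>c\<close> of its steps.
\<close>

lemma wp_for_loop:
  assumes distinct: "i \<noteq> b" "t \<noteq> i" "t \<noteq> b" and n: "n < 2 ^ w" "reg s b = n"
    and start: "I 0 s e"
    and frame: "\<And>j s e r v. I j s e \<Longrightarrow> r = i \<or> r = t \<Longrightarrow> I j (s\<lparr>reg := (reg s)(r := v)\<rparr>) e"
    and body: "\<And>j s e. j < n \<Longrightarrow> I j s e \<Longrightarrow> reg s i = j \<Longrightarrow> reg s b = n \<Longrightarrow>
      wp w p (\<lambda>k s'. reg s' i = j \<and> reg s' b = n \<and> (\<exists>e'. I (Suc j) s' e' \<and> k + e' \<le> e + c)) s"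
  shows "wp w (for_loop i b t p)
    (\<lambda>k s'. reg s' b = n \<and> (\<exists>e'. I n s' e' \<and> k + e' \<le> e + (c + 4) * n + 3)) s"
proof -
  define W where "W = While t (seqs [p, Const t 1, Oper i Add i t, Oper t Less i b])"
  \<comment> \<open>Besides \<open>c\<close>, each of the remaining \<open>n - j\<close> rounds pays
    four steps: the test and the three instructions after the body. The additional 1 is the failing
    test.\<close>
  have loop: "wp w W (\<lambda>k s'. reg s' b = n \<and> (\<exists>e'. I n s' e' \<and> k + e' \<le> e + (c + 4) * (n - j) + 1)) s"
    if "I j s e" "j \<le> n" "reg s i = j" "reg s b = n" "reg s t = (if j < n then 1 else 0)" for j s e
    using that
  proof (induction "n - j" arbitrary: j s e)
    case 0
    then show ?case unfolding W_def by (intro wp_WhileFalse) auto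
  next
    case (Suc m)
    then have j: "j < n" by simp
    \<comment> \<open>A round is entered only with \<open>j < n < 2 ^ w\<close>, so the constant 1
      is not truncated.\<close>
    have "1 < (2::nat) ^ w" using j n by linarith
    then have one: "1 mod 2 ^ w = (1::nat)" by (rule mod_less)
    show ?case
      unfolding W_def
    proof (rule wp_WhileTrue, fold W_def)
      show "reg s t \<noteq> 0" using Suc j by simp
      show "wp w (seqs [p, Const t 1, Oper i Add i t, Oper t Less i b])
         (\<lambda>k s'. wp w W (\<lambda>k' s'. reg s' b = n \<and>
            (\<exists>e'. I n s' e' \<and> 1 + k + k' + e' \<le> e + (c + 4) * (n - j) + 1)) s') s"
        unfolding seqs.simps wp_Seq
      proof (rule wp_mono[OF body[OF j]])
        show "I j s e" "reg s i = j" "reg s b = n" using Suc by auto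
      next
        fix k s'
        assume "reg s' i = j \<and> reg s' b = n \<and> (\<exists>e'. I (Suc j) s' e' \<and> k + e' \<le> e + c)"
        then obtain e' where e': "reg s' i = j" "reg s' b = n" "I (Suc j) s' e'" "k + e' \<le> e + c"
          by auto
        define s'' where "s'' = s'\<lparr>reg := (reg s')(t := 1, i := Suc j, t := if Suc j < n then 1 else 0)\<rparr>"
        have I: "I (Suc j) s'' e'"
        proof -
          have "I (Suc j) (s'\<lparr>reg := (reg s')(t := 1)\<rparr>) e'" (is "I _ ?s1 _") using frame e' by blast
          then have "I (Suc j) (?s1\<lparr>reg := (reg ?s1)(i := Suc j)\<rparr>) e'" (is "I _ ?s2 _")
            using frame by blast
          then have "I (Suc j) (?s2\<lparr>reg := (reg ?s2)(t := if Suc j < n then 1 else 0)\<rparr>) e'"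
            using frame by blast
          then show ?thesis by (simp add: s''_def)
        qed
        have le: "n - j = Suc (n - Suc j)" using j by simp
        have "wp w W (\<lambda>k s'. reg s' b = n \<and> (\<exists>e''. I n s' e'' \<and> k + e'' \<le> e' + (c + 4) * (n - Suc j) + 1)) s''"
          by (rule Suc.hyps) (use Suc j I distinct e' in \<open>auto simp: s''_def\<close>)
        then have "wp w W (\<lambda>k' s'. reg s' b = n \<and>
            (\<exists>e'. I n s' e' \<and> 1 + (k + 3) + k' + e' \<le> e + (c + 4) * (n - j) + 1)) s''"
          by (rule wp_mono)
             (elim conjE exE, intro conjI exI, assumption, assumption, use e'(4) in \<open>simp add: le\<close>)
        then show "wp w (Const t 1) (\<lambda>ka s'. wp w (Oper i Add i t)
          (\<lambda>k' s'. wp w (Oper t Less i b)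
           (\<lambda>k'a s'. wp w W (\<lambda>k'b s'. reg s' b = n \<and>
               (\<exists>e'. I n s' e' \<and> 1 + (k + (ka + (k' + k'a))) + k'b + e' \<le> e + (c + 4) * (n - j) + 1)) s') s') s') s'"
          using j n e' distinct one by (simp add: wp_simps s''_def fun_upd_twist numeral_3_eq_3)
      qed
    qed
  qed
  have I0: "I 0 (s\<lparr>reg := (reg s)(i := 0, t := if 0 < n then 1 else 0)\<rparr>) e" (is "I 0 ?s e")
  proof -
    have "I 0 (s\<lparr>reg := (reg s)(i := 0)\<rparr>) e" (is "I _ ?s1 _") using frame start by blast
    then have "I 0 (?s1\<lparr>reg := (reg ?s1)(t := if 0 < n then 1 else 0)\<rparr>) e" using frame by blast
    then show ?thesis by simp
  qed
  have "wp w W (\<lambda>k s'. reg s' b = n \<and> (\<exists>e'. I n s' e' \<and> k + e' \<le> e + (c + 4) * (n - 0) + 1)) ?s"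
    by (rule loop) (use distinct n I0 in auto)
  then have "wp w W (\<lambda>k s'. reg s' b = n \<and> (\<exists>e'. I n s' e' \<and> 1 + (1 + k) + e' \<le> e + (c + 4) * n + 3)) ?s"
    by (rule wp_mono) auto
  then show ?thesis
    using distinct n by (cases "0 < n") (simp_all add: for_loop_def wp_simps W_def)
qed

definition power_code :: "register \<Rightarrow> register \<Rightarrow> nat \<Rightarrow> com" where
  "power_code r x e = ((\<lambda>p. Seq p (Oper r Mul r x)) ^^ e) (Const r 1)"

lemma wp_power_code:
  assumes "r \<noteq> x" "Q (e + 1) (s\<lparr>reg := (reg s)(r := reg s x ^ e mod 2 ^ w)\<rparr>)"
  shows "wp w (power_code r x e) Q s"
proof -
  have "wp w (power_code r x e)
    (\<lambda>k s'. k = e + 1 \<and> s' = s\<lparr>reg := (reg s)(r := reg s x ^ e mod 2 ^ w)\<rparr>) s"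
  proof (induction e)
    case 0
    then show ?case by (auto simp: power_code_def wp_simps fun_upd_def)
  next
    case (Suc e)
    have "power_code r x (Suc e) = Seq (power_code r x e) (Oper r Mul r x)"
      by (simp add: power_code_def)
    moreover have "wp w (Seq (power_code r x e) (Oper r Mul r x))
      (\<lambda>k s'. k = Suc e + 1 \<and> s' = s\<lparr>reg := (reg s)(r := reg s x ^ Suc e mod 2 ^ w)\<rparr>) s"
      unfolding wp_Seq
      by (rule wp_mono[OF Suc.IH])
         (use assms(1) in \<open>auto simp: wp_simps mod_mult_left_eq mod_mult_right_eq fun_upd_def mult.commute cong: if_cong\<close>)
    ultimately show ?case by (simp only:)
  qed
  then show ?thesis by (rule wp_mono) (use assms(2) in simp)
qed

section \<open>The data structure problem\<close>

lemma eval_binop_small: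
  "a + b < 2 ^ w \<Longrightarrow> eval_binop w Add a b = a + b"
  "a * b < 2 ^ w \<Longrightarrow> eval_binop w Mul a b = a * b"
  "b \<le> a \<Longrightarrow> a < 2 ^ w \<Longrightarrow> eval_binop w Sub a b = a - b"
  "eval_binop w Div a b = a div b"
  "eval_binop w Mod a b = a mod b"
  "eval_binop w Less a b = (if a < b then 1 else 0)"
  "eval_binop w And a a = a"
proof -
  assume *: "b \<le> a" "a < 2 ^ w"
  then have "int a < 2 ^ w" by (metis of_nat_less_iff of_nat_numeral of_nat_power)
  with * have "(int a - int b) mod 2 ^ w = int a - int b"
    by (intro mod_pos_pos_trivial; linarith)
  with * show "eval_binop w Sub a b = a - b" by simp
qed simp_all

declare eval_binop.simps [simp del]

section \<open>Counting triples with histograms\<close>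

definition table :: "(nat \<Rightarrow> nat) \<Rightarrow> nat set \<Rightarrow> nat \<Rightarrow> nat" where
  "table f G y = card {k \<in> G. f k = y}"

definition hits :: "nat \<Rightarrow> nat set \<Rightarrow> nat set \<Rightarrow> nat set \<Rightarrow> (nat \<Rightarrow> nat) \<Rightarrow> nat" where
  "hits M A B C f = (\<Sum>i\<in>A. \<Sum>j\<in>B. \<Sum>k\<in>C. of_bool ((f i + f j + f k) mod M = 1))"

text \<open>Number of hits through a word of value \<open>v\<close>: one of the other two groups is
  scanned, the other is consulted through its histogram. The summand \<open>2 * M\<close> keeps the
  subtraction of two residues from being cut off at 0.\<close>

definition partners :: "nat \<Rightarrow> nat set \<Rightarrow> nat set \<Rightarrow> (nat \<Rightarrow> nat) \<Rightarrow> nat \<Rightarrow> nat" where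
  "partners M B C f v = (\<Sum>j\<in>B. table f C ((2 * M + 1 - v - f j) mod M))"

text \<open>Both arguments of \<open>mod\<close> are below \<open>3 * M\<close>, so the reduction is
  at most two subtractions and the claim becomes a case distinction in linear arithmetic.\<close>

lemma mod_sum_eq_one_iff:
  fixes x y z M :: nat
  assumes "x < M" "y < M" "z < M" "2 \<le> M"
  shows "(x + y + z) mod M = 1 \<longleftrightarrow> z = (2 * M + 1 - x - y) mod M"
proof -
  have small: "a mod M = (if a < M then a else if a < 2 * M then a - M else a - 2 * M)"
    if "a < 3 * M" for a
    using that assms by (auto simp: le_mod_geq)
  show ?thesis
    using assms by (subst (1 2) small) auto
qed

lemma table_le_card: "finite G \<Longrightarrow> table f G y \<le> card G"
  unfolding table_def by (rule card_mono) auto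

lemma table_cong: "(\<And>k. k \<in> G \<Longrightarrow> f k = g k) \<Longrightarrow> table f G y = table g G y"
  unfolding table_def by (metis (mono_tags, lifting) Collect_cong)

text \<open>Stated with additions on both sides to avoid truncated subtraction; it follows by
  splitting off \<open>p\<close> before and after the change.\<close>

lemma table_fun_upd:
  assumes "finite G" "p \<in> G"
  shows "table (f(p := v)) G y + of_bool (f p = y) = table f G y + of_bool (v = y)"
proof -
  have *: "table g G y = table g (G - {p}) y + of_bool (g p = y)" for g
  proof (cases "g p = y")
    case True
    then have "{k \<in> G. g k = y} = insert p {k \<in> G - {p}. g k = y}" using assms by auto
    then show ?thesis using assms True by (simp add: table_def)
  next
    case False
    then have "{k \<in> G. g k = y} = {k \<in> G - {p}. g k = y}" using assms by auto
    then show ?thesis using False by (simp add: table_def)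
  qed
  have "table (f(p := v)) (G - {p}) y = table f (G - {p}) y" by (rule table_cong) auto
  then show ?thesis using *[of f] *[of "f(p := v)"] by simp
qed

lemma partners_le:
  assumes "finite C"
  shows "partners M B C f v \<le> card B * card C"
  unfolding partners_def using sum_bounded_above[of B _ "card C"] table_le_card[OF assms]
  by (metis (no_types, lifting) of_nat_id)

lemma hits_cong:
  "(\<And>k. k \<in> A \<union> B \<union> C \<Longrightarrow> f k = g k) \<Longrightarrow> hits M A B C f = hits M A B C g"
  unfolding hits_def by (intro sum.cong refl) auto

text \<open>Together with \<open>hits_rotate\<close>, this moves the group of the changed word to
  the front, where \<open>hits_fun_upd\<close> applies.\<close>

lemma hits_swap: "hits M A B C f = hits M B A C f"
  unfolding hits_def by (subst sum.swap) (simp add: add_ac)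

lemma hits_rotate: "hits M C A B f = hits M A B C f"
proof -
  have "hits M C A B f = (\<Sum>i\<in>A. \<Sum>k\<in>C. \<Sum>j\<in>B. of_bool ((f k + f i + f j) mod M = 1))"
    unfolding hits_def by (rule sum.swap)
  also have "\<dots> = hits M A B C f"
    unfolding hits_def by (rule sum.cong[OF refl], subst sum.swap) (simp add: add_ac)
  finally show ?thesis .
qed

lemma hits_le: "hits M A B C f \<le> card A * (card B * card C)"
proof -
  have "(\<Sum>k\<in>C. of_bool ((f i + f j + f k) mod M = 1)) \<le> card C" for i j
    using sum_mono[of C "\<lambda>k. of_bool ((f i + f j + f k) mod M = 1)" "\<lambda>_. 1 :: nat"] by simp
  then have "(\<Sum>j\<in>B. \<Sum>k\<in>C. of_bool ((f i + f j + f k) mod M = 1)) \<le> card B * card C" for i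
    using sum_bounded_above[of B _ "card C"] by (metis (no_types, lifting) of_nat_id)
  then show ?thesis
    unfolding hits_def using sum_bounded_above[of A _ "card B * card C"]
    by (metis (no_types, lifting) of_nat_id)
qed

lemma hits_pos_iff:
  assumes "finite A" "finite B" "finite C"
  shows "hits M A B C f \<noteq> 0 \<longleftrightarrow> (\<exists>i\<in>A. \<exists>j\<in>B. \<exists>k\<in>C. (f i + f j + f k) mod M = 1)"
  unfolding hits_def using assms by auto

text \<open>Triples avoiding \<open>p\<close> keep their sums, and those through \<open>p\<close>
  are counted by \<open>partners\<close> at the value of \<open>p\<close>. Since \<open>p\<close>
  lies in neither \<open>B\<close> nor \<open>C\<close>, both \<open>partners\<close> terms can be
  evaluated in the old state.\<close>

lemma hits_fun_upd:
  assumes fin: "finite A" "finite B" "finite C" and p: "p \<in> A" "p \<notin> B" "p \<notin> C"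
    and M: "2 \<le> M" "v < M" "\<And>k. f k < M"
  shows "hits M A B C (f(p := v)) + partners M B C f (f p) = hits M A B C f + partners M B C f v"
proof -
  have inner: "(\<Sum>j\<in>B. \<Sum>k\<in>C. of_bool ((x + f j + f k) mod M = 1)) = partners M B C f x"
    if "x < M" for x
    unfolding partners_def table_def
  proof (intro sum.cong refl)
    fix j
    have "(\<Sum>k\<in>C. of_bool ((x + f j + f k) mod M = 1)) = card {k \<in> C. (x + f j + f k) mod M = 1}"
      using fin by (simp add: Int_def of_bool_def sum.If_cases)
    also have "{k \<in> C. (x + f j + f k) mod M = 1} = {k \<in> C. f k = (2 * M + 1 - x - f j) mod M}"
      using mod_sum_eq_one_iff[OF that M(3) M(3) M(1)] by blast
    finally show "(\<Sum>k\<in>C. of_bool ((x + f j + f k) mod M = 1)) =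
        card {k \<in> C. f k = (2 * M + 1 - x - f j) mod M}" .
  qed
  have split: "hits M A B C g = partners M B C f (g p) + hits M (A - {p}) B C f"
    if "\<And>k. k \<noteq> p \<Longrightarrow> g k = f k" "g p < M" for g
  proof -
    have "hits M A B C g = (\<Sum>j\<in>B. \<Sum>k\<in>C. of_bool ((g p + g j + g k) mod M = 1)) + hits M (A - {p}) B C g"
      unfolding hits_def using fin p by (simp add: sum.remove)
    also have "(\<Sum>j\<in>B. \<Sum>k\<in>C. of_bool ((g p + g j + g k) mod M = 1)) =
        (\<Sum>j\<in>B. \<Sum>k\<in>C. of_bool ((g p + f j + f k) mod M = 1) :: nat)"
      by (intro sum.cong refl) (metis p that(1))
    also have "\<dots> = partners M B C f (g p)" using inner that by simp
    also have "hits M (A - {p}) B C g = hits M (A - {p}) B C f"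
    proof (rule hits_cong)
      fix k
      assume "k \<in> A - {p} \<union> B \<union> C"
      then have "k \<noteq> p" using p by auto
      then show "g k = f k" by (rule that(1))
    qed
    finally show ?thesis .
  qed
  show ?thesis using split[of f] split[of "f(p := v)"] M by simp
qed

section \<open>The retroactive problem and its states\<close>

definition side :: "nat \<Rightarrow> nat" where
  "side n = floor_sqrt (n div 4)"

definition group :: "nat \<Rightarrow> nat \<Rightarrow> nat set" where
  "group n g =
    (if g = 0 then {..<side n} else if g = 1 then {side n..<2 * side n} else {2 * side n..<n})"

definition modulus :: "nat \<Rightarrow> nat \<Rightarrow> nat" where
  "modulus d n = (n + 1) ^ d"

definition triple_problem :: "nat \<Rightarrow> ds_problem" where
  "triple_problem d = \<lparr>
     states = \<lambda>n. words_of_length (modulus d n) n,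
     initial = \<lambda>n. replicate n 0,
     updates = \<lambda>n. {[p, v] | p v. p < n \<and> v < modulus d n},
     effect = \<lambda>u x. x[u ! 0 := (x ! (u ! 0) + u ! 1) mod modulus d (length x)],
     queries = \<lambda>n. {[]},
     answer = \<lambda>q x. hits (modulus d (length x)) (group (length x) 0) (group (length x) 1)
       (group (length x) 2) (nth x)\<rparr>"

lemma le_side_iff: "x \<le> side n \<longleftrightarrow> 4 * x * x \<le> n"
  unfolding side_def le_floor_sqrt_iff power2_eq_square
  by (simp add: less_eq_div_iff_mult_less_eq mult_ac)

text \<open>Dividing by 4 under the root makes this true for every \<open>n\<close>, down to
  \<open>n = 1\<close>, so the two small groups always fit.\<close>

lemma two_side_le: "2 * side n \<le> n"
proof (cases "side n")
  case (Suc k)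
  have "4 * side n * side n \<le> n" using le_side_iff by blast
  moreover have "2 * side n \<le> 4 * side n * side n" using Suc by simp
  ultimately show ?thesis by linarith
qed simp

lemma modulus_pos: "0 < modulus d n"
  by (simp add: modulus_def)

text \<open>The source of \<open>3 \<le> d\<close>: an answer can count as many as
  \<open>n * (n * n)\<close> triples and has to stay below \<open>(n + 1) ^ d\<close>. The same
  bounds later show that all counts fit into words.\<close>

lemma modulus_gt_cube:
  assumes "3 \<le> d" "1 \<le> n"
  shows "n * (n * n) < modulus d n" "n < modulus d n" "2 \<le> modulus d n"
proof -
  have "n * (n * n) < (n + 1) * ((n + 1) * (n + 1))" by (intro mult_strict_mono) (use assms in auto)
  also have "\<dots> = (n + 1) ^ 3" by (simp add: power3_eq_cube)
  also have "\<dots> \<le> modulus d n" unfolding modulus_def using assms by (intro power_increasing) auto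
  finally show *: "n * (n * n) < modulus d n" .
  have "n * 1 \<le> n * (n * n)" using assms by (intro mult_le_mono2) auto
  with * show "n < modulus d n" by linarith
  with assms show "2 \<le> modulus d n" by linarith
qed

lemma finite_group [simp]: "finite (group n g)"
  by (simp add: group_def)

lemma card_group_le: "card (group n g) \<le> n"
  using two_side_le[of n] by (auto simp: group_def)

lemma ds_problem_triple_problem:
  assumes "3 \<le> d"
  shows "ds_problem (triple_problem d)"
  unfolding ds_problem_def
proof (rule exI[of _ d], rule exI[of _ 2], rule exI[of _ 0], intro allI impI)
  fix n :: nat
  assume n: "1 \<le> n"
  let ?P = "triple_problem d" and ?M = "modulus d n"
  have "length x = n \<Longrightarrow> answer ?P q x < ?M" for q x
  proof -
    assume x: "length x = n"
    have "answer ?P q x \<le> card (group n 0) * (card (group n 1) * card (group n 2))"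
      using hits_le x by (simp add: triple_problem_def)
    also have "\<dots> \<le> n * (n * n)" by (intro mult_le_mono card_group_le)
    finally show ?thesis using modulus_gt_cube(1)[OF assms n] by linarith
  qed
  then show "states ?P n \<subseteq> words_of_length ((n + 1) ^ d) n \<and>
       updates ?P n \<subseteq> words_of_length ((n + 1) ^ d) 2 \<and>
       queries ?P n \<subseteq> words_of_length ((n + 1) ^ d) 0 \<and>
       initial ?P n \<in> states ?P n \<and>
       (\<forall>u\<in>updates ?P n. \<forall>x\<in>states ?P n. effect ?P u x \<in> states ?P n) \<and>
       (\<forall>q\<in>queries ?P n. \<forall>x\<in>states ?P n. answer ?P q x < (n + 1) ^ d)"
    using modulus_gt_cube(2)[OF assms n] n modulus_pos[of d n]
    by (auto simp: triple_problem_def words_of_length_def modulus_def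
        dest!: set_update_subset_insert[THEN subsetD])
qed

text \<open>Commuting updates turn the fold over time into an unordered sum. It is left unreduced,
  so that inserting or deleting an update changes it by an exact addition; reduction modulo
  \<open>M\<close> happens only where states are compared.\<close>

definition cell :: "timeline \<Rightarrow> nat set \<Rightarrow> nat \<Rightarrow> nat" where
  "cell \<tau> S p = (\<Sum>t\<in>S. if the (\<tau> t) ! 0 = p then the (\<tau> t) ! 1 else 0)"

text \<open>The start \<open>x\<close> is general for the sake of the induction. The bound on its
  entries serves the empty list, where the right-hand side still reduces
  \<open>x ! p\<close>.\<close>

lemma fold_effect_triple_problem:
  assumes "set us \<subseteq> updates (triple_problem d) n" "length x = n" "\<And>p. p < n \<Longrightarrow> x ! p < modulus d n"
  shows "length (fold (effect (triple_problem d)) us x) = n \<and>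
    (\<forall>p<n. fold (effect (triple_problem d)) us x ! p =
      (x ! p + (\<Sum>u\<leftarrow>us. if u ! 0 = p then u ! 1 else 0)) mod modulus d n)"
  using assms
proof (induction us arbitrary: x)
  case (Cons u us)
  let ?x = "effect (triple_problem d) u x"
  have x: "length ?x = n" "\<And>p. p < n \<Longrightarrow> ?x ! p < modulus d n"
    "\<And>p. p < n \<Longrightarrow> ?x ! p = (x ! p + (if u ! 0 = p then u ! 1 else 0)) mod modulus d n"
    using Cons.prems modulus_pos[of d n] by (auto simp: triple_problem_def nth_list_update)
  have "set us \<subseteq> updates (triple_problem d) n" using Cons.prems by simp
  from Cons.IH[OF this x(1,2)] show ?case
    using x(3) by (auto simp: mod_add_left_eq add.assoc)
qed (auto simp: modulus_pos)

text \<open>An arbitrary set \<open>S\<close> of occupied times covers present and prefix states at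
  once.\<close>

lemma fold_sorted_triple_problem:
  assumes "finite S" "S \<subseteq> dom \<tau>" "ran \<tau> \<subseteq> updates (triple_problem d) n"
  shows "fold (effect (triple_problem d)) (map (\<lambda>t. the (\<tau> t)) (sorted_list_of_set S))
    (initial (triple_problem d) n) = map (\<lambda>p. cell \<tau> S p mod modulus d n) [0..<n]"
    (is "fold _ ?us ?x = _")
proof -
  have "set ?us \<subseteq> updates (triple_problem d) n"
    using assms by (fastforce simp: ran_def dom_def)
  moreover have "length ?x = n" "\<And>p. p < n \<Longrightarrow> ?x ! p = 0"
    by (auto simp: triple_problem_def)
  ultimately have *: "length (fold (effect (triple_problem d)) ?us ?x) = n \<and>
    (\<forall>p<n. fold (effect (triple_problem d)) ?us ?x ! p =
      (?x ! p + (\<Sum>u\<leftarrow>?us. if u ! 0 = p then u ! 1 else 0)) mod modulus d n)"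
    using modulus_pos by (intro fold_effect_triple_problem) auto
  have "(\<Sum>u\<leftarrow>?us. if u ! 0 = p then u ! 1 else 0) = cell \<tau> S p" for p
    using assms(1) by (simp add: cell_def sum_list_distinct_conv_sum_set comp_def)
  with * \<open>\<And>p. p < n \<Longrightarrow> ?x ! p = 0\<close> show ?thesis
    by (intro nth_equalityI) auto
qed

definition hit_count :: "nat \<Rightarrow> nat \<Rightarrow> (nat \<Rightarrow> nat) \<Rightarrow> nat" where
  "hit_count d n f = hits (modulus d n) (group n 0) (group n 1) (group n 2) f"

lemma group_subset: "k \<in> group n g \<Longrightarrow> k < n"
  using two_side_le[of n] by (auto simp: group_def split: if_splits)

lemma answer_triple_problem:
  "answer (triple_problem d) q (map f [0..<n]) = hit_count d n f"
  unfolding triple_problem_def hit_count_def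
  by (auto intro!: hits_cong dest: group_subset)

lemma answer_present_state:
  assumes "finite (dom \<tau>)" "ran \<tau> \<subseteq> updates (triple_problem d) n"
  shows "answer (triple_problem d) q (present_state (triple_problem d) n \<tau>) =
    hit_count d n (\<lambda>p. cell \<tau> (dom \<tau>) p mod modulus d n)"
  unfolding present_state_def by (simp add: fold_sorted_triple_problem assms answer_triple_problem)

lemma answer_prefix_state:
  assumes "finite (dom \<tau>)" "ran \<tau> \<subseteq> updates (triple_problem d) n"
  shows "answer (triple_problem d) q (prefix_state (triple_problem d) n \<tau> t) =
    hit_count d n (\<lambda>p. cell \<tau> {t' \<in> dom \<tau>. t' < t} p mod modulus d n)"
  unfolding prefix_state_def
  by (subst fold_sorted_triple_problem) (use assms in \<open>auto simp: answer_triple_problem\<close>)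

lemma cell_insert:
  assumes "finite (dom \<tau>)" "t \<notin> dom \<tau>"
  shows "cell (\<tau>(t \<mapsto> [p, v])) (dom (\<tau>(t \<mapsto> [p, v]))) = (cell \<tau> (dom \<tau>))(p := cell \<tau> (dom \<tau>) p + v)"
proof
  fix r
  have "cell (\<tau>(t \<mapsto> [p, v])) (dom \<tau>) r = cell \<tau> (dom \<tau>) r"
    unfolding cell_def using assms by (intro sum.cong) auto
  moreover have "cell (\<tau>(t \<mapsto> [p, v])) (insert t (dom \<tau>)) r =
      (if p = r then v else 0) + cell (\<tau>(t \<mapsto> [p, v])) (dom \<tau>) r"
    unfolding cell_def using assms by (subst sum.insert) auto
  ultimately show "cell (\<tau>(t \<mapsto> [p, v])) (dom (\<tau>(t \<mapsto> [p, v]))) r =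
      ((cell \<tau> (dom \<tau>))(p := cell \<tau> (dom \<tau>) p + v)) r"
    by auto
qed

text \<open>This is \<open>cell_insert\<close> read backwards: the old timeline arises from the new
  one by reinserting the deleted update.\<close>

lemma cell_delete:
  assumes "finite (dom \<tau>)" "\<tau> t = Some [p, v]"
  shows "cell \<tau> (dom \<tau>) = (cell (\<tau>(t := None)) (dom (\<tau>(t := None))))
    (p := cell (\<tau>(t := None)) (dom (\<tau>(t := None))) p + v)"
proof -
  have "(\<tau>(t := None))(t \<mapsto> [p, v]) = \<tau>" using assms by auto
  then show ?thesis using cell_insert[of "\<tau>(t := None)" t p v] assms by simp
qed

text \<open>Linear search for the largest \<open>j < n\<close> with
  \<open>4 * j * j \<le> n\<close>; initialization may cost as much as \<open>n\<close> operations.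
  Combining a register with itself by \<open>And\<close> serves as a copy instruction
  throughout.\<close>

definition side_code :: com where
  "side_code = for_loop 12 3 13 (seqs [Oper 14 Mul 12 12, Const 15 4, Oper 14 Mul 14 15,
     Oper 14 Less 3 14, If 14 Skip (Oper 4 And 12 12)])"

lemma side_less: "1 \<le> n \<Longrightarrow> side n < n"
proof -
  assume "1 \<le> n"
  then show ?thesis using two_side_le[of n] by (cases "side n = 0") auto
qed

lemma wp_side_code:
  assumes "reg s 3 = n" "reg s 4 = 0" "1 \<le> n" "4 * n * n < 2 ^ w"
  shows "wp w side_code (\<lambda>k s'. k \<le> 10 * n + 3 \<and> mem s' = mem s \<and> reg s' 4 = side n \<and>
    (\<forall>r. r \<notin> {4, 12, 13, 14, 15} \<longrightarrow> reg s' r = reg s r)) s"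
proof -
  \<comment> \<open>After \<open>j\<close> rounds the candidates below \<open>j\<close> have been
    tried. For \<open>j = 0\<close> the truncated \<open>j - 1\<close> gives the initial content
    0.\<close>
  define I where "I = (\<lambda>j (s' :: config) (e :: nat). e = 0 \<and> mem s' = mem s \<and> reg s' 4 = min (j - 1) (side n) \<and>
    (\<forall>r. r \<notin> {4, 12, 13, 14, 15} \<longrightarrow> reg s' r = reg s r))"
  have "1 * 1 \<le> n * n" using assms by (intro mult_le_mono) auto
  then have n: "n < 2 ^ w" "4 < (2::nat) ^ w"
    using assms(4) le_square[of n] unfolding mult.assoc by linarith+
  have "wp w side_code
    (\<lambda>k s'. reg s' 3 = n \<and> (\<exists>e'. I n s' e' \<and> k + e' \<le> 0 + (6 + 4) * n + 3)) s"
    unfolding side_code_def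
  proof (rule wp_for_loop)
    show "I 0 s 0" using assms by (simp add: I_def)
    show "\<And>j s e r v. I j s e \<Longrightarrow> r = 12 \<or> r = 13 \<Longrightarrow> I j (s\<lparr>reg := (reg s)(r := v)\<rparr>) e"
      by (auto simp: I_def)
    fix j s' e
    assume j: "j < n" "I j s' e" "reg s' 12 = j" "reg s' 3 = n"
    have "j * j \<le> n * n" using j by (intro mult_le_mono) auto
    then have jj: "j * j < 2 ^ w" "j * j * 4 < 2 ^ w" using assms(4) by linarith+
    have min: "min j (side n) = (if n < j * j * 4 then min (j - 1) (side n) else j)"
      using le_side_iff[of j n] by (auto simp: mult_ac)
    show "wp w (seqs [Oper 14 Mul 12 12, Const 15 4, Oper 14 Mul 14 15,
       Oper 14 Less 3 14, If 14 Skip (Oper 4 And 12 12)])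
      (\<lambda>k s'. reg s' 12 = j \<and> reg s' 3 = n \<and> (\<exists>e'. I (Suc j) s' e' \<and> k + e' \<le> e + 6)) s'"
      using j n jj min by (simp add: wp_simps eval_binop_small I_def cong: wp_cong)
  qed (use n assms in auto)
  then show ?thesis
    by (rule wp_mono) (use side_less[OF assms(3)] in \<open>auto simp: I_def min_def\<close>)
qed

text \<open>\<open>floor_log N + 1\<close> bits hold every number up to \<open>N\<close>, so
  \<open>c\<close> times as many hold polynomials of degree \<open>c\<close> in
  \<open>N + 1\<close>. All claims that something fits into a word rest on this.\<close>

lemma word_size_ge: "(N + 1) ^ c \<le> 2 ^ word_size c N"
proof -
  have "N + 1 \<le> 2 ^ (floor_log N + 1)" using floor_log_exp2_gt[of N] by simp
  then have "(N + 1) ^ c \<le> (2 ^ (floor_log N + 1)) ^ c" by (intro power_mono) auto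
  then show ?thesis unfolding word_size_def by (metis power_mult mult.commute)
qed

section \<open>A partially retroactive implementation\<close>

text \<open>
  Memory layout: cell \<open>8 * y + g\<close> with \<open>g < 3\<close> holds the number of occurrences of the value \<open>y\<close> in
  group \<open>g\<close>, cell \<open>8 * p + 3\<close> the \<open>p\<close>-th word of the present state, and the cells \<open>8 * t + 4\<close> and
  \<open>8 * t + 5\<close> the update at time \<open>t\<close>. Registers 0, 1, 2 hold the arguments of an operation.
\<close>

definition partners_code :: com where
  "partners_code = for_loop 21 4 22 (seqs
     [Oper 23 Add 21 16, Oper 23 Mul 23 8, Oper 23 Add 23 10, Load 23 23,
      Oper 24 Sub 11 13, Oper 24 Sub 24 23, Oper 24 Mod 24 5, Oper 24 Mul 24 8, Oper 24 Add 24 17,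
      Load 24 24, Oper 19 Add 19 24,
      Oper 24 Sub 11 14, Oper 24 Sub 24 23, Oper 24 Mod 24 5, Oper 24 Mul 24 8, Oper 24 Add 24 17,
      Load 24 24, Oper 20 Add 20 24])"

text \<open>Register 15 becomes the group of the changed word. The scanned group (16) is always one
  of the two small ones, so that \<open>side n\<close> rounds suffice; the remaining group (17) is
  accessed through its histogram.\<close>

definition select_code :: com where
  "select_code = seqs
     [Oper 12 Mul 1 8, Oper 12 Add 12 10, Load 13 12, Oper 14 Add 13 2, Oper 14 Mod 14 5,
      Store 12 14, Const 19 0, Const 20 0,
      Oper 18 Less 1 4,
      If 18 (seqs [Const 15 0, Oper 16 And 4 4, Const 17 2])
        (seqs [Const 16 0, Oper 18 Less 1 7,
           If 18 (seqs [Const 15 1, Const 17 2]) (seqs [Const 15 2, Const 17 1])])]"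

text \<open>The gain is added before the loss is subtracted, which prevents underflow. The histogram
  entry of the new value is loaded only after the old one was decremented, so equal values cancel
  out.\<close>

definition recount_code :: com where
  "recount_code = seqs
     [Oper 6 Add 6 20, Oper 6 Sub 6 19,
      Oper 24 Mul 13 8, Oper 24 Add 24 15, Load 25 24, Oper 25 Sub 25 9, Store 24 25,
      Oper 24 Mul 14 8, Oper 24 Add 24 15, Load 25 24, Oper 25 Add 25 9, Store 24 25]"

definition update_code :: com where
  "update_code = seqs [select_code, partners_code, recount_code]"

text \<open>All words are 0 at the start, so the only nonzero histogram entries are those of the
  value 0, in cells 0, 1 and 2: the sizes of the groups. The hit count in register 6 stays
  0.\<close>

definition triple_init_code :: "nat \<Rightarrow> com" where
  "triple_init_code d = seqs
     [Oper 3 And 0 0, side_code, Const 9 1, Oper 12 Add 3 9, power_code 5 12 d,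
      Oper 7 Add 4 4, Const 8 8, Const 10 3, Oper 11 Add 5 5, Oper 11 Add 11 9,
      Const 12 0, Store 12 4, Store 9 4, Oper 12 Add 9 9, Oper 13 Sub 3 7, Store 12 13]"

definition triple_insert_code :: com where
  "triple_insert_code = seqs
     [Oper 12 Mul 0 8, Oper 12 Add 12 10, Oper 12 Add 12 9, Store 12 1,
      Oper 12 Add 12 9, Store 12 2, update_code]"

text \<open>The increment \<open>v\<close> is undone by adding \<open>M - v\<close>, which lets
  deletions share \<open>update_code\<close> with insertions.\<close>

definition triple_delete_code :: com where
  "triple_delete_code = seqs
     [Oper 12 Mul 0 8, Oper 12 Add 12 10, Oper 12 Add 12 9, Load 1 12,
      Oper 12 Add 12 9, Load 2 12, Oper 2 Sub 5 2, update_code]"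

definition triple_query_code :: com where
  "triple_query_code = Oper 0 And 6 6"

definition triple_implementation :: "nat \<Rightarrow> implementation" where
  "triple_implementation d = \<lparr>init_code = triple_init_code d, insert_code = triple_insert_code,
     delete_code = triple_delete_code, query_code = triple_query_code\<rparr>"

text \<open>The factor 16 is generous: addresses stay below \<open>8 * M\<close> and
  \<open>8 * H\<close>, and the largest other numbers are \<open>2 * M + 1\<close>, sums of two
  counts and \<open>4 * n * n\<close>.\<close>

locale triple_machine =
  fixes d n w H :: nat
  assumes n: "1 \<le> n" and d: "3 \<le> d" and word: "16 * modulus d n + 16 * H + 16 \<le> 2 ^ w"
begin

abbreviation "M \<equiv> modulus d n"

lemma w_pos: "0 < w"
  using word by (cases w) auto

definition tables_ok :: "(nat \<Rightarrow> nat) \<Rightarrow> config \<Rightarrow> bool" where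
  "tables_ok f s \<longleftrightarrow>
    (\<forall>r\<in>{3::nat,4,5,7,8,9,10,11}. reg s r = (if r = 3 then n else if r = 4 then side n else if r = 5 then M
       else if r = 7 then 2 * side n else if r = 8 then 8 else if r = 9 then 1 else if r = 10 then 3
       else 2 * M + 1)) \<and>
    (\<forall>p. f p < M) \<and>
    reg s 6 = hit_count d n f \<and>
    (\<forall>p<n. mem s (p * 8 + 3) = f p) \<and>
    (\<forall>g<3. \<forall>y<M. mem s (y * 8 + g) = table f (group n g) y)"

definition timeline_ok :: "timeline \<Rightarrow> config \<Rightarrow> bool" where
  "timeline_ok \<tau> s \<longleftrightarrow> finite (dom \<tau>) \<and> dom \<tau> \<subseteq> {..<H} \<and> ran \<tau> \<subseteq> updates (triple_problem d) n \<and>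
    (\<forall>t p v. \<tau> t = Some [p, v] \<longrightarrow> mem s (t * 8 + 4) = p \<and> mem s (t * 8 + 5) = v)"

lemma table_le: "table f (group n g) y \<le> n"
  by (rule le_trans[OF table_le_card card_group_le]) simp

lemma M_bounds: "n * (n * n) < M" "n < M" "2 \<le> M" "n * n < M"
proof -
  show *: "n * (n * n) < M" "n < M" "2 \<le> M" using modulus_gt_cube[OF d n] by auto
  have "1 * (n * n) \<le> n * (n * n)" using n by (intro mult_le_mono1)
  then show "n * n < M" using *(1) by linarith
qed

lemma wp_partners_code:
  assumes regs: "reg s 4 = side n" "reg s 5 = M" "reg s 8 = 8" "reg s 10 = 3" "reg s 11 = 2 * M + 1"
      "reg s 13 = a" "reg s 14 = b" "reg s 16 = l" "reg s 17 = g" "reg s 19 = 0" "reg s 20 = 0"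
    and ab: "a < M" "b < M" and g: "g < 3" and l: "l + side n \<le> n"
    and f: "\<And>p. f p < M" "\<And>j. j < side n \<Longrightarrow> mem s ((j + l) * 8 + 3) = f (j + l)"
    and tab: "\<And>y. y < M \<Longrightarrow> mem s (y * 8 + g) = table f (group n g) y"
  shows "wp w partners_code (\<lambda>k s'. k \<le> 22 * side n + 3 \<and> mem s' = mem s \<and>
    (\<forall>r<19. reg s' r = reg s r) \<and>
    reg s' 19 = partners M {l..<l + side n} (group n g) f a \<and>
    reg s' 20 = partners M {l..<l + side n} (group n g) f b) s"
proof -
  define D where "D = 2 * M + 1"
  let ?term = "\<lambda>x j. table f (group n g) ((D - x - f (j + l)) mod M)"
  define I where "I = (\<lambda>j (s' :: config) (e :: nat). e = 0 \<and> mem s' = mem s \<and> (\<forall>r<19. reg s' r = reg s r) \<and>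
    reg s' 19 = (\<Sum>i<j. ?term a i) \<and> reg s' 20 = (\<Sum>i<j. ?term b i))"
  have partners: "(\<Sum>i<side n. ?term x i) = partners M {l..<l + side n} (group n g) f x" for x
    unfolding partners_def D_def[symmetric]
    using sum.shift_bounds_nat_ivl[of "\<lambda>i. table f (group n g) ((D - x - f i) mod M)" 0 l "side n"]
    by (simp add: lessThan_atLeast0 add.commute)
  have "wp w partners_code
    (\<lambda>k s'. reg s' 4 = side n \<and> (\<exists>e'. I (side n) s' e' \<and> k + e' \<le> 0 + (18 + 4) * side n + 3)) s"
    unfolding partners_code_def
  proof (rule wp_for_loop)
    show "I 0 s 0" using regs by (simp add: I_def)
    show "\<And>j s e r v. I j s e \<Longrightarrow> r = 21 \<or> r = 22 \<Longrightarrow> I j (s\<lparr>reg := (reg s)(r := v)\<rparr>) e"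
      by (auto simp: I_def)
    show "side n < 2 ^ w" using word M_bounds side_less[OF n] by linarith
    fix j s' e
    assume j: "j < side n" "I j s' e" "reg s' 21 = j" "reg s' 4 = side n"
    define u where "u = j + l"
    let ?f = "f u"
    \<comment> \<open>A partial sum counts pairs of words, of which there are at most
      \<open>n * n < M\<close>, so the accumulators never wrap around.\<close>
    have bound: "(\<Sum>i<j. ?term x i) + ?term x j \<le> M" for x
    proof -
      have "(\<Sum>i<j. ?term x i) + ?term x j = (\<Sum>i<Suc j. ?term x i)" by simp
      also have "\<dots> \<le> Suc j * n"
        using sum_bounded_above[of "{..<Suc j}" "?term x" n] table_le by simp
      also have "\<dots> \<le> n * n" using j side_less[OF n] by (intro mult_le_mono1) simp
      finally show ?thesis using M_bounds by linarith
    qed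
    have idx: "(D - x - ?f) mod M < M" for x using modulus_pos by simp
    have mems: "mem s' (u * 8 + 3) = ?f"
      "mem s' ((D - x - ?f) mod M * 8 + g) = ?term x j" for x
      using j f tab idx by (auto simp: I_def u_def)
    have regs': "\<forall>r<19. reg s' r = reg s r" using j by (simp add: I_def)
    have rs: "reg s' 5 = M" "reg s' 8 = 8" "reg s' 10 = 3" "reg s' 11 = D"
      "reg s' 13 = a" "reg s' 14 = b" "reg s' 16 = l" "reg s' 17 = g"
      using regs by (simp_all add: regs'[rule_format] D_def)
    have acc: "reg s' 19 = (\<Sum>i<j. ?term a i)" "reg s' 20 = (\<Sum>i<j. ?term b i)"
      using j by (auto simp: I_def)
    have u: "u < M" using j(1) l M_bounds(2) by (simp add: u_def)
    have small: "u < 2 ^ w" "u * 8 < 2 ^ w" "u * 8 + 3 < 2 ^ w"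
      "D < 2 ^ w" 
      using u word by (simp_all add: D_def)
    have small2: "(D - x - ?f) mod M * 8 < 2 ^ w"
      "(D - x - ?f) mod M * 8 + g < 2 ^ w" "D - x < 2 ^ w" for x
      using idx[of x] g word by (simp_all add: D_def)
    have sub: "?f \<le> D - a" "a \<le> D" "?f \<le> D - b" "b \<le> D"
      using ab f(1)[of u] unfolding D_def by linarith+
    have acc_small: "(\<Sum>i<j. ?term x i) + ?term x j < 2 ^ w" for x
      using bound[of x] word by linarith
    show "wp w (seqs
     [Oper 23 Add 21 16, Oper 23 Mul 23 8, Oper 23 Add 23 10, Load 23 23,
      Oper 24 Sub 11 13, Oper 24 Sub 24 23, Oper 24 Mod 24 5, Oper 24 Mul 24 8, Oper 24 Add 24 17,
      Load 24 24, Oper 19 Add 19 24,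
      Oper 24 Sub 11 14, Oper 24 Sub 24 23, Oper 24 Mod 24 5, Oper 24 Mul 24 8, Oper 24 Add 24 17,
      Load 24 24, Oper 20 Add 20 24])
      (\<lambda>k s'. reg s' 21 = j \<and> reg s' 4 = side n \<and> (\<exists>e'. I (Suc j) s' e' \<and> k + e' \<le> e + 18)) s'"
      apply (simp cong: wp_cong add: wp_simps eval_binop_small rs mems small small2 sub acc acc_small j(3,4) u_def[symmetric]
         del: add_mult_distrib add_mult_distrib2 diff_diff_left sum.lessThan_Suc mult_Suc mult_Suc_right)
      using j(2) acc_small[of a] acc_small[of b] by (simp add: I_def u_def eval_binop_small)
  qed (use regs in auto)
  then show ?thesis
    by (rule wp_mono) (auto simp: I_def partners[symmetric])
qed

lemma tables_okD:
  assumes "tables_ok f s"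
  shows "reg s 3 = n" "reg s 4 = side n" "reg s 5 = M" "reg s 7 = 2 * side n" "reg s 8 = 8"
    "reg s 9 = 1" "reg s 10 = 3" "reg s 11 = 2 * M + 1"
  using assms by (simp_all add: tables_ok_def)

text \<open>Swapping or rotating the groups puts the one containing \<open>p\<close> first and a
  small one second; the interval starting at \<open>l\<close> is that small group.\<close>

lemma hit_count_fun_upd:
  assumes f: "\<And>k. f k < M" and v: "v < M" and p: "p < n"
    and g: "g = (if p < side n then 0 else if p < 2 * side n then 1 else 2)"
    and l: "l = (if p < side n then side n else 0)"
    and g': "g' = (if p < 2 * side n then 2 else 1)"
  shows "hit_count d n (f(p := v)) + partners M {l..<l + side n} (group n g') f (f p) =
    hit_count d n f + partners M {l..<l + side n} (group n g') f v"
proof -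
  consider "p < side n" | "side n \<le> p" "p < 2 * side n" | "2 * side n \<le> p" by linarith
  then show ?thesis
  proof cases
    case 1
    then show ?thesis
      using hits_fun_upd[of "group n 0" "group n 1" "group n 2" p M v f] f v M_bounds l g'
      by (simp add: hit_count_def) (simp add: group_def mult_2)
  next
    case 2
    then show ?thesis
      using hits_fun_upd[of "group n 1" "group n 0" "group n 2" p M v f] f v M_bounds l g'
      by (simp add: hit_count_def hits_swap[of _ "group n 0"]) (simp add: group_def lessThan_atLeast0)
  next
    case 3
    then show ?thesis
      using hits_fun_upd[of "group n 2" "group n 0" "group n 1" p M v f] f v M_bounds l g' p
      by (simp add: hit_count_def hits_rotate) (simp add: group_def lessThan_atLeast0)
  qed
qed

lemma hit_count_less: "hit_count d n f < M"
proof -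
  have "hit_count d n f \<le> card (group n 0) * (card (group n 1) * card (group n 2))"
    unfolding hit_count_def by (rule hits_le)
  also have "\<dots> \<le> n * (n * n)" by (intro mult_le_mono card_group_le)
  finally show ?thesis using M_bounds(1) by linarith
qed

lemma partners_less: "l + side n \<le> n \<Longrightarrow> partners M {l..<l + side n} (group n g) f v < M"
proof -
  assume "l + side n \<le> n"
  have "partners M {l..<l + side n} (group n g) f v \<le> card {l..<l + side n} * card (group n g)"
    by (rule partners_le) simp
  also have "\<dots> \<le> n * n" using card_group_le \<open>l + side n \<le> n\<close> by (intro mult_le_mono) auto
  finally show ?thesis using M_bounds(4) by linarith
qed

text \<open>The interleaved arrays are separated by the residue of the address modulo 8.\<close>

lemma address_eq_iff: "i < 8 \<Longrightarrow> j < 8 \<Longrightarrow> (a::nat) * 8 + i = b * 8 + j \<longleftrightarrow> a = b \<and> i = j"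
  by presburger

text \<open>The bound \<open>v \<le> M\<close> is not strict because deleting an increment 0 passes
  \<open>M - 0\<close>.\<close>

lemma wp_select_code:
  assumes ok: "tables_ok f s" and p: "reg s 1 = p" "p < n" and v: "reg s 2 = v" "v \<le> M"
    and g: "g = (if p < side n then 0 else if p < 2 * side n then 1 else 2)"
    and l: "l = (if p < side n then side n else 0)"
    and g': "g' = (if p < 2 * side n then 2 else 1)"
    and b: "b = (f p + v) mod M"
  shows "wp w select_code (\<lambda>k s'. k \<le> 20 \<and> (\<forall>r<12. reg s' r = reg s r) \<and>
    mem s' = (mem s)(p * 8 + 3 := b) \<and> reg s' 13 = f p \<and> reg s' 14 = b \<and> reg s' 15 = g \<and>
    reg s' 16 = l \<and> reg s' 17 = g' \<and> reg s' 19 = 0 \<and> reg s' 20 = 0) s"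
proof -
  note regs = tables_okD[OF ok]
  have pM: "p < M" using p M_bounds by linarith
  have "f p < M" using ok by (simp add: tables_ok_def)
  then have small: "p * 8 < 2 ^ w" "p * 8 + 3 < 2 ^ w" "f p + v < 2 ^ w" "Suc 0 < 2 ^ w" "2 < (2::nat) ^ w"
    using pM word v by linarith+
  have mem: "mem s (p * 8 + 3) = f p" using ok p by (simp add: tables_ok_def)
  show ?thesis
    unfolding select_code_def
    using p v g l g' b small
    by (simp cong: wp_cong add: wp_simps eval_binop_small regs mem w_pos)
qed

text \<open>If \<open>a = b\<close>, the same cell is decremented and incremented again, hence the
  conditional. The lower bound 1 on the entry of the old value makes the decrement exact.\<close>

lemma wp_recount_code:
  assumes regs: "reg s 6 = c" "reg s 9 = 1" "reg s 8 = 8" "reg s 13 = a" "reg s 14 = b" "reg s 15 = g"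
      "reg s 19 = x" "reg s 20 = y"
    and small: "c < M" "x < M" "y < M" "a < M" "b < M" "g < 3" and x: "x \<le> c + y"
    and mem: "1 \<le> mem s (a * 8 + g)" "mem s (a * 8 + g) \<le> M" "mem s (b * 8 + g) \<le> M"
  shows "wp w recount_code (\<lambda>k s'. k = 12 \<and> (\<forall>r<12. r \<noteq> 6 \<longrightarrow> reg s' r = reg s r) \<and>
    reg s' 6 = c + y - x \<and>
    mem s' = (mem s)(a * 8 + g := mem s (a * 8 + g) - 1,
      b * 8 + g := (if a = b then mem s (a * 8 + g) else mem s (b * 8 + g) + 1))) s"
proof -
  have words: "c + y < 2 ^ w" "a * 8 < 2 ^ w" "a * 8 + g < 2 ^ w" "b * 8 < 2 ^ w" "b * 8 + g < 2 ^ w"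
    "mem s (a * 8 + g) < 2 ^ w" "Suc (mem s (b * 8 + g)) < 2 ^ w"
    using small word mem by linarith+
  have eq: "a * 8 + g = b * 8 + g \<longleftrightarrow> a = b" by simp
  show ?thesis
    unfolding recount_code_def using regs x words mem
    by (cases "a = b") (simp_all cong: wp_cong add: wp_simps eval_binop_small)
qed

lemma wp_update_code:
  assumes ok: "tables_ok f s" and p: "reg s 1 = p" "p < n" and v: "reg s 2 = v" "v \<le> M"
  shows "wp w update_code (\<lambda>k s'. k \<le> 40 + 22 * side n \<and>
    tables_ok (f(p := (f p + v) mod M)) s' \<and>
    (\<forall>a i. (i = 4 \<or> i = 5) \<longrightarrow> mem s' (a * 8 + i) = mem s (a * 8 + i))) s"
proof -
  define b where "b = (f p + v) mod M"
  define g where "g = (if p < side n then 0 else if p < 2 * side n then 1 else 2 :: nat)"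
  define g' where "g' = (if p < 2 * side n then 2 else 1 :: nat)"
  define l where "l = (if p < side n then side n else 0)"
  define x where "x = partners M {l..<l + side n} (group n g') f (f p)"
  define y where "y = partners M {l..<l + side n} (group n g') f b"
  note regs = tables_okD[OF ok]
  have fM: "\<And>p. f p < M" and bM: "b < M" using ok modulus_pos by (auto simp: tables_ok_def b_def)
  have l: "l + side n \<le> n" using two_side_le[of n] by (auto simp: l_def)
  have g: "g < 3" "g' < 3" "p \<in> group n g" "\<And>h. h < 3 \<Longrightarrow> h \<noteq> g \<Longrightarrow> p \<notin> group n h"
    using p by (auto simp: g_def g'_def group_def)
  have pl: "p \<notin> {l..<l + side n}" "g' \<noteq> g" by (auto simp: l_def g_def g'_def)
  have count: "hit_count d n (f(p := b)) + x = hit_count d n f + y"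
    unfolding x_def y_def using fM bM p g_def l_def g'_def by (intro hit_count_fun_upd) auto
  have tab: "mem s (y * 8 + h) = table f (group n h) y" if "h < 3" "y < M" for h y
    using ok that by (simp add: tables_ok_def)
  \<comment> \<open>Moving \<open>p\<close> to another value would lower this count by one; so it is
    positive and may be decremented.\<close>
  have "table f (group n g) (f p) = Suc (table (f(p := f p + 1)) (group n g) (f p))"
    using table_fun_upd[OF finite_group g(3), of f "f p + 1" "f p"] by simp
  then have pos: "1 \<le> table f (group n g) (f p)" by simp
  have tabM: "table f (group n h) a \<le> M" for h a
    using table_le[of f h a] M_bounds by linarith
  have xy: "x < M" "y < M" "x \<le> hit_count d n f + y"
    using partners_less[OF l] count by (auto simp: x_def y_def)
  have count6: "reg s 6 = hit_count d n f" using ok by (simp add: tables_ok_def)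
  show ?thesis
    unfolding update_code_def seqs.simps wp_Seq
  proof (rule wp_mono[OF wp_select_code[OF ok p v g_def l_def g'_def b_def]], elim conjE)
    fix k1 :: nat and s1 :: config
    assume s1: "k1 \<le> 20" "\<forall>r<12. reg s1 r = reg s r" "mem s1 = (mem s)(p * 8 + 3 := b)"
      "reg s1 13 = f p" "reg s1 14 = b" "reg s1 15 = g" "reg s1 16 = l" "reg s1 17 = g'"
      "reg s1 19 = 0" "reg s1 20 = 0"
    have mem1: "mem s1 (a * 8 + h) = mem s (a * 8 + h)" if "a \<noteq> p \<or> h \<noteq> 3" "h < 8" for a h
      using that s1(3) address_eq_iff[of h 3 a p] by auto
    \<comment> \<open>The new value is already stored at \<open>p\<close>, but the scanned group
      does not contain \<open>p\<close>, so the pass still sees the old \<open>f\<close>.\<close>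
    have "wp w partners_code (\<lambda>k s'. k \<le> 22 * side n + 3 \<and> mem s' = mem s1 \<and>
      (\<forall>r<19. reg s' r = reg s1 r) \<and> reg s' 19 = x \<and> reg s' 20 = y) s1"
      unfolding x_def y_def
    proof (rule wp_partners_code)
      fix j assume "j < side n"
      then have "j + l \<noteq> p" "j + l < n" using pl l by auto
      then show "mem s1 ((j + l) * 8 + 3) = f (j + l)"
        using ok mem1[of "j + l" 3] by (simp add: tables_ok_def del: distrib_right_numeral)
    qed (use s1 regs fM bM g l tab mem1 in simp_all)
    then show "wp w partners_code (\<lambda>k s'. wp w recount_code (\<lambda>k' s''. k1 + (k + k') \<le> 40 + 22 * side n \<and>
      tables_ok (f(p := (f p + v) mod M)) s'' \<and>
      (\<forall>a i. (i = 4 \<or> i = 5) \<longrightarrow> mem s'' (a * 8 + i) = mem s (a * 8 + i))) s') s1"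
    proof (rule wp_mono, elim conjE)
      fix k2 :: nat and s2 :: config
      assume s2: "k2 \<le> 22 * side n + 3" "mem s2 = mem s1" "\<forall>r<19. reg s2 r = reg s1 r"
        "reg s2 19 = x" "reg s2 20 = y"
      have mem2: "mem s2 (a * 8 + h) = table f (group n h) a" if "a < M" "h < 3" for a h
        using that by (simp add: s2 mem1 tab)
      show "wp w recount_code (\<lambda>k' s''. k1 + (k2 + k') \<le> 40 + 22 * side n \<and>
        tables_ok (f(p := (f p + v) mod M)) s'' \<and>
        (\<forall>a i. (i = 4 \<or> i = 5) \<longrightarrow> mem s'' (a * 8 + i) = mem s (a * 8 + i))) s2"
      proof (rule wp_mono[OF wp_recount_code[where c = "hit_count d n f" and a = "f p" and b = b
              and g = g and x = x and y = y]], goal_cases)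
        case (19 k3 s3)
        then have s3: "k3 = 12" "\<And>r. r < 12 \<Longrightarrow> r \<noteq> 6 \<Longrightarrow> reg s3 r = reg s2 r"
          "reg s3 6 = hit_count d n f + y - x"
          "mem s3 = (mem s2)(f p * 8 + g := mem s2 (f p * 8 + g) - 1,
            b * 8 + g := (if f p = b then mem s2 (f p * 8 + g) else mem s2 (b * 8 + g) + 1))"
          by auto
        have mem3: "mem s3 (a * 8 + h) = mem s2 (a * 8 + h)" if "h \<noteq> g" "h < 8" for a h
          using that g(1) unfolding s3(4) by (simp add: address_eq_iff)
        have own: "mem s3 (a * 8 + g) = table (f(p := b)) (group n g) a" if "a < M" for a
          using that table_fun_upd[OF finite_group g(3), of f b a] pos g(1) fM bM
          unfolding s3(4) by (auto simp: mem2 split: if_splits)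
        have other: "mem s3 (a * 8 + h) = table (f(p := b)) (group n h) a" if "a < M" "h < 3" "h \<noteq> g" for a h
        proof -
          have "table (f(p := b)) (group n h) a = table f (group n h) a"
            using g(4)[OF that(2,3)] by (intro table_cong) auto
          then show ?thesis using that by (simp add: mem3 mem2)
        qed
        have tabs: "mem s3 (a * 8 + h) = table (f(p := b)) (group n h) a" if "a < M" "h < 3" for a h
          using own other that by blast
        have state: "mem s3 (r * 8 + 3) = (f(p := b)) r" if "r < n" for r
          using that ok g(1) s1(3) mem1[of r 3] by (auto simp: mem3 s2(2) tables_ok_def)
        have "tables_ok (f(p := b)) s3"
          unfolding tables_ok_def using s3(2,3) s2(3) s1(2) regs count fM bM tabs state by auto
        moreover have "mem s3 (a * 8 + i) = mem s (a * 8 + i)" if "i = 4 \<or> i = 5" for a i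
          using that g(1) mem1[of a i] by (auto simp: mem3 s2(2))
        ultimately show ?case using s1(1) s2(1) s3(1) by (simp add: b_def)
      qed (use s1 s2 count6 regs fM bM g(1) pos count mem2 tabM hit_count_less xy in simp_all)
    qed
  qed
qed

lemma tables_ok_cong:
  assumes "tables_ok f s" "\<And>r. 3 \<le> r \<Longrightarrow> r < 12 \<Longrightarrow> reg s' r = reg s r"
    and "\<And>a h. h < 4 \<Longrightarrow> mem s' (a * 8 + h) = mem s (a * 8 + h)"
  shows "tables_ok f s'"
  using assms(1) unfolding tables_ok_def by (auto simp: assms(2,3))

definition ds_ok :: "timeline \<Rightarrow> config \<Rightarrow> bool" where
  "ds_ok \<tau> s \<longleftrightarrow> tables_ok (\<lambda>p. cell \<tau> (dom \<tau>) p mod M) s \<and> timeline_ok \<tau> s"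

lemma updates_triple_problem: "u \<in> updates (triple_problem d) n \<longleftrightarrow> (\<exists>p v. u = [p, v] \<and> p < n \<and> v < M)"
  by (simp add: triple_problem_def)

lemma wp_triple_insert_code:
  assumes ok: "ds_ok \<tau> s" and t: "t < H" "t \<notin> dom \<tau>" and u: "[p, v] \<in> updates (triple_problem d) n"
  shows "wp w triple_insert_code (\<lambda>k s'. k \<le> 50 + 22 * side n \<and> ds_ok (\<tau>(t \<mapsto> [p, v])) s')
    (pass_args w [t, p, v] s)"
proof -
  have pv: "p < n" "v < M" using u by (auto simp: updates_triple_problem)
  have tables: "tables_ok (\<lambda>p. cell \<tau> (dom \<tau>) p mod M) s" and timeline: "timeline_ok \<tau> s"
    using ok by (auto simp: ds_ok_def)
  note regs = tables_okD[OF tables]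
  have small: "t < 2 ^ w" "p < 2 ^ w" "v < 2 ^ w" "t * 8 < 2 ^ w" "t * 8 + 3 < 2 ^ w" "t * 8 + 4 < 2 ^ w"
     "t * 8 + 5 < 2 ^ w"
    using t pv M_bounds word by linarith+
  define s1 where "s1 = s\<lparr>reg := (reg s)(0 := t, 1 := p, 2 := v, 12 := t * 8 + 5),
    mem := (mem s)(t * 8 + 4 := p, t * 8 + 5 := v)\<rparr>"
  have args: "pass_args w [t, p, v] s = s\<lparr>reg := (reg s)(0 := t, 1 := p, 2 := v)\<rparr>"
    unfolding pass_args_def using small
    by (auto simp: fun_eq_iff nth_Cons less_Suc_eq numeral_2_eq_2 split: nat.splits)
  have tables1: "tables_ok (\<lambda>p. cell \<tau> (dom \<tau>) p mod M) s1"
  proof (rule tables_ok_cong[OF tables])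
    show "mem s1 (a * 8 + h) = mem s (a * 8 + h)" if "h < 4" for a h
      using that address_eq_iff[of h 4 a t] address_eq_iff[of h 5 a t] by (simp add: s1_def)
  qed (simp add: s1_def)
  have update: "wp w update_code (\<lambda>k s'. k \<le> 44 + 22 * side n \<and> ds_ok (\<tau>(t \<mapsto> [p, v])) s') s1"
  proof (rule wp_mono[OF wp_update_code[OF tables1, of p v]], goal_cases)
    case (5 k s2)
    have "(\<lambda>p. cell \<tau> (dom \<tau>) p mod M)(p := (cell \<tau> (dom \<tau>) p mod M + v) mod M) =
      (\<lambda>r. cell (\<tau>(t \<mapsto> [p, v])) (dom (\<tau>(t \<mapsto> [p, v]))) r mod M)"
      using timeline t(2) by (subst cell_insert) (auto simp: timeline_ok_def fun_eq_iff mod_add_left_eq)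
    moreover have "timeline_ok (\<tau>(t \<mapsto> [p, v])) s2"
      using timeline t(1) u 5 unfolding timeline_ok_def
      by (auto simp: s1_def address_eq_iff ran_def)
    ultimately show ?case using 5 by (auto simp: ds_ok_def)
  qed (use pv in \<open>auto simp: s1_def\<close>)
  have addr: "4 + t * 8 = t * 8 + 4" "5 + t * 8 = t * 8 + 5" by auto
  show ?thesis
    unfolding triple_insert_code_def args
    using update small
    by (simp cong: wp_cong add: wp_simps eval_binop_small regs s1_def addr)
qed

lemma wp_triple_delete_code:
  assumes ok: "ds_ok \<tau> s" and t: "t \<in> dom \<tau>"
  shows "wp w triple_delete_code (\<lambda>k s'. k \<le> 50 + 22 * side n \<and> ds_ok (\<tau>(t := None)) s')
    (pass_args w [t] s)"
proof -
  have tables: "tables_ok (\<lambda>p. cell \<tau> (dom \<tau>) p mod M) s" and timeline: "timeline_ok \<tau> s"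
    using ok by (auto simp: ds_ok_def)
  note regs = tables_okD[OF tables]
  obtain u where "\<tau> t = Some u" "u \<in> updates (triple_problem d) n" "t < H"
    using t timeline by (auto simp: timeline_ok_def ran_def)
  then obtain p v where pv: "\<tau> t = Some [p, v]" "p < n" "v < M" "t < H"
    by (auto simp: updates_triple_problem)
  have mem: "mem s (t * 8 + 4) = p" "mem s (t * 8 + 5) = v"
    using timeline pv by (auto simp: timeline_ok_def)
  have small: "t < 2 ^ w" "M < 2 ^ w" "t * 8 < 2 ^ w" "t * 8 + 3 < 2 ^ w" "t * 8 + 4 < 2 ^ w"
     "t * 8 + 5 < 2 ^ w"
    using pv M_bounds word by linarith+
  define s1 where "s1 = s\<lparr>reg := (reg s)(0 := t, 1 := p, 12 := t * 8 + 5, 2 := M - v)\<rparr>"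
  have args: "pass_args w [t] s = s\<lparr>reg := (reg s)(0 := t)\<rparr>"
    unfolding pass_args_def using small by (auto simp: fun_eq_iff)
  have tables1: "tables_ok (\<lambda>p. cell \<tau> (dom \<tau>) p mod M) s1"
    by (rule tables_ok_cong[OF tables]) (auto simp: s1_def)
  have update: "wp w update_code (\<lambda>k s'. k \<le> 43 + 22 * side n \<and> ds_ok (\<tau>(t := None)) s') s1"
  proof (rule wp_mono[OF wp_update_code[OF tables1, of p "M - v"]], goal_cases)
    case (5 k s2)
    let ?c = "cell (\<tau>(t := None)) (dom (\<tau>(t := None)))"
    have c: "cell \<tau> (dom \<tau>) = ?c(p := ?c p + v)"
      using timeline pv by (intro cell_delete) (auto simp: timeline_ok_def)
    have "((?c p + v) mod M + (M - v)) mod M = (?c p + v + (M - v)) mod M" by (rule mod_add_left_eq)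
    then have "((?c p + v) mod M + (M - v)) mod M = ?c p mod M" using pv by simp
    then have "(\<lambda>p. cell \<tau> (dom \<tau>) p mod M)(p := (cell \<tau> (dom \<tau>) p mod M + (M - v)) mod M) =
      (\<lambda>r. ?c r mod M)"
      unfolding c by (auto simp: fun_eq_iff)
    moreover have "timeline_ok (\<tau>(t := None)) s2"
      using timeline 5 unfolding timeline_ok_def
      by (auto simp: s1_def ran_def)
    ultimately show ?case using 5 by (auto simp: ds_ok_def)
  qed (use pv in \<open>auto simp: s1_def\<close>)
  have addr: "4 + t * 8 = t * 8 + 4" "5 + t * 8 = t * 8 + 5" by auto
  show ?thesis
    unfolding triple_delete_code_def args
    using update small pv(3)
    by (simp cong: wp_cong add: wp_simps eval_binop_small regs s1_def addr mem)
qed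

lemma serves_triple_implementation:
  assumes "list_all partial_op xs" "legal_ops (triple_problem d) n m H \<tau> xs" "ds_ok \<tau> s"
  shows "\<exists>ks. serves (triple_problem d) (triple_implementation d) w n \<tau> s xs ks \<and>
    (\<forall>k\<in>set ks. k \<le> 50 + 22 * side n)"
  using assms
proof (induction xs arbitrary: \<tau> s)
  case Nil
  then show ?case by (intro exI[of _ "[]"]) simp
next
  case (Cons x xs)
  have "\<exists>k s'. exec w (op_code (triple_implementation d) x) (pass_args w (op_args x) s) k s' \<and>
    answered (triple_problem d) n \<tau> x (reg s' 0) \<and> ds_ok (timeline_after x \<tau>) s' \<and> k \<le> 50 + 22 * side n"
  proof (cases x)
    case (Insert t u)
    then obtain p v where u: "u = [p, v]" "[p, v] \<in> updates (triple_problem d) n" "t < H" "t \<notin> dom \<tau>"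
      using Cons.prems by (auto simp: updates_triple_problem)
    show ?thesis
      using wp_triple_insert_code[OF Cons.prems(3) u(3,4,2)] Insert u(1)
      by (auto simp: wp_def triple_implementation_def)
  next
    case (Delete t)
    then show ?thesis
      using wp_triple_delete_code[OF Cons.prems(3)] Cons.prems(2)
      by (fastforce simp: wp_def triple_implementation_def)
  next
    case (Query_Present q)
    then have q: "q = []" using Cons.prems by (simp add: triple_problem_def)
    have "answer (triple_problem d) q (present_state (triple_problem d) n \<tau>) = reg s 6"
      using Cons.prems(3)
      by (subst answer_present_state) (auto simp: ds_ok_def timeline_ok_def tables_ok_def)
    moreover have "ds_ok \<tau> (s\<lparr>reg := (reg s)(0 := reg s 6)\<rparr>)"
      using Cons.prems(3) by (auto simp: ds_ok_def timeline_ok_def intro: tables_ok_cong)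
    ultimately have "wp w triple_query_code (\<lambda>k s'.
        answered (triple_problem d) n \<tau> x (reg s' 0) \<and> ds_ok (timeline_after x \<tau>) s' \<and>
        k \<le> 50 + 22 * side n) (pass_args w q s)"
      by (simp add: triple_query_code_def wp_simps eval_binop_small pass_args_def q Query_Present)
    then show ?thesis
      using Query_Present by (auto simp: wp_def triple_implementation_def)
  next
    case (Query_Prefix t q)
    then show ?thesis using Cons.prems by simp
  qed
  then obtain k s' where *: "exec w (op_code (triple_implementation d) x) (pass_args w (op_args x) s) k s'"
    "answered (triple_problem d) n \<tau> x (reg s' 0)" "ds_ok (timeline_after x \<tau>) s'" "k \<le> 50 + 22 * side n"
    by blast
  from Cons.IH[OF _ _ *(3)] Cons.prems obtain ks where
    "serves (triple_problem d) (triple_implementation d) w n (timeline_after x \<tau>) s' xs ks"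
    "\<forall>k\<in>set ks. k \<le> 50 + 22 * side n" by auto
  with * show ?case by (intro exI[of _ "k # ks"]) auto
qed

lemma wp_triple_init_code:
  "wp w (triple_init_code d) (\<lambda>k s. k \<le> 10 * n + d + 30 \<and> ds_ok Map.empty s) (start_config w n [])"
proof -
  have n_small: "n < 2 ^ w" "n + 1 < 2 ^ w" "4 * n * n < 2 ^ w" using M_bounds word unfolding mult.assoc by linarith+
  have small: "2 * side n < 2 ^ w" "side n + side n < 2 ^ w" "M + M < 2 ^ w" "M + M + 1 < 2 ^ w"
     "M < 2 ^ w" "3 < (2::nat) ^ w" "8 < (2::nat) ^ w"
    using two_side_le[of n] M_bounds word by linarith+
  have ok: "ds_ok Map.empty s" if
    "reg s 3 = n" "reg s 4 = side n" "reg s 5 = M" "reg s 6 = 0" "reg s 7 = 2 * side n"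
    "reg s 8 = 8" "reg s 9 = 1" "reg s 10 = 3" "reg s 11 = 2 * M + 1"
    "mem s = (\<lambda>_. 0)(0 := side n, 1 := side n, 2 := n - 2 * side n)" for s
  proof -
    have cards: "table (\<lambda>_. 0) (group n g) y = (if y = 0 then card (group n g) else 0)" for g y
      by (simp add: table_def)
    have "mem s (y * 8 + g) = table (\<lambda>_. 0) (group n g) y" if "g < 3" for g y
      using that \<open>mem s = _\<close> unfolding cards by (auto simp: group_def)
    moreover have "mem s (p * 8 + 3) = 0" for p
      using \<open>mem s = _\<close> by auto
    moreover have "hit_count d n (\<lambda>_. 0) = 0" by (simp add: hit_count_def hits_def)
    ultimately show ?thesis
      using that modulus_pos by (simp add: ds_ok_def timeline_ok_def tables_ok_def cell_def)
  qed
  show ?thesis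
    unfolding triple_init_code_def seqs.simps
  proof (subst wp_Seq, subst wp_Oper, subst wp_Seq, rule wp_mono[OF wp_side_code[OF _ _ n n_small(3)]], goal_cases)
    case (3 k1 s1)
    then have s1: "k1 \<le> 10 * n + 3" "mem s1 = (\<lambda>_. 0)" "reg s1 4 = side n" "reg s1 3 = n"
      by (auto simp: start_config_def eval_binop_small n_small)
    have s1_6: "reg s1 6 = 0" using 3 by (simp add: start_config_def)
    have pow: "(n + 1) ^ d = M" by (simp add: modulus_def)
    show ?case
      using n_small small two_side_le[of n]
      apply (simp cong: wp_cong add: wp_simps eval_binop_small s1 w_pos)
      apply (rule wp_power_code)
       apply simp
      apply (simp cong: wp_cong add: wp_simps eval_binop_small s1 w_pos pow[simplified])
      apply (intro conjI)
      using s1(1) apply simp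
      apply (rule ok)
      apply (auto simp: s1 s1_6 numeral_2_eq_2 mult_2)
      done
  qed (auto simp: start_config_def eval_binop_small n_small)
qed

end

section \<open>The operation time in terms of the square root of n\<close>

lemma side_le_sqrt: "real (side n) \<le> sqrt (real n)"
proof -
  have "4 * side n * side n \<le> n" using le_side_iff by blast
  then have "side n ^ 2 \<le> n" by (simp add: power2_eq_square)
  then have "real (side n) ^ 2 \<le> real n" by (metis of_nat_le_iff of_nat_power)
  then show ?thesis by (rule real_le_rsqrt)
qed

lemma partially_retroactive_triple_problem:
  assumes "3 \<le> d" "1 \<le> h"
  shows "partially_retroactive (triple_problem d) h (triple_implementation d) (d + h + 6)
    (\<lambda>n. (100 + real d) * (sqrt (real n) + 1))"
  unfolding partially_retroactive_def
proof (intro allI impI, elim conjE)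
  fix n m xs
  assume n: "1 \<le> n" and xs: "list_all partial_op xs"
    "legal_ops (triple_problem d) n m (max n m ^ h) Map.empty xs"
  define N where "N = max n m"
  define w where "w = word_size (d + h + 6) N"
  have "1 \<le> N" "n \<le> N" using n by (auto simp: N_def)
  interpret triple_machine d n w "N ^ h"
  proof
    \<comment> \<open>In the word factor \<open>d + h + 6\<close>, the part \<open>d + h\<close>
      pays for the modulus and for the range \<open>N ^ h\<close> of the times; the 6 contributes a
      factor \<open>2 ^ 6 = 64\<close>, more than the \<open>3 * 16\<close> needed.\<close>
    have "modulus d n \<le> (N + 1) ^ d" unfolding modulus_def using \<open>n \<le> N\<close> by (intro power_mono) auto
    also have "\<dots> \<le> (N + 1) ^ (d + h)" by (intro power_increasing) auto
    finally have 1: "modulus d n \<le> (N + 1) ^ (d + h)" .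
    have "N ^ h \<le> (N + 1) ^ h" by (intro power_mono) auto
    also have "\<dots> \<le> (N + 1) ^ (d + h)" by (intro power_increasing) auto
    finally have 2: "N ^ h \<le> (N + 1) ^ (d + h)" .
    have 3: "1 \<le> (N + 1) ^ (d + h)" by simp
    have "2 ^ 6 \<le> (N + 1) ^ 6" using \<open>1 \<le> N\<close> by (intro power_mono) auto
    then have "64 * (N + 1) ^ (d + h) \<le> (N + 1) ^ 6 * (N + 1) ^ (d + h)" by (intro mult_le_mono1) simp
    also have "\<dots> = (N + 1) ^ (d + h + 6)" by (simp add: power_add)
    also have "\<dots> \<le> 2 ^ w" unfolding w_def by (rule word_size_ge)
    finally show "16 * modulus d n + 16 * N ^ h + 16 \<le> 2 ^ w" using 1 2 3 by linarith
  qed (use n assms in auto)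
  obtain k s where s: "exec w (triple_init_code d) (start_config w n []) k s" "k \<le> 10 * n + d + 30"
    "ds_ok Map.empty s"
    using wp_triple_init_code by (auto simp: wp_def)
  obtain ks where ks: "serves (triple_problem d) (triple_implementation d) w n Map.empty s xs ks"
    "\<forall>k\<in>set ks. k \<le> 50 + 22 * side n"
    using serves_triple_implementation[OF xs(1) _ s(3)] xs(2) unfolding N_def by blast
  have start: "serves_from_start (triple_problem d) (triple_implementation d) w n xs k ks"
    unfolding serves_from_start_def using s(1) ks(1) by (auto simp: triple_implementation_def)
  have "real k \<le> (100 + real d) * 1 * real n"
  proof -
    have "d * 1 \<le> d * n" using n by (intro mult_le_mono2)
    then have "k \<le> (100 + d) * n" using s(2) n unfolding add_mult_distrib by linarith
    then have "real k \<le> real ((100 + d) * n)" by (simp only: of_nat_le_iff)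
    then show ?thesis by simp
  qed
  also have "\<dots> \<le> (100 + real d) * (sqrt (real n) + 1) * real n"
    by (intro mult_right_mono mult_left_mono) auto
  finally have 1: "real k \<le> (100 + real d) * (sqrt (real n) + 1) * real n" .
  have "real k' \<le> (100 + real d) * (sqrt (real n) + 1)" if "k' \<in> set ks" for k'
  proof -
    have "k' \<le> 50 + 22 * side n" using that ks(2) by blast
    then have "real k' \<le> real (50 + 22 * side n)" by (simp only: of_nat_le_iff)
    then have "real k' \<le> 100 * (sqrt (real n) + 1)" using side_le_sqrt[of n] by simp
    also have "\<dots> \<le> (100 + real d) * (sqrt (real n) + 1)" by (intro mult_right_mono) auto
    finally show ?thesis .
  qed
  with 1 start show "\<exists>k ks. serves_from_start (triple_problem d) (triple_implementation d)
      (word_size (d + h + 6) (max n m)) n xs k ks \<and>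
      real k \<le> (100 + real d) * (sqrt (real n) + 1) * real n \<and>
      (\<forall>k'\<in>set ks. real k' \<le> (100 + real d) * (sqrt (real n) + 1))"
    unfolding w_def N_def by blast
qed

lemma time_bound_sqrt: "(\<lambda>n. (100 + real d) * (sqrt (real n) + 1)) \<in> O(\<lambda>n. sqrt (real n))"
proof (rule bigoI[of _ "(100 + real d) * 2"])
  show "\<forall>\<^sub>F n in sequentially. norm ((100 + real d) * (sqrt (real n) + 1)) \<le>
      (100 + real d) * 2 * norm (sqrt (real n))"
    using eventually_ge_at_top[of 1]
  proof eventually_elim
    case (elim n)
    then have "1 \<le> sqrt (real n)" by simp
    then have "(100 + real d) * (sqrt (real n) + 1) \<le> (100 + real d) * (2 * sqrt (real n))"
      by (intro mult_left_mono) auto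
    then show ?case by (simp add: algebra_simps)
  qed
qed

section \<open>Embedding programs into a machine with larger words\<close>

fun truncated_op :: "binop \<Rightarrow> bool" where
  "truncated_op Add = True"
| "truncated_op Sub = True"
| "truncated_op Mul = True"
| "truncated_op Shl = True"
| "truncated_op _ = False"

text \<open>
  A program for word size \<open>w\<close> runs on a machine with larger words: register \<open>r\<close> becomes \<open>r + 40\<close>,
  addresses are shifted by register 39, and register 38 contains \<open>2 ^ w\<close>. Comparisons yield 1 even
  for \<open>w = 0\<close>, so they must not be reduced modulo \<open>2 ^ w\<close>.
\<close>

fun embed :: "com \<Rightarrow> com" where
  "embed Skip = Skip"
| "embed (Const r a) = Seq (Const (r + 40) a) (Oper (r + 40) Mod (r + 40) 38)"
| "embed (Oper r f x y) = Seq (Oper (r + 40) f (x + 40) (y + 40))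
     (if truncated_op f then Oper (r + 40) Mod (r + 40) 38 else Skip)"
| "embed (Load r x) = Seq (Oper 37 Add (x + 40) 39) (Load (r + 40) 37)"
| "embed (Store x y) = Seq (Oper 37 Add (x + 40) 39) (Store 37 (y + 40))"
| "embed (Seq p q) = Seq (embed p) (embed q)"
| "embed (If x p q) = If (x + 40) (embed p) (embed q)"
| "embed (While x p) = While (x + 40) (embed p)"

text \<open>For \<open>w = 0\<close> a comparison can still put 1 into a register, which may then be
  used as an address or stored. The exponent \<open>max w 1\<close> bounds words and addresses in
  this case too.\<close>

definition sim :: "nat \<Rightarrow> nat \<Rightarrow> config \<Rightarrow> config \<Rightarrow> bool" where
  "sim w B s \<sigma> \<longleftrightarrow>
    (\<forall>r. reg \<sigma> (r + 40) = reg s r \<and> reg s r < 2 ^ max w 1) \<and>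
    (\<forall>a<2 ^ max w 1. mem \<sigma> (a + B) = mem s a \<and> mem s a < 2 ^ max w 1) \<and>
    reg \<sigma> 38 = 2 ^ w \<and> reg \<sigma> 39 = B"

text \<open>What the simulation leaves untouched: the registers of the host below the scratch
  register 37, and the memory in front of the simulated one.\<close>

definition frame :: "nat \<Rightarrow> config \<Rightarrow> config \<Rightarrow> bool" where
  "frame B \<sigma> \<sigma>' \<longleftrightarrow> (\<forall>r<37. reg \<sigma>' r = reg \<sigma> r) \<and> (\<forall>a<B. mem \<sigma>' a = mem \<sigma> a)"

lemma frame_refl: "frame B \<sigma> \<sigma>"
  by (simp add: frame_def)

lemma frame_trans: "frame B \<sigma> \<sigma>' \<Longrightarrow> frame B \<sigma>' \<sigma>'' \<Longrightarrow> frame B \<sigma> \<sigma>''"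
  by (simp add: frame_def)

text \<open>\<open>2 ^ w\<close> divides \<open>2 ^ v\<close>, so reducing modulo the larger power
  first does no harm.\<close>

lemma eval_binop_truncated:
  assumes "w \<le> v" "truncated_op f"
  shows "eval_binop v f a b mod 2 ^ w = eval_binop w f a b"
proof -
  have dvd: "(2::nat) ^ w dvd 2 ^ v" "(2::int) ^ w dvd 2 ^ v" using assms by (simp_all add: le_imp_power_dvd)
  have "nat (x mod 2 ^ v) mod 2 ^ w = nat (x mod 2 ^ w)" for x :: int
  proof -
    have "nat (x mod 2 ^ v) mod 2 ^ w = nat ((x mod 2 ^ v) mod 2 ^ w)"
      by (simp add: nat_mod_distrib nat_power_eq)
    then show ?thesis using dvd by (simp add: mod_mod_cancel)
  qed
  then show ?thesis
    using assms(2) dvd by (cases f) (simp_all add: eval_binop.simps mod_mod_cancel)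
qed

text \<open>The remaining operations ignore the word size and do not exceed \<open>u\<close> bits;
  \<open>1 \<le> u\<close> is for the results of comparisons.\<close>

lemma eval_binop_not_truncated:
  assumes "\<not> truncated_op f" "a < 2 ^ u" "b < 2 ^ u" "1 \<le> u"
  shows "eval_binop v f a b = eval_binop w f a b" "eval_binop w f a b < 2 ^ u"
proof -
  show "eval_binop v f a b = eval_binop w f a b"
    using assms(1) by (cases f) (simp_all add: eval_binop.simps)
  have ab: "take_bit u a = a" "take_bit u b = b" using assms by (simp_all add: take_bit_nat_eq_self)
  have bits: "x < 2 ^ u" if "take_bit u x = x" for x :: nat
    using that by (metis take_bit_nat_less_exp)
  have "a div x < 2 ^ u" "a mod x < 2 ^ u" for x
    using assms(2) div_le_dividend[of a x] mod_less_eq_dividend[of a x] by linarith+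
  moreover have "and a b < 2 ^ u" "or a b < 2 ^ u" "xor a b < 2 ^ u"
    by (rule bits, simp add: ab take_bit_and take_bit_or take_bit_xor)+
  moreover have "(1::nat) < 2 ^ u" using assms(4) one_less_power[of "2::nat" u] by simp
  ultimately show "eval_binop w f a b < 2 ^ u"
    using assms(1) by (cases f) (simp_all add: eval_binop.simps)
qed

text \<open>Induction on the execution. Every instruction becomes at most two, and tests remain
  single steps, which gives the factor 2.\<close>

lemma exec_embed:
  assumes "exec w p s k s'" "sim w B s \<sigma>" "w \<le> v" "2 ^ max w 1 + B \<le> 2 ^ v"
  shows "wp v (embed p) (\<lambda>k' \<sigma>'. k' \<le> 2 * k \<and> sim w B s' \<sigma>' \<and> frame B \<sigma> \<sigma>') \<sigma>"
  using assms(1,2)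
proof (induction arbitrary: \<sigma>)
  case (Skip s)
  then show ?case by (simp add: wp_simps frame_refl)
next
  case (Const r a s)
  have "a mod 2 ^ v mod 2 ^ w = a mod 2 ^ w"
    using assms(3) by (simp add: mod_mod_cancel le_imp_power_dvd)
  moreover have "a mod 2 ^ w < 2 ^ max w 1"
    by (rule less_le_trans[of _ "2 ^ w"]) simp_all
  ultimately show ?case
    using Const by (auto simp: wp_simps eval_binop_small sim_def frame_def)
next
  case (Oper r f x y s)
  have xy: "reg \<sigma> (x + 40) = reg s x" "reg \<sigma> (y + 40) = reg s y" "reg s x < 2 ^ max w 1" "reg s y < 2 ^ max w 1"
    "reg \<sigma> 38 = 2 ^ w"
    using Oper by (auto simp: sim_def)
  show ?case
  proof (cases "truncated_op f")
    case True
    have "eval_binop w f (reg s x) (reg s y) < 2 ^ w"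
      using eval_binop_truncated[OF order_refl True, of w "reg s x" "reg s y"]
      by (metis mod_less_divisor zero_less_numeral zero_less_power)
    then have "eval_binop w f (reg s x) (reg s y) < 2 ^ max w 1"
      by (rule less_le_trans) simp
    then show ?thesis
      using Oper True xy eval_binop_truncated[OF assms(3) True]
      by (auto simp: wp_simps eval_binop_small sim_def frame_def)
  next
    case False
    then show ?thesis
      using Oper xy eval_binop_not_truncated[OF False xy(3,4)]
      by (auto simp: wp_simps sim_def frame_def)
  qed
next
  case (Load r x s)
  have "reg s x < 2 ^ max w 1" using Load by (auto simp: sim_def)
  then have "reg s x + B < 2 ^ v" using assms(4) by linarith
  then show ?case
    using Load by (auto simp: wp_simps eval_binop_small sim_def frame_def)
next
  case (Store x y s)
  have "reg s x < 2 ^ max w 1" using Store by (auto simp: sim_def)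
  then have "reg s x + B < 2 ^ v" using assms(4) by linarith
  then show ?case
    using Store by (auto simp: wp_simps eval_binop_small sim_def frame_def)
next
  case (Seq p s k s' p' k' s'')
  show ?case
    unfolding embed.simps wp_Seq
    by (rule wp_mono[OF Seq.IH(1)[OF Seq.prems]], elim conjE, rule wp_mono[OF Seq.IH(2)])
       (auto intro: frame_trans)
next
  case (IfTrue s x p k s' p')
  then show ?case
    using wp_mono[OF IfTrue.IH[OF IfTrue.prems]] by (auto simp: wp_If sim_def)
next
  case (IfFalse s x p' k s' p)
  then show ?case
    using wp_mono[OF IfFalse.IH[OF IfFalse.prems]] by (auto simp: wp_If sim_def)
next
  case (WhileFalse s x p)
  then show ?case by (auto intro!: wp_WhileFalse simp: sim_def frame_refl)
next
  case (WhileTrue s x p k s' k' s'')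
  have "reg \<sigma> (x + 40) \<noteq> 0" using WhileTrue by (auto simp: sim_def)
  then show ?case
    unfolding embed.simps
    by (rule wp_WhileTrue, intro wp_mono[OF WhileTrue.IH(1)[OF WhileTrue.prems]])
       (elim conjE, rule wp_mono[OF WhileTrue.IH(2)[unfolded embed.simps]], auto intro: frame_trans)
qed

section \<open>Running the implementation inside a 3-SUM program\<close>

definition timeline_after_ops :: "retro_op list \<Rightarrow> timeline \<Rightarrow> timeline" where
  "timeline_after_ops = fold timeline_after"

fun nonzero_answer :: "ds_problem \<Rightarrow> nat \<Rightarrow> timeline \<Rightarrow> retro_op \<Rightarrow> bool" where
  "nonzero_answer P n \<tau> (Query_Prefix t q) \<longleftrightarrow> answer P q (prefix_state P n \<tau> t) \<noteq> 0"
| "nonzero_answer P n \<tau> _ \<longleftrightarrow> False"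

fun some_nonzero :: "ds_problem \<Rightarrow> nat \<Rightarrow> timeline \<Rightarrow> retro_op list \<Rightarrow> bool" where
  "some_nonzero P n \<tau> [] \<longleftrightarrow> False"
| "some_nonzero P n \<tau> (x # xs) \<longleftrightarrow>
     nonzero_answer P n \<tau> x \<or> some_nonzero P n (timeline_after x \<tau>) xs"

text \<open>Times below \<open>s\<close> are reserved for the current block of \<open>Y\<close>, the
  next \<open>N\<close> load \<open>Z\<close>, and the last \<open>g * s\<close> hold the
  differences of \<open>X\<close>. Prefix queries exclude their own time, so
  \<open>s + N + (i * s + s)\<close> sees precisely the blocks 0 to \<open>i\<close>, whose
  differences add up to block \<open>i\<close>.\<close>

definition reduction_ops ::
    "nat \<Rightarrow> nat \<Rightarrow> nat \<Rightarrow> nat \<Rightarrow> (nat \<Rightarrow> nat) \<Rightarrow> (nat \<Rightarrow> nat) \<Rightarrow> (nat \<Rightarrow> nat) \<Rightarrow> retro_op list" where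
  "reduction_ops N s g M X Y Z =
     map (\<lambda>i. Insert (s + i) [s + i + s, Z i]) [0..<N] @
     map (\<lambda>r. Insert (s + N + r) [r mod s, if r < s then X r else (X r + M - X (r - s)) mod M]) [0..<g * s] @
     concat (map (\<lambda>j.
       map (\<lambda>p. Insert p [s + p, Y (j * s + p)]) [0..<s] @
       map (\<lambda>i. Query_Prefix (s + N + (i * s + s)) []) [0..<g] @
       map Delete [0..<s]) [0..<g])"

text \<open>Reducing by register 38, which holds \<open>2 ^ w\<close>, reproduces the truncation of
  arguments in \<open>pass_args\<close>; registers 40 to 42 are the simulated registers 0 to
  2.\<close>

definition insert_call :: "implementation \<Rightarrow> register \<Rightarrow> register \<Rightarrow> register \<Rightarrow> com" where
  "insert_call D t p x = seqs [Oper 40 Mod t 38, Oper 41 Mod p 38, Oper 42 Mod x 38, embed (insert_code D)]"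

definition delete_call :: "implementation \<Rightarrow> register \<Rightarrow> com" where
  "delete_call D t = Seq (Oper 40 Mod t 38) (embed (delete_code D))"

definition query_call :: "implementation \<Rightarrow> register \<Rightarrow> com" where
  "query_call D t = seqs [Oper 40 Mod t 38, embed (query_code D), If 40 (Const 0 1) Skip]"

text \<open>
  Registers of the reduction: 0 verdict, 1 \<open>N\<close>, 3 \<open>n\<close>, 4 side of \<open>n\<close>, 5 modulus, 6--8 offsets that
  turn the integers in the three sets into state entries, 9 number of blocks \<open>g\<close>, 10 \<open>g * s\<close>,
  11 \<open>s + N\<close>.
\<close>

definition Z_phase :: "implementation \<Rightarrow> com" where
  "Z_phase D = for_loop 12 1 13 (seqs
     [Oper 14 Add 4 12, Oper 15 Add 14 4, Oper 16 Add 12 1, Oper 16 Add 16 1, Load 16 16,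
      Oper 16 Add 16 8, insert_call D 14 15 16])"

definition X_phase :: "implementation \<Rightarrow> com" where
  "X_phase D = for_loop 12 10 13 (seqs
     [Oper 14 Add 11 12, Oper 15 Mod 12 4, Oper 16 Mod 12 1, Load 16 16, Oper 16 Add 16 6,
      Oper 18 Less 12 4,
      If 18 Skip (seqs
        [Oper 17 Sub 12 4, Oper 17 Mod 17 1, Load 17 17, Oper 17 Add 17 6,
         Oper 16 Add 16 5, Oper 16 Sub 16 17, Oper 16 Mod 16 5]),
      insert_call D 14 15 16])"

definition Y_insert_phase :: "implementation \<Rightarrow> com" where
  "Y_insert_phase D = for_loop 12 4 13 (seqs
     [Oper 15 Add 4 12, Oper 16 Add 21 12, Oper 16 Mod 16 1, Oper 16 Add 16 1, Load 16 16,
      Oper 16 Add 16 7, insert_call D 12 15 16])"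

definition query_phase :: "implementation \<Rightarrow> com" where
  "query_phase D = for_loop 12 9 13 (seqs
     [Oper 14 Mul 12 4, Oper 14 Add 14 4, Oper 14 Add 11 14, query_call D 14])"

definition Y_delete_phase :: "implementation \<Rightarrow> com" where
  "Y_delete_phase D = for_loop 12 4 13 (delete_call D 12)"

definition Y_phase :: "implementation \<Rightarrow> com" where
  "Y_phase D = for_loop 19 9 20 (seqs
     [Oper 21 Mul 19 4, Y_insert_phase D, query_phase D, Y_delete_phase D])"

definition phases_code :: "implementation \<Rightarrow> com" where
  "phases_code D = seqs [Z_phase D, X_phase D, Y_phase D]"

text \<open>\<open>G\<close> stands for the verdict to be reached. The offsets act modulo
  \<open>2 ^ v\<close>, so they also convert negative inputs in two's complement. \<open>X\<close>
  and \<open>Y\<close> read the input cyclically, which completes the last block with elements from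
  the beginning.\<close>

locale driver =
  fixes P :: ds_problem and D :: implementation and w v N n s g M xo yo zo :: nat
    and X Y Z :: "nat \<Rightarrow> nat" and inp :: "nat \<Rightarrow> nat" and G :: bool
  assumes v: "2 ^ w + 100 * M + 100 * n + 100 * N \<le> 2 ^ v" and wv: "w \<le> v" and v1: "1 < v"
    and s: "1 \<le> s" "2 * s \<le> n" and N: "1 \<le> N" and g: "g \<le> n" "g * s \<le> N + s"
    and X: "\<And>r. (inp (r mod N) + xo) mod 2 ^ v = X r" "\<And>r. X r < M"
    and Y: "\<And>r. (inp (r mod N + N) + yo) mod 2 ^ v = Y r"
    and Z: "\<And>i. i < N \<Longrightarrow> (inp (i + N + N) + zo) mod 2 ^ v = Z i"
begin

abbreviation "B \<equiv> 3 * N"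

definition layout :: "config \<Rightarrow> bool" where
  "layout \<sigma> \<longleftrightarrow> reg \<sigma> 1 = N \<and> reg \<sigma> 4 = s \<and> reg \<sigma> 5 = M \<and> reg \<sigma> 6 = xo \<and>
     reg \<sigma> 7 = yo \<and> reg \<sigma> 8 = zo \<and> reg \<sigma> 9 = g \<and> reg \<sigma> 10 = g * s \<and>
     reg \<sigma> 11 = s + N \<and> (\<forall>a<B. mem \<sigma> a = inp a)"

text \<open>The credit \<open>e\<close> is twice the running time of the outstanding operations,
  since embedding doubles it. The invariant behind the verdict: \<open>G\<close> holds iff a nonzero
  answer was already seen or is still to come.\<close>

definition pending :: "retro_op list \<Rightarrow> config \<Rightarrow> nat \<Rightarrow> bool" where
  "pending xs \<sigma> e \<longleftrightarrow> layout \<sigma> \<and> (\<exists>\<tau> c ks. sim w B c \<sigma> \<and> serves P D w n \<tau> c xs ks \<and>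
     e = 2 * sum_list ks \<and> reg \<sigma> 0 \<le> 1 \<and> (reg \<sigma> 0 \<noteq> 0 \<or> some_nonzero P n \<tau> xs \<longleftrightarrow> G))"

lemma pendingI:
  assumes "layout \<sigma>" "sim w B c \<sigma>" "serves P D w n \<tau> c xs ks" "e = 2 * sum_list ks" "reg \<sigma> 0 \<le> 1"
    "reg \<sigma> 0 \<noteq> 0 \<or> some_nonzero P n \<tau> xs \<longleftrightarrow> G"
  shows "pending xs \<sigma> e"
  using assms unfolding pending_def by blast

lemma pending_cong:
  assumes "pending xs \<sigma> e" "\<And>r. r < 12 \<or> r \<ge> 37 \<Longrightarrow> reg \<sigma>' r = reg \<sigma> r" "mem \<sigma>' = mem \<sigma>"
  shows "pending xs \<sigma>' e"
  using assms(1) unfolding pending_def layout_def sim_def by (simp add: assms(2,3))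

lemma pending_upd: "pending xs \<sigma> e \<Longrightarrow> 12 \<le> r \<Longrightarrow> r < 37 \<Longrightarrow> pending xs (\<sigma>\<lparr>reg := (reg \<sigma>)(r := x)\<rparr>) e"
  by (rule pending_cong) auto

lemma pendingD:
  assumes "pending xs \<sigma> e"
  shows "reg \<sigma> 1 = N" "reg \<sigma> (Suc 0) = N" "reg \<sigma> 4 = s" "reg \<sigma> 5 = M" "reg \<sigma> 6 = xo" "reg \<sigma> 7 = yo"
    "reg \<sigma> 8 = zo" "reg \<sigma> 9 = g" "reg \<sigma> 10 = g * s" "reg \<sigma> 11 = s + N"
    "\<And>a. a < B \<Longrightarrow> mem \<sigma> a = inp a" "reg \<sigma> 38 = 2 ^ w"
  using assms by (auto simp: pending_def layout_def sim_def)

lemma memory_fits: "2 ^ max w 1 + B \<le> 2 ^ v"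
proof (cases "w = 0")
  case True
  then show ?thesis using v N by simp
next
  case False
  then have "max w 1 = w" by simp
  then show ?thesis using v by simp
qed

text \<open>Here \<sigma>\<open>'\<close> is \<sigma> after loading the arguments. The equivalence
  with \<open>G\<close> is handed back in its old form, because the callers differ in how they
  continue it: only a query may change register 0.\<close>

lemma wp_op:
  assumes "pending (x # xs) \<sigma> e" "full_op x"
    and args: "\<And>r. r < length (op_args x) \<Longrightarrow> reg \<sigma>' (r + 40) = op_args x ! r mod 2 ^ w"
      "\<And>r. r \<ge> length (op_args x) \<Longrightarrow> reg \<sigma>' (r + 40) = reg \<sigma> (r + 40)"
      "\<And>r. r < 40 \<Longrightarrow> reg \<sigma>' r = reg \<sigma> r" "mem \<sigma>' = mem \<sigma>"
  shows "wp v (embed (op_code D x)) (\<lambda>k \<sigma>''. \<exists>\<tau> c ks e'. sim w B c \<sigma>'' \<and>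
     answered P n \<tau> x (reg \<sigma>'' 40) \<and> serves P D w n (timeline_after x \<tau>) c xs ks \<and>
     frame B \<sigma> \<sigma>'' \<and> e' = 2 * sum_list ks \<and> k + e' \<le> e \<and>
     reg \<sigma> 0 \<le> 1 \<and> (reg \<sigma> 0 \<noteq> 0 \<or> some_nonzero P n \<tau> (x # xs) \<longleftrightarrow> G)) \<sigma>'"
proof -
  obtain \<tau> c ks where *: "sim w B c \<sigma>" "serves P D w n \<tau> c (x # xs) ks" "e = 2 * sum_list ks"
    "reg \<sigma> 0 \<le> 1" "reg \<sigma> 0 \<noteq> 0 \<or> some_nonzero P n \<tau> (x # xs) \<longleftrightarrow> G"
    using assms(1) unfolding pending_def by blast
  from *(2) obtain k c' ks' where ks: "ks = k # ks'"
    "exec w (op_code D x) (pass_args w (op_args x) c) k c'" "answered P n \<tau> x (reg c' 0)"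
    "serves P D w n (timeline_after x \<tau>) c' xs ks'" unfolding serves.simps by blast
  have "y mod 2 ^ w < 2 ^ max w (Suc 0)" for y :: nat
    by (rule less_le_trans[of _ "2 ^ w"]) simp_all
  then have "sim w B (pass_args w (op_args x) c) \<sigma>'"
    using *(1) args by (auto simp: sim_def pass_args_def not_less)
  from exec_embed[OF ks(2) this wv memory_fits] show ?thesis
  proof (rule wp_mono, elim conjE)
    fix k' \<sigma>''
    assume k': "k' \<le> 2 * k" "sim w B c' \<sigma>''" "frame B \<sigma>' \<sigma>''"
    have "reg \<sigma>'' (0 + 40) = reg c' 0" using k'(2) unfolding sim_def by blast
    then have "reg \<sigma>'' 40 = reg c' 0" by simp
    moreover have "frame B \<sigma> \<sigma>''" using k'(3) args by (simp add: frame_def)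
    moreover have "k' + 2 * sum_list ks' \<le> e" using k'(1) *(3) ks(1) by simp
    ultimately show "\<exists>\<tau> c ks e'. sim w B c \<sigma>'' \<and>
     answered P n \<tau> x (reg \<sigma>'' 40) \<and> serves P D w n (timeline_after x \<tau>) c xs ks \<and>
     frame B \<sigma> \<sigma>'' \<and> e' = 2 * sum_list ks \<and> k' + e' \<le> e \<and>
     reg \<sigma> 0 \<le> 1 \<and> (reg \<sigma> 0 \<noteq> 0 \<or> some_nonzero P n \<tau> (x # xs) \<longleftrightarrow> G)"
      using k' ks *(4,5) by metis
  qed
qed

lemma layout_frame: "layout \<sigma> \<Longrightarrow> frame B \<sigma> \<sigma>' \<Longrightarrow> layout \<sigma>'"
  by (simp add: layout_def frame_def)

lemma wp_insert_call:
  assumes "pending (Insert (reg \<sigma> t) [reg \<sigma> p, reg \<sigma> x] # xs) \<sigma> e" "t < 37" "p < 37" "x < 37"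
    and Q: "\<And>k \<sigma>' e'. pending xs \<sigma>' e' \<Longrightarrow> \<forall>r<37. reg \<sigma>' r = reg \<sigma> r \<Longrightarrow> k + e' \<le> e + 3 \<Longrightarrow> Q k \<sigma>'"
  shows "wp v (insert_call D t p x) Q \<sigma>"
proof -
  let ?op = "Insert (reg \<sigma> t) [reg \<sigma> p, reg \<sigma> x]"
  let ?\<sigma> = "\<sigma>\<lparr>reg := (reg \<sigma>)(40 := reg \<sigma> t mod 2 ^ w, 41 := reg \<sigma> p mod 2 ^ w, 42 := reg \<sigma> x mod 2 ^ w)\<rparr>"
  have "wp v (embed (op_code D ?op)) (\<lambda>k. Q (Suc (Suc (Suc k)))) ?\<sigma>"
  proof (rule wp_mono[OF wp_op[OF assms(1)]], goal_cases)
    case (2 r) then show ?case by (auto simp: less_Suc_eq numeral_3_eq_3 numeral_2_eq_2)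
  next
    case (3 r) then show ?case by auto
  next
    case (6 k \<sigma>')
    then obtain \<tau> c ks e' where *: "sim w B c \<sigma>'" "serves P D w n (timeline_after ?op \<tau>) c xs ks"
      "frame B \<sigma> \<sigma>'" "e' = 2 * sum_list ks" "k + e' \<le> e"
      "reg \<sigma> 0 \<le> 1" "reg \<sigma> 0 \<noteq> 0 \<or> some_nonzero P n \<tau> (?op # xs) \<longleftrightarrow> G" by blast
    have "layout \<sigma>'" using assms(1) *(3) by (auto simp: pending_def intro: layout_frame)
    moreover have "reg \<sigma>' 0 = reg \<sigma> 0" using *(3) by (simp add: frame_def)
    ultimately have "pending xs \<sigma>' e'"
      using * by (intro pendingI[of _ c "timeline_after ?op \<tau>" _ ks]) auto
    then show ?case using *(3,5) by (intro Q[of \<sigma>' e']) (auto simp: frame_def)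
  qed auto
  then show ?thesis
    using pendingD(12)[OF assms(1)] assms(2-4)
    by (simp cong: wp_cong add: insert_call_def wp_simps eval_binop_small)
qed

lemma wp_delete_call:
  assumes "pending (Delete (reg \<sigma> t) # xs) \<sigma> e" "t < 37"
    and Q: "\<And>k \<sigma>' e'. pending xs \<sigma>' e' \<Longrightarrow> \<forall>r<37. reg \<sigma>' r = reg \<sigma> r \<Longrightarrow> k + e' \<le> e + 1 \<Longrightarrow> Q k \<sigma>'"
  shows "wp v (delete_call D t) Q \<sigma>"
proof -
  let ?op = "Delete (reg \<sigma> t)"
  let ?\<sigma> = "\<sigma>\<lparr>reg := (reg \<sigma>)(40 := reg \<sigma> t mod 2 ^ w)\<rparr>"
  have "wp v (embed (op_code D ?op)) (\<lambda>k. Q (Suc k)) ?\<sigma>"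
  proof (rule wp_mono[OF wp_op[OF assms(1)]], goal_cases)
    case (6 k \<sigma>')
    then obtain \<tau> c ks e' where *: "sim w B c \<sigma>'" "serves P D w n (timeline_after ?op \<tau>) c xs ks"
      "frame B \<sigma> \<sigma>'" "e' = 2 * sum_list ks" "k + e' \<le> e"
      "reg \<sigma> 0 \<le> 1" "reg \<sigma> 0 \<noteq> 0 \<or> some_nonzero P n \<tau> (?op # xs) \<longleftrightarrow> G" by blast
    have "layout \<sigma>'" using assms(1) *(3) by (auto simp: pending_def intro: layout_frame)
    moreover have "reg \<sigma>' 0 = reg \<sigma> 0" using *(3) by (simp add: frame_def)
    ultimately have "pending xs \<sigma>' e'"
      using * by (intro pendingI[of _ c "timeline_after ?op \<tau>" _ ks]) auto
    then show ?case using *(3,5) by (intro Q[of \<sigma>' e']) (auto simp: frame_def)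
  qed auto
  then show ?thesis
    using pendingD(12)[OF assms(1)] assms(2)
    by (simp cong: wp_cong add: delete_call_def wp_simps eval_binop_small)
qed

lemma wp_query_call:
  assumes "pending (Query_Prefix (reg \<sigma> t) [] # xs) \<sigma> e" "0 < t" "t < 37"
    and Q: "\<And>k \<sigma>' e'. pending xs \<sigma>' e' \<Longrightarrow> \<forall>r<37. r \<noteq> 0 \<longrightarrow> reg \<sigma>' r = reg \<sigma> r \<Longrightarrow> k + e' \<le> e + 3 \<Longrightarrow> Q k \<sigma>'"
  shows "wp v (query_call D t) Q \<sigma>"
proof -
  let ?op = "Query_Prefix (reg \<sigma> t) []"
  let ?\<sigma> = "\<sigma>\<lparr>reg := (reg \<sigma>)(40 := reg \<sigma> t mod 2 ^ w)\<rparr>"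
  have "wp v (embed (op_code D ?op)) (\<lambda>k. wp v (If 40 (Const 0 1) Skip) (\<lambda>k'. Q (1 + (k + k')))) ?\<sigma>"
  proof (rule wp_mono[OF wp_op[OF assms(1)]], goal_cases)
    case (6 k \<sigma>')
    then obtain \<tau> c ks e' where *: "sim w B c \<sigma>'" "serves P D w n \<tau> c xs ks"
      "frame B \<sigma> \<sigma>'" "e' = 2 * sum_list ks" "k + e' \<le> e"
      "reg \<sigma> 0 \<le> 1" "reg \<sigma> 0 \<noteq> 0 \<or> some_nonzero P n \<tau> (?op # xs) \<longleftrightarrow> G"
      "answered P n \<tau> ?op (reg \<sigma>' 40)" by auto
    define r0 where "r0 = (if reg \<sigma>' 40 = 0 then reg \<sigma>' 0 else 1)"
    let ?\<sigma>' = "\<sigma>'\<lparr>reg := (reg \<sigma>')(0 := r0)\<rparr>"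
    have "reg \<sigma>' 0 = reg \<sigma> 0" using *(3) by (simp add: frame_def)
    moreover have "layout ?\<sigma>'" using assms(1) *(3) by (auto simp: pending_def layout_def frame_def)
    moreover have "sim w B c ?\<sigma>'" using *(1) by (simp add: sim_def)
    ultimately have "pending xs ?\<sigma>' e'"
      using * by (intro pendingI[of _ c \<tau> _ ks]) (auto simp: r0_def)
    then have "Q (Suc (k + 2)) ?\<sigma>'" using *(3,5) by (intro Q[of ?\<sigma>' e']) (auto simp: frame_def)
    moreover have "\<sigma>'\<lparr>reg := (reg \<sigma>')(0 := reg \<sigma>' 0)\<rparr> = \<sigma>'" by simp
    ultimately show ?case using v1 by (cases "reg \<sigma>' 40 = 0") (simp_all add: wp_simps r0_def)
  qed auto
  then show ?thesis
    using pendingD(12)[OF assms(1)] assms(2)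
    by (simp cong: wp_cong add: query_call_def seqs.simps wp_Seq wp_Oper eval_binop_small del: One_nat_def)
qed

text \<open>Common pattern of the inner loops: one operation of the list per round. The admissible
  bound registers belong to \<open>layout\<close> and so survive the simulated code; registers 19 to
  36 are kept for the outer loop.\<close>

lemma wp_phase:
  assumes start: "pending (map f [0..<b] @ rest) \<sigma> e" and b: "b < 2 ^ v" "reg \<sigma> rb = b"
      "rb \<in> {1, 4, 9, 10}"
    and body: "\<And>i \<sigma>' e' Q. i < b \<Longrightarrow> pending (f i # map f [Suc i..<b] @ rest) \<sigma>' e' \<Longrightarrow>
      reg \<sigma>' 12 = i \<Longrightarrow> \<forall>r. 19 \<le> r \<and> r < 37 \<longrightarrow> reg \<sigma>' r = reg \<sigma> r \<Longrightarrow>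
      (\<And>k \<sigma>'' e''. pending (map f [Suc i..<b] @ rest) \<sigma>'' e'' \<Longrightarrow> reg \<sigma>'' 12 = i \<Longrightarrow>
        \<forall>r. 19 \<le> r \<and> r < 37 \<longrightarrow> reg \<sigma>'' r = reg \<sigma> r \<Longrightarrow> k + e'' \<le> e' + c \<Longrightarrow> Q k \<sigma>'') \<Longrightarrow>
      wp v p Q \<sigma>'"
    and Q: "\<And>k \<sigma>' e'. pending rest \<sigma>' e' \<Longrightarrow> \<forall>r. 19 \<le> r \<and> r < 37 \<longrightarrow> reg \<sigma>' r = reg \<sigma> r \<Longrightarrow>
      k + e' \<le> e + (c + 4) * b + 3 \<Longrightarrow> Q k \<sigma>'"
  shows "wp v (for_loop 12 rb 13 p) Q \<sigma>"
proof -
  define I where "I = (\<lambda>i \<sigma>' e'. pending (map f [i..<b] @ rest) \<sigma>' e' \<and>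
    (\<forall>r. 19 \<le> r \<and> r < 37 \<longrightarrow> reg \<sigma>' r = reg \<sigma> r))"
  have rb: "reg \<sigma>' rb = b" if "pending xs \<sigma>' e'" for xs \<sigma>' e'
    using b(2,3) pendingD[OF that] pendingD[OF start] by auto
  have "wp v (for_loop 12 rb 13 p)
    (\<lambda>k \<sigma>'. reg \<sigma>' rb = b \<and> (\<exists>e'. I b \<sigma>' e' \<and> k + e' \<le> e + (c + 4) * b + 3)) \<sigma>"
  proof (rule wp_for_loop)
    show "I 0 \<sigma> e" using start by (simp add: I_def)
    show "I j (\<sigma>'\<lparr>reg := (reg \<sigma>')(r := x)\<rparr>) e'" if "I j \<sigma>' e'" "r = 12 \<or> r = 13" for j \<sigma>' e' r x
      using that by (auto simp: I_def intro!: pending_upd)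
    fix j \<sigma>' e'
    assume j: "j < b" "I j \<sigma>' e'" "reg \<sigma>' 12 = j" "reg \<sigma>' rb = b"
    then have "pending (f j # map f [Suc j..<b] @ rest) \<sigma>' e'" by (simp add: I_def upt_conv_Cons)
    then show "wp v p (\<lambda>k \<sigma>'. reg \<sigma>' 12 = j \<and> reg \<sigma>' rb = b \<and>
      (\<exists>e''. I (Suc j) \<sigma>' e'' \<and> k + e'' \<le> e' + c)) \<sigma>'"
      by (rule body[OF j(1)]) (use j rb in \<open>auto simp: I_def\<close>)
  qed (use b in auto)
  then show ?thesis
    by (rule wp_mono) (auto simp: I_def intro: Q)
qed

lemma register_bounds: "N < 2 ^ v" "s < 2 ^ v" "g < 2 ^ v" "g * s < 2 ^ v" "s + N + g * s + s < 2 ^ v" "2 * M < 2 ^ v" "M < 2 ^ v"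
  "N + N + N < 2 ^ v" "g * s + s < 2 ^ v"
  using v s g N by linarith+

lemma wp_Z_phase:
  assumes "pending (map (\<lambda>i. Insert (s + i) [s + i + s, Z i]) [0..<N] @ rest) \<sigma> e"
    and Q: "\<And>k \<sigma>' e'. pending rest \<sigma>' e' \<Longrightarrow> k + e' \<le> e + 24 * N + 3 \<Longrightarrow> Q k \<sigma>'"
  shows "wp v (Z_phase D) Q \<sigma>"
  unfolding Z_phase_def
proof (rule wp_phase[OF assms(1), where c = 20])
  fix i \<sigma>' e' Q
  let ?f = "\<lambda>i. Insert (s + i) [s + i + s, Z i]"
  assume i: "i < N" and pending: "pending (?f i # map ?f [Suc i..<N] @ rest) \<sigma>' e'" and r12: "reg \<sigma>' 12 = i"
    and r: "\<forall>r. 19 \<le> r \<and> r < 37 \<longrightarrow> reg \<sigma>' r = reg \<sigma> r"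
    and Q: "\<And>k \<sigma>'' e''. pending (map ?f [Suc i..<N] @ rest) \<sigma>'' e'' \<Longrightarrow> reg \<sigma>'' 12 = i \<Longrightarrow>
        \<forall>r. 19 \<le> r \<and> r < 37 \<longrightarrow> reg \<sigma>'' r = reg \<sigma> r \<Longrightarrow> k + e'' \<le> e' + 20 \<Longrightarrow> Q k \<sigma>''"
  have words: "s + i < 2 ^ v" "s + i + s < 2 ^ v" "i + N < 2 ^ v" "i + N + N < 2 ^ v"
    using i v s by linarith+
  have mem: "mem \<sigma>' (i + N + N) = inp (i + N + N)" using i by (intro pendingD[OF pending]) simp
  have "eval_binop v Add (inp (i + N + N)) zo = Z i" using Z[OF i] by (simp add: eval_binop.simps)
  moreover have "wp v (insert_call D 14 15 16) (\<lambda>k. Q (Suc (Suc (Suc (Suc (Suc (Suc k)))))))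
      (\<sigma>'\<lparr>reg := (reg \<sigma>')(14 := s + i, 15 := s + i + s, 16 := Z i)\<rparr>)" (is "wp v _ _ ?\<sigma>")
    by (rule wp_insert_call[of ?\<sigma> 14 15 16 "map ?f [Suc i..<N] @ rest" e'])
       (use r in \<open>auto intro!: Q pending_cong[OF pending] simp: r12\<close>)
  ultimately show "wp v (seqs
     [Oper 14 Add 4 12, Oper 15 Add 14 4, Oper 16 Add 12 1, Oper 16 Add 16 1, Load 16 16,
      Oper 16 Add 16 8, insert_call D 14 15 16]) Q \<sigma>'"
    using words by (simp cong: wp_cong add: wp_simps eval_binop_small pendingD[OF pending] r12 mem)
qed (use register_bounds pendingD[OF assms(1)] Q in auto)

lemma wp_Y_insert_phase:
  assumes "pending (map (\<lambda>p. Insert p [s + p, Y (j * s + p)]) [0..<s] @ rest) \<sigma> e"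
    and j: "j < g" "reg \<sigma> 21 = j * s"
    and Q: "\<And>k \<sigma>' e'. pending rest \<sigma>' e' \<Longrightarrow> \<forall>r. 19 \<le> r \<and> r < 37 \<longrightarrow> reg \<sigma>' r = reg \<sigma> r \<Longrightarrow>
      k + e' \<le> e + 24 * s + 3 \<Longrightarrow> Q k \<sigma>'"
  shows "wp v (Y_insert_phase D) Q \<sigma>"
  unfolding Y_insert_phase_def
proof (rule wp_phase[OF assms(1), where c = 20])
  fix i \<sigma>' e' Q
  let ?f = "\<lambda>p. Insert p [s + p, Y (j * s + p)]"
  assume i: "i < s" and pending: "pending (?f i # map ?f [Suc i..<s] @ rest) \<sigma>' e'" and r12: "reg \<sigma>' 12 = i"
    and r: "\<forall>r. 19 \<le> r \<and> r < 37 \<longrightarrow> reg \<sigma>' r = reg \<sigma> r"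
    and Q: "\<And>k \<sigma>'' e''. pending (map ?f [Suc i..<s] @ rest) \<sigma>'' e'' \<Longrightarrow> reg \<sigma>'' 12 = i \<Longrightarrow>
        \<forall>r. 19 \<le> r \<and> r < 37 \<longrightarrow> reg \<sigma>'' r = reg \<sigma> r \<Longrightarrow> k + e'' \<le> e' + 20 \<Longrightarrow> Q k \<sigma>''"
  define x where "x = j * s + i"
  have "Suc j * s \<le> g * s" using j by (intro mult_le_mono1) simp
  then have "x < g * s" using i by (simp add: x_def)
  moreover have "x mod N < N" using N by simp
  ultimately have words: "s + i < 2 ^ v" "x < 2 ^ v" "x mod N + N < 2 ^ v"
    using i v s register_bounds by linarith+
  have mem: "mem \<sigma>' (x mod N + N) = inp (x mod N + N)"
    using \<open>x mod N < N\<close> by (intro pendingD[OF pending]) simp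
  have r21: "reg \<sigma>' 21 = j * s" using r j by simp
  have "eval_binop v Add (inp (x mod N + N)) yo = Y x" using Y[of x] by (simp add: eval_binop.simps)
  moreover have "wp v (insert_call D 12 15 16) (\<lambda>k. Q (Suc (Suc (Suc (Suc (Suc (Suc k)))))))
      (\<sigma>'\<lparr>reg := (reg \<sigma>')(15 := s + i, 16 := Y x)\<rparr>)" (is "wp v _ _ ?\<sigma>")
    by (rule wp_insert_call[of ?\<sigma> 12 15 16 "map ?f [Suc i..<s] @ rest" e'])
       (use r in \<open>auto intro!: Q pending_cong[OF pending] simp: r12 x_def\<close>)
  ultimately show "wp v (seqs
     [Oper 15 Add 4 12, Oper 16 Add 21 12, Oper 16 Mod 16 1, Oper 16 Add 16 1, Load 16 16,
      Oper 16 Add 16 7, insert_call D 12 15 16]) Q \<sigma>'"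
    using words
    by (simp cong: wp_cong add: wp_simps eval_binop_small pendingD[OF pending] r12 r21 mem x_def[symmetric])
qed (use register_bounds pendingD[OF assms(1)] Q in auto)

lemma wp_query_phase:
  assumes "pending (map (\<lambda>i. Query_Prefix (s + N + (i * s + s)) []) [0..<g] @ rest) \<sigma> e"
    and Q: "\<And>k \<sigma>' e'. pending rest \<sigma>' e' \<Longrightarrow> \<forall>r. 19 \<le> r \<and> r < 37 \<longrightarrow> reg \<sigma>' r = reg \<sigma> r \<Longrightarrow>
      k + e' \<le> e + 24 * g + 3 \<Longrightarrow> Q k \<sigma>'"
  shows "wp v (query_phase D) Q \<sigma>"
  unfolding query_phase_def
proof (rule wp_phase[OF assms(1), where c = 20])
  fix i \<sigma>' e' Q
  let ?f = "\<lambda>i. Query_Prefix (s + N + (i * s + s)) []"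
  assume i: "i < g" and pending: "pending (?f i # map ?f [Suc i..<g] @ rest) \<sigma>' e'" and r12: "reg \<sigma>' 12 = i"
    and r: "\<forall>r. 19 \<le> r \<and> r < 37 \<longrightarrow> reg \<sigma>' r = reg \<sigma> r"
    and Q: "\<And>k \<sigma>'' e''. pending (map ?f [Suc i..<g] @ rest) \<sigma>'' e'' \<Longrightarrow> reg \<sigma>'' 12 = i \<Longrightarrow>
        \<forall>r. 19 \<le> r \<and> r < 37 \<longrightarrow> reg \<sigma>'' r = reg \<sigma> r \<Longrightarrow> k + e'' \<le> e' + 20 \<Longrightarrow> Q k \<sigma>''"
  define x where "x = i * s"
  have "i * s \<le> g * s" using i by (intro mult_le_mono1) simp
  then have words: "x < 2 ^ v" "x + s < 2 ^ v" "s + N + (x + s) < 2 ^ v"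
    using register_bounds(5) unfolding x_def by linarith+
  have "wp v (query_call D 14) (\<lambda>k. Q (Suc (Suc (Suc k))))
      (\<sigma>'\<lparr>reg := (reg \<sigma>')(14 := s + N + (x + s))\<rparr>)" (is "wp v _ _ ?\<sigma>")
    by (rule wp_query_call[of ?\<sigma> 14 "map ?f [Suc i..<g] @ rest" e'])
       (use r in \<open>auto intro!: Q pending_cong[OF pending] simp: r12 x_def\<close>)
  then show "wp v (seqs
     [Oper 14 Mul 12 4, Oper 14 Add 14 4, Oper 14 Add 11 14, query_call D 14]) Q \<sigma>'"
    using words
    by (simp cong: wp_cong add: wp_simps eval_binop_small pendingD[OF pending] r12 x_def[symmetric])
qed (use register_bounds pendingD[OF assms(1)] Q in auto)

lemma wp_Y_delete_phase:
  assumes "pending (map Delete [0..<s] @ rest) \<sigma> e"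
    and Q: "\<And>k \<sigma>' e'. pending rest \<sigma>' e' \<Longrightarrow> \<forall>r. 19 \<le> r \<and> r < 37 \<longrightarrow> reg \<sigma>' r = reg \<sigma> r \<Longrightarrow>
      k + e' \<le> e + 24 * s + 3 \<Longrightarrow> Q k \<sigma>'"
  shows "wp v (Y_delete_phase D) Q \<sigma>"
  unfolding Y_delete_phase_def
proof (rule wp_phase[OF assms(1), where c = 20])
  fix i \<sigma>' e' Q
  assume i: "i < s" and pending: "pending (Delete i # map Delete [Suc i..<s] @ rest) \<sigma>' e'" and r12: "reg \<sigma>' 12 = i"
    and r: "\<forall>r. 19 \<le> r \<and> r < 37 \<longrightarrow> reg \<sigma>' r = reg \<sigma> r"
    and Q: "\<And>k \<sigma>'' e''. pending (map Delete [Suc i..<s] @ rest) \<sigma>'' e'' \<Longrightarrow> reg \<sigma>'' 12 = i \<Longrightarrow>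
        \<forall>r. 19 \<le> r \<and> r < 37 \<longrightarrow> reg \<sigma>'' r = reg \<sigma> r \<Longrightarrow> k + e'' \<le> e' + 20 \<Longrightarrow> Q k \<sigma>''"
  show "wp v (delete_call D 12) Q \<sigma>'"
    by (rule wp_delete_call[of \<sigma>' 12 "map Delete [Suc i..<s] @ rest" e'])
       (use r pending in \<open>auto intro!: Q simp: r12\<close>)
qed (use register_bounds pendingD[OF assms(1)] Q in auto)

lemma wp_X_phase:
  assumes "pending (map (\<lambda>r. Insert (s + N + r)
      [r mod s, if r < s then X r else (X r + M - X (r - s)) mod M]) [0..<g * s] @ rest) \<sigma> e"
    and Q: "\<And>k \<sigma>' e'. pending rest \<sigma>' e' \<Longrightarrow> k + e' \<le> e + 30 * (g * s) + 3 \<Longrightarrow> Q k \<sigma>'"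
  shows "wp v (X_phase D) Q \<sigma>"
  unfolding X_phase_def
proof (rule wp_phase[OF assms(1), where c = 26])
  fix i \<sigma>' e' Q
  let ?x = "\<lambda>r. if r < s then X r else (X r + M - X (r - s)) mod M"
  let ?f = "\<lambda>r. Insert (s + N + r) [r mod s, ?x r]"
  assume i: "i < g * s" and pending: "pending (?f i # map ?f [Suc i..<g * s] @ rest) \<sigma>' e'" and r12: "reg \<sigma>' 12 = i"
    and r: "\<forall>r. 19 \<le> r \<and> r < 37 \<longrightarrow> reg \<sigma>' r = reg \<sigma> r"
    and Q: "\<And>k \<sigma>'' e''. pending (map ?f [Suc i..<g * s] @ rest) \<sigma>'' e'' \<Longrightarrow> reg \<sigma>'' 12 = i \<Longrightarrow>
        \<forall>r. 19 \<le> r \<and> r < 37 \<longrightarrow> reg \<sigma>'' r = reg \<sigma> r \<Longrightarrow> k + e'' \<le> e' + 26 \<Longrightarrow> Q k \<sigma>''"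
  have words: "s + N + i < 2 ^ v" "i < 2 ^ v" "X i + M < 2 ^ v" "X (i - s) \<le> X i + M"
    using i register_bounds X(2)[of i] X(2)[of "i - s"] by linarith+
  have mem: "mem \<sigma>' (x mod N) = inp (x mod N)" for x
  proof (rule pendingD[OF pending])
    have "x mod N < N" using N by simp
    then show "x mod N < B" by linarith
  qed
  have inp: "eval_binop v Add (inp (x mod N)) xo = X x" for x
    using X(1)[of x] by (simp add: eval_binop.simps)
  show "wp v (seqs
     [Oper 14 Add 11 12, Oper 15 Mod 12 4, Oper 16 Mod 12 1, Load 16 16, Oper 16 Add 16 6,
      Oper 18 Less 12 4,
      If 18 Skip (seqs
        [Oper 17 Sub 12 4, Oper 17 Mod 17 1, Load 17 17, Oper 17 Add 17 6,
         Oper 16 Add 16 5, Oper 16 Sub 16 17, Oper 16 Mod 16 5]),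
      insert_call D 14 15 16]) Q \<sigma>'"
  proof (cases "i < s")
    case True
    have "wp v (insert_call D 14 15 16) (\<lambda>k. Q (Suc (Suc (Suc (Suc (Suc (Suc (Suc (Suc k)))))))))
        (\<sigma>'\<lparr>reg := (reg \<sigma>')(14 := s + N + i, 15 := i mod s, 16 := X i, 18 := Suc 0)\<rparr>)" (is "wp v _ _ ?\<sigma>")
      by (rule wp_insert_call[of ?\<sigma> 14 15 16 "map ?f [Suc i..<g * s] @ rest" e'])
         (use r True in \<open>auto intro!: Q pending_cong[OF pending[unfolded if_P[OF True]]] simp: r12 simp del: mod_less\<close>)
    then show ?thesis
      using words True
      by (simp cong: wp_cong add: wp_simps eval_binop_small pendingD[OF pending] r12 mem inp)
  next
    case False
    have "wp v (insert_call D 14 15 16)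
        (\<lambda>k. Q (Suc (Suc (Suc (Suc (Suc (Suc (Suc (Suc (Suc (Suc (Suc (Suc (Suc (Suc k)))))))))))))))
        (\<sigma>'\<lparr>reg := (reg \<sigma>')(14 := s + N + i, 15 := i mod s, 18 := 0, 17 := X (i - s),
          16 := (X i + M - X (i - s)) mod M)\<rparr>)" (is "wp v _ _ ?\<sigma>")
      by (rule wp_insert_call[of ?\<sigma> 14 15 16 "map ?f [Suc i..<g * s] @ rest" e'])
         (use r False in \<open>auto intro!: Q pending_cong[OF pending[unfolded if_not_P[OF False]]] simp: r12\<close>)
    then show ?thesis
      using words False
      by (simp cong: wp_cong add: wp_simps eval_binop_small pendingD[OF pending] r12 mem inp)
  qed
qed (use register_bounds pendingD[OF assms(1)] Q in auto)

text \<open>A round costs 24 for each insertion, query and deletion; the 10 consists of three loop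
  overheads of 3 and one multiplication, and the outer loop adds 4.\<close>

lemma wp_Y_phase:
  assumes "pending (concat (map (\<lambda>j.
       map (\<lambda>p. Insert p [s + p, Y (j * s + p)]) [0..<s] @
       map (\<lambda>i. Query_Prefix (s + N + (i * s + s)) []) [0..<g] @
       map Delete [0..<s]) [0..<g])) \<sigma> e"
  shows "wp v (Y_phase D) (\<lambda>k \<sigma>'. \<exists>e'. pending [] \<sigma>' e' \<and> k + e' \<le> e + (48 * s + 24 * g + 10 + 4) * g + 3) \<sigma>"
proof -
  let ?round = "\<lambda>j. map (\<lambda>p. Insert p [s + p, Y (j * s + p)]) [0..<s] @
       map (\<lambda>i. Query_Prefix (s + N + (i * s + s)) []) [0..<g] @ map Delete [0..<s]"
  define I where "I = (\<lambda>j. pending (concat (map ?round [j..<g])))"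
  have "wp v (Y_phase D) (\<lambda>k \<sigma>'. reg \<sigma>' 9 = g \<and>
    (\<exists>e'. I g \<sigma>' e' \<and> k + e' \<le> e + (48 * s + 24 * g + 10 + 4) * g + 3)) \<sigma>"
    unfolding Y_phase_def
  proof (rule wp_for_loop)
    show "I 0 \<sigma> e" using assms by (simp add: I_def)
    show "I j (\<sigma>'\<lparr>reg := (reg \<sigma>')(r := x)\<rparr>) e'" if "I j \<sigma>' e'" "r = 19 \<or> r = 20" for j \<sigma>' e' r x
      using that by (auto simp: I_def intro!: pending_upd)
    fix j \<sigma>' e'
    assume j: "j < g" "I j \<sigma>' e'" "reg \<sigma>' 19 = j"
    let ?rest = "concat (map ?round [Suc j..<g])"
    have pending: "pending (?round j @ ?rest) \<sigma>' e'"
      using j by (simp add: I_def upt_conv_Cons)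
    let ?\<sigma> = "\<sigma>'\<lparr>reg := (reg \<sigma>')(21 := j * s)\<rparr>"
    have "j * s \<le> g * s" using j by (intro mult_le_mono1) simp
    then have js: "j * s < 2 ^ v" using register_bounds by linarith
    show "wp v (seqs [Oper 21 Mul 19 4, Y_insert_phase D, query_phase D, Y_delete_phase D])
      (\<lambda>k \<sigma>'. reg \<sigma>' 19 = j \<and> reg \<sigma>' 9 = g \<and>
        (\<exists>e''. I (Suc j) \<sigma>' e'' \<and> k + e'' \<le> e' + (48 * s + 24 * g + 10))) \<sigma>'"
      unfolding seqs.simps wp_Seq wp_Oper pendingD[OF pending] j(3) eval_binop_small(2)[OF js]
    proof (rule wp_Y_insert_phase[where \<sigma> = ?\<sigma> and e = e' and j = j])
      show "pending (map (\<lambda>p. Insert p [s + p, Y (j * s + p)]) [0..<s] @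
         (map (\<lambda>i. Query_Prefix (s + N + (i * s + s)) []) [0..<g] @ map Delete [0..<s] @ ?rest)) ?\<sigma> e'"
        using pending by (intro pending_cong[OF pending[unfolded append_assoc]]) auto
    next
      fix k1 \<sigma>1 e1
      assume 1: "pending (map (\<lambda>i. Query_Prefix (s + N + (i * s + s)) []) [0..<g] @ map Delete [0..<s] @ ?rest) \<sigma>1 e1"
        "\<forall>r. 19 \<le> r \<and> r < 37 \<longrightarrow> reg \<sigma>1 r = reg ?\<sigma> r" "k1 + e1 \<le> e' + 24 * s + 3"
      show "wp v (query_phase D) (\<lambda>k. wp v (Y_delete_phase D) (\<lambda>k' \<sigma>'. reg \<sigma>' 19 = j \<and> reg \<sigma>' 9 = g \<and>
        (\<exists>e''. I (Suc j) \<sigma>' e'' \<and> 1 + (k1 + (k + k')) + e'' \<le> e' + (48 * s + 24 * g + 10)))) \<sigma>1"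
      proof (rule wp_query_phase[OF 1(1)])
        fix k2 \<sigma>2 e2
        assume 2: "pending (map Delete [0..<s] @ ?rest) \<sigma>2 e2"
          "\<forall>r. 19 \<le> r \<and> r < 37 \<longrightarrow> reg \<sigma>2 r = reg \<sigma>1 r" "k2 + e2 \<le> e1 + 24 * g + 3"
        show "wp v (Y_delete_phase D) (\<lambda>k' \<sigma>'. reg \<sigma>' 19 = j \<and> reg \<sigma>' 9 = g \<and>
          (\<exists>e''. I (Suc j) \<sigma>' e'' \<and> 1 + (k1 + (k2 + k')) + e'' \<le> e' + (48 * s + 24 * g + 10))) \<sigma>2"
        proof (rule wp_Y_delete_phase[OF 2(1)])
          fix k3 \<sigma>3 e3
          assume 3: "pending ?rest \<sigma>3 e3" "\<forall>r. 19 \<le> r \<and> r < 37 \<longrightarrow> reg \<sigma>3 r = reg \<sigma>2 r"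
            "k3 + e3 \<le> e2 + 24 * s + 3"
          have "reg \<sigma>3 19 = j" using 1(2) 2(2) 3(2) j(3) by simp
          moreover have "1 + (k1 + (k2 + k3)) + e3 \<le> e' + (48 * s + 24 * g + 10)"
            using 1(3) 2(3) 3(3) by linarith
          ultimately show "reg \<sigma>3 19 = j \<and> reg \<sigma>3 9 = g \<and>
            (\<exists>e''. I (Suc j) \<sigma>3 e'' \<and> 1 + (k1 + (k2 + k3)) + e'' \<le> e' + (48 * s + 24 * g + 10))"
            using 3(1) pendingD[OF 3(1)] unfolding I_def by blast
        qed
      qed
    qed (use j in auto)
  qed (use register_bounds pendingD[OF assms] in auto)
  then show ?thesis
    by (rule wp_mono) (auto simp: I_def)
qed

lemma wp_phases:
  assumes "pending (reduction_ops N s g M X Y Z) \<sigma> e"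
  shows "wp v (phases_code D) (\<lambda>k \<sigma>'. reg \<sigma>' 0 = (if G then 1 else 0) \<and>
    k \<le> e + 24 * N + 30 * (g * s) + (48 * s + 24 * g + 10 + 4) * g + 9) \<sigma>"
  unfolding phases_code_def seqs.simps wp_Seq
proof (rule wp_Z_phase[OF assms[unfolded reduction_ops_def]], rule wp_X_phase, assumption, rule wp_mono, rule wp_Y_phase, assumption, elim exE conjE)
  fix k1 \<sigma>1 e1 k2 \<sigma>2 e2 k3 \<sigma>3 e3
  assume *: "k1 + e1 \<le> e + 24 * N + 3" "k2 + e2 \<le> e1 + 30 * (g * s) + 3"
    "k3 + e3 \<le> e2 + (48 * s + 24 * g + 10 + 4) * g + 3" "pending [] \<sigma>3 e3"
  \<comment> \<open>No operation is outstanding, so the invariant identifies the verdict, which is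
    at most 1, with \<open>G\<close>.\<close>
  have "reg \<sigma>3 0 = (if G then 1 else 0)" using *(4) by (auto simp: pending_def)
  moreover have "k1 + (k2 + k3) \<le> e + 24 * N + 30 * (g * s) + (48 * s + 24 * g + 10 + 4) * g + 9"
    using *(1-3) by linarith
  ultimately show "reg \<sigma>3 0 = (if G then 1 else 0) \<and>
    k1 + (k2 + k3) \<le> e + 24 * N + 30 * (g * s) + (48 * s + 24 * g + 10 + 4) * g + 9" by blast
qed

end

section \<open>The operation sequence of the reduction\<close>

lemma timeline_after_ops_append:
  "timeline_after_ops (xs @ ys) \<tau> = timeline_after_ops ys (timeline_after_ops xs \<tau>)"
  by (simp add: timeline_after_ops_def)

lemma timeline_after_ops_Nil_singleton [simp]:
  "timeline_after_ops [] \<tau> = \<tau>" "timeline_after_ops [x] \<tau> = timeline_after x \<tau>"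
  by (simp_all add: timeline_after_ops_def)

lemma legal_ops_append:
  "legal_ops P n m H \<tau> (xs @ ys) \<longleftrightarrow>
    legal_ops P n m H \<tau> xs \<and> legal_ops P n m H (timeline_after_ops xs \<tau>) ys"
  by (induction xs arbitrary: \<tau>) (auto simp: timeline_after_ops_def)

lemma some_nonzero_append:
  "some_nonzero P n \<tau> (xs @ ys) \<longleftrightarrow>
    some_nonzero P n \<tau> xs \<or> some_nonzero P n (timeline_after_ops xs \<tau>) ys"
  by (induction xs arbitrary: \<tau>) (auto simp: timeline_after_ops_def)

text \<open>Indexing the timelines by the number of operations already performed reduces statements
  about a whole phase to single steps; the next two lemmas follow the same scheme.\<close>

lemma timeline_after_ops_map:
  assumes "\<And>i. i < k \<Longrightarrow> timeline_after (f i) (\<tau> i) = \<tau> (Suc i)"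
  shows "timeline_after_ops (map f [0..<k]) (\<tau> 0) = \<tau> k"
  using assms by (induction k) (auto simp: timeline_after_ops_append)

lemma legal_ops_map:
  assumes "\<And>i. i < k \<Longrightarrow> timeline_after (f i) (\<tau> i) = \<tau> (Suc i)"
    and "\<And>i. i < k \<Longrightarrow> legal_op P n m H (\<tau> i) (f i)"
  shows "legal_ops P n m H (\<tau> 0) (map f [0..<k])"
  using assms by (induction k) (auto simp: legal_ops_append timeline_after_ops_map)

lemma some_nonzero_map:
  assumes "\<And>i. i < k \<Longrightarrow> timeline_after (f i) (\<tau> i) = \<tau> (Suc i)"
  shows "some_nonzero P n (\<tau> 0) (map f [0..<k]) \<longleftrightarrow> (\<exists>i<k. nonzero_answer P n (\<tau> i) (f i))"
  using assms by (induction k) (auto simp: some_nonzero_append timeline_after_ops_map less_Suc_eq)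

lemma timeline_after_ops_concat:
  assumes "\<And>j. j < k \<Longrightarrow> timeline_after_ops (r j) \<tau> = \<tau>"
  shows "timeline_after_ops (concat (map r [0..<k])) \<tau> = \<tau>"
  using assms by (induction k) (auto simp: timeline_after_ops_append)

lemma legal_ops_concat:
  assumes "\<And>j. j < k \<Longrightarrow> timeline_after_ops (r j) \<tau> = \<tau>" "\<And>j. j < k \<Longrightarrow> legal_ops P n m H \<tau> (r j)"
  shows "legal_ops P n m H \<tau> (concat (map r [0..<k]))"
  using assms by (induction k) (auto simp: legal_ops_append timeline_after_ops_concat)

lemma some_nonzero_concat:
  assumes "\<And>j. j < k \<Longrightarrow> timeline_after_ops (r j) \<tau> = \<tau>"
  shows "some_nonzero P n \<tau> (concat (map r [0..<k])) \<longleftrightarrow> (\<exists>j<k. some_nonzero P n \<tau> (r j))"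
  using assms by (induction k) (auto simp: some_nonzero_append timeline_after_ops_concat less_Suc_eq)

lemma sum_lessThan_add: "(\<Sum>t<a + b. f t) = (\<Sum>t<a. f t) + (\<Sum>t<b. f (a + t) :: nat)" for a b :: nat
  by (induction b) (simp_all add: add.assoc)

locale reduction =
  fixes d n N s g M :: nat and X Y Z :: "nat \<Rightarrow> nat"
  assumes M: "M = modulus d n" and s_def: "s = side n" and s: "1 \<le> s" and N: "1 \<le> N" "2 * s + N \<le> n"
    and g: "N \<le> g * s"
    and X: "\<And>r. X r < M" and Y: "\<And>r. Y r < M" and Z: "\<And>i. i < N \<Longrightarrow> Z i < M"
begin

abbreviation "P \<equiv> triple_problem d"

definition step :: "nat \<Rightarrow> nat" where
  "step r = (if r < s then X r else (X r + M - X (r - s)) mod M)"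

text \<open>\<open>base\<close>, \<open>filled\<close> and \<open>emptied\<close> are closed forms
  of all timelines that occur: after \<open>a\<close> insertions from \<open>Z\<close> and
  \<open>r\<close> differences of \<open>X\<close>, and within round \<open>j\<close> after
  \<open>a\<close> insertions from \<open>Y\<close> or \<open>a\<close> deletions. Each operation
  just raises an index.\<close>

definition base :: "nat \<Rightarrow> nat \<Rightarrow> timeline" where
  "base a r = (\<lambda>t. if s \<le> t \<and> t < s + a then Some [t + s, Z (t - s)]
     else if s + N \<le> t \<and> t < s + N + r then Some [(t - (s + N)) mod s, step (t - (s + N))] else None)"

definition filled :: "nat \<Rightarrow> nat \<Rightarrow> timeline" where
  "filled j a = (\<lambda>t. if t < a then Some [s + t, Y (j * s + t)] else base N (g * s) t)"

definition emptied :: "nat \<Rightarrow> nat \<Rightarrow> timeline" where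
  "emptied j a = (\<lambda>t. if t < a then None else filled j s t)"

lemma M_pos: "0 < M"
  by (simp add: M modulus_pos)

lemma step_less: "step r < M"
  using M_pos X by (simp add: step_def)

lemma Z_step:
  "timeline_after (Insert (s + i) [s + i + s, Z i]) (base i 0) = base (Suc i) 0"
  by (auto simp: base_def fun_eq_iff)

lemma X_step:
  "timeline_after (Insert (s + N + r) [r mod s, step r]) (base N r) = base N (Suc r)"
  by (auto simp: base_def fun_eq_iff)

lemma Y_insert_step:
  "a < s \<Longrightarrow> timeline_after (Insert a [s + a, Y (j * s + a)]) (filled j a) = filled j (Suc a)"
  by (auto simp: filled_def fun_eq_iff)

lemma Y_delete_step:
  "timeline_after (Delete a) (emptied j a) = emptied j (Suc a)"
  by (auto simp: emptied_def fun_eq_iff)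

lemma base_start: "base 0 0 = Map.empty"
  by (simp add: base_def fun_eq_iff)

lemma filled_0: "filled j 0 = base N (g * s)"
  by (simp add: filled_def)

lemma emptied_0: "emptied j 0 = filled j s"
  by (simp add: emptied_def)

lemma emptied_s: "emptied j s = base N (g * s)"
  by (auto simp: emptied_def filled_def base_def fun_eq_iff)

definition round_ops :: "nat \<Rightarrow> retro_op list" where
  "round_ops j = map (\<lambda>p. Insert p [s + p, Y (j * s + p)]) [0..<s] @
     map (\<lambda>i. Query_Prefix (s + N + (i * s + s)) []) [0..<g] @ map Delete [0..<s]"

lemma reduction_ops_eq:
  "reduction_ops N s g M X Y Z = map (\<lambda>i. Insert (s + i) [s + i + s, Z i]) [0..<N] @
     map (\<lambda>r. Insert (s + N + r) [r mod s, step r]) [0..<g * s] @ concat (map round_ops [0..<g])"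
  by (simp add: reduction_ops_def step_def round_ops_def[abs_def])

lemma after_Y_insert: "timeline_after_ops (map (\<lambda>p. Insert p [s + p, Y (j * s + p)]) [0..<s])
    (base N (g * s)) = filled j s"
  using timeline_after_ops_map[of s "\<lambda>p. Insert p [s + p, Y (j * s + p)]" "filled j"] Y_insert_step
  by (simp add: filled_0)

lemma after_queries:
  "timeline_after_ops (map (\<lambda>i. Query_Prefix (s + N + (i * s + s)) []) [0..<g]) \<tau> = \<tau>"
  using timeline_after_ops_map[of g _ "\<lambda>_. \<tau>"] by simp

lemma after_Y_delete: "timeline_after_ops (map Delete [0..<s]) (filled j s) = base N (g * s)"
  using timeline_after_ops_map[of s Delete "emptied j"] Y_delete_step
  by (simp add: emptied_0 emptied_s)

lemma after_round: "timeline_after_ops (round_ops j) (base N (g * s)) = base N (g * s)"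
  by (simp add: round_ops_def timeline_after_ops_append after_Y_insert after_queries after_Y_delete)

lemma after_Z: "timeline_after_ops (map (\<lambda>i. Insert (s + i) [s + i + s, Z i]) [0..<N]) Map.empty = base N 0"
  using timeline_after_ops_map[of N "\<lambda>i. Insert (s + i) [s + i + s, Z i]" "\<lambda>i. base i 0"] Z_step
  by (simp add: base_start)

lemma after_X: "timeline_after_ops (map (\<lambda>r. Insert (s + N + r) [r mod s, step r]) [0..<g * s])
    (base N 0) = base N (g * s)"
  using timeline_after_ops_map[of "g * s" "\<lambda>r. Insert (s + N + r) [r mod s, step r]" "base N"] X_step
  by simp

text \<open>The free time \<open>t\<close> makes the domain a proper subset of an interval with at
  most \<open>m\<close> elements, so the capacity is not yet exhausted.\<close>

lemma legal_insert:
  assumes "dom \<tau> \<subseteq> {..<s + N + g * s}" "t < s + N + g * s" "t \<notin> dom \<tau>" "s + N + g * s \<le> m" "m \<le> H"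
    "p < n" "x < M"
  shows "legal_op P n m H \<tau> (Insert t [p, x])"
proof -
  have "dom \<tau> \<subset> {..<s + N + g * s}" using assms by blast
  then have "card (dom \<tau>) < s + N + g * s" using psubset_card_mono[of "{..<s + N + g * s}"] by simp
  then show ?thesis using assms by (simp add: triple_problem_def M)
qed

lemma legal_reduction_ops:
  assumes "s + N + g * s \<le> m" "m \<le> H"
  shows "legal_ops P n m H Map.empty (reduction_ops N s g M X Y Z)"
proof -
  have "legal_ops P n m H Map.empty (map (\<lambda>i. Insert (s + i) [s + i + s, Z i]) [0..<N])"
    unfolding base_start[symmetric]
    by (rule legal_ops_map[where \<tau> = "\<lambda>i. base i 0"], rule Z_step, rule legal_insert)
       (use assms N Z in \<open>auto simp: base_def split: if_splits\<close>)
  moreover have "legal_ops P n m H (base N 0) (map (\<lambda>r. Insert (s + N + r) [r mod s, step r]) [0..<g * s])"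
  proof (rule legal_ops_map[where \<tau> = "base N"], rule X_step, rule legal_insert)
    fix r assume "r < g * s"
    have "r mod s < s" using s by simp
    then show "r mod s < n" using N by linarith
  qed (use assms step_less in \<open>auto simp: base_def split: if_splits\<close>)
  moreover have "legal_ops P n m H (base N (g * s)) (round_ops j)" for j
  proof -
    have "legal_ops P n m H (base N (g * s)) (map (\<lambda>p. Insert p [s + p, Y (j * s + p)]) [0..<s])"
      unfolding filled_0[symmetric, of j]
      by (rule legal_ops_map[where \<tau> = "filled j"], rule Y_insert_step, assumption, rule legal_insert)
         (use assms N Y in \<open>auto simp: filled_def base_def split: if_splits\<close>)
    moreover have "legal_ops P n m H (filled j s) (map (\<lambda>i. Query_Prefix (s + N + (i * s + s)) []) [0..<g])"
    proof (rule legal_ops_map[where \<tau> = "\<lambda>_. filled j s"])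
      fix i assume "i < g"
      then have "Suc i * s \<le> g * s" by (intro mult_le_mono1) simp
      then have "s + N + (i * s + s) \<le> H" using assms by simp
      then show "legal_op P n m H (filled j s) (Query_Prefix (s + N + (i * s + s)) [])"
        by (simp add: triple_problem_def)
    qed simp
    moreover have "legal_ops P n m H (filled j s) (map Delete [0..<s])"
      unfolding emptied_0[symmetric]
      by (rule legal_ops_map[where \<tau> = "emptied j"], rule Y_delete_step)
         (auto simp: emptied_def filled_def)
    ultimately show ?thesis
      by (simp add: round_ops_def legal_ops_append after_Y_insert after_queries)
  qed
  ultimately show ?thesis
    unfolding reduction_ops_eq
    by (simp add: legal_ops_append after_Z after_X legal_ops_concat after_round)
qed

lemma full_reduction_ops: "list_all full_op (reduction_ops N s g M X Y Z)"
  by (auto simp: reduction_ops_def list_all_iff)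

text \<open>The increments to word \<open>p\<close> sit at the indices congruent to \<open>p\<close>
  modulo \<open>s\<close> and telescope modulo \<open>M\<close>, leaving the entry of the latest
  block.\<close>

lemma sum_step:
  assumes "p < s"
  shows "(\<Sum>r<i * s + s. if r mod s = p then step r else 0) mod M = X (i * s + p)"
proof (induction i)
  case 0
  have "(\<Sum>r<s. if r mod s = p then step r else 0) = (\<Sum>r<s. if r = p then step r else 0)"
    by (intro sum.cong) auto
  then show ?case using assms X by (simp add: step_def)
next
  case (Suc i)
  let ?f = "\<lambda>r. if r mod s = p then step r else 0"
  have shift: "i * s + s + r = Suc i * s + r" for r by simp
  have "Suc i * s + s = (i * s + s) + s" by simp
  then have "(\<Sum>r<Suc i * s + s. ?f r) = (\<Sum>r<i * s + s. ?f r) + (\<Sum>r<s. ?f (i * s + s + r))"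
    by (simp only: sum_lessThan_add)
  also have "(\<Sum>r<s. ?f (i * s + s + r)) = (\<Sum>r<s. ?f (Suc i * s + r))"
    by (simp only: shift)
  also have "\<dots> = (\<Sum>r<s. if r = p then step (Suc i * s + r) else 0)"
    by (intro sum.cong refl) (auto simp del: mult_Suc simp: mod_mult_self3)
  also have "\<dots> = step (Suc i * s + p)" using assms by simp
  also have "\<dots> = (X (Suc i * s + p) + M - X (i * s + p)) mod M"
    by (simp add: step_def)
  finally have "(\<Sum>r<Suc i * s + s. ?f r) mod M =
      ((\<Sum>r<i * s + s. ?f r) mod M + (X (Suc i * s + p) + M - X (i * s + p))) mod M"
    by (simp add: mod_simps)
  also have "\<dots> = (X (Suc i * s + p) + M) mod M"
    unfolding Suc.IH using X[of "i * s + p"] by simp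
  finally show ?case using X by simp
qed

text \<open>The sum over time splits into the three zones of the timeline. The first two contribute
  at most one update per word, the third is handled by \<open>sum_step\<close>.\<close>

lemma cell_filled:
  assumes "i < g" "r < n"
  shows "cell (filled j s) {t \<in> dom (filled j s). t < s + N + (i * s + s)} r mod M =
    (if r < s then X (i * s + r) else if r < 2 * s then Y (j * s + (r - s))
     else if r < 2 * s + N then Z (r - 2 * s) else 0)"
proof -
  have le: "i * s + s \<le> g * s"
    using assms(1) mult_le_mono1[of "Suc i" g s] by simp
  have dom: "{t \<in> dom (filled j s). t < s + N + (i * s + s)} = {..<s + N + (i * s + s)}"
    using le by (auto simp: filled_def base_def split: if_splits)
  let ?f = "\<lambda>t. if the (filled j s t) ! 0 = r then the (filled j s t) ! 1 else 0"
  have split: "(\<Sum>t<s + N + L. ?f t) = (\<Sum>t<s. ?f t) + (\<Sum>t<N. ?f (s + t)) + (\<Sum>t<L. ?f (s + N + t))" for L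
    by (simp only: sum_lessThan_add add.assoc)
  have 1: "(\<Sum>t<s. ?f t) = (if s \<le> r \<and> r < 2 * s then Y (j * s + (r - s)) else 0)"
  proof -
    have "(\<Sum>t<s. ?f t) = (\<Sum>t<s. if t + s = r then Y (j * s + t) else 0)"
      by (intro sum.cong) (auto simp: filled_def)
    also have "\<dots> = (\<Sum>t<s. if t = r - s then (if s \<le> r then Y (j * s + t) else 0) else 0)"
      by (intro sum.cong) auto
    finally show ?thesis by auto
  qed
  have 2: "(\<Sum>t<N. ?f (s + t)) = (if 2 * s \<le> r \<and> r < 2 * s + N then Z (r - 2 * s) else 0)"
  proof -
    have "(\<Sum>t<N. ?f (s + t)) = (\<Sum>t<N. if s + t + s = r then Z t else 0)"
      by (intro sum.cong) (auto simp: filled_def base_def)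
    also have "\<dots> = (\<Sum>t<N. if t = r - 2 * s then (if 2 * s \<le> r then Z t else 0) else 0)"
      by (intro sum.cong) auto
    finally show ?thesis by auto
  qed
  have 3: "(\<Sum>t<i * s + s. ?f (s + N + t)) = (\<Sum>t<i * s + s. if t mod s = r then step t else 0)"
    using le by (intro sum.cong) (auto simp: filled_def base_def)
  have 4: "(\<Sum>t<i * s + s. if t mod s = r then step t else 0) = 0" if "s \<le> r"
  proof (rule sum.neutral, rule ballI)
    fix t
    have "t mod s < s" using s by simp
    then show "(if t mod s = r then step t else 0) = 0" using that by simp
  qed
  show ?thesis
    unfolding cell_def dom split 1 2 3 using sum_step[of r i] 4 X Y Z M_pos by auto
qed

lemma some_nonzero_reduction_ops:
  "some_nonzero P n Map.empty (reduction_ops N s g M X Y Z) \<longleftrightarrow>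
    (\<exists>j<g. \<exists>i<g. hit_count d n (\<lambda>r. if r < s then X (i * s + r) else if r < 2 * s then Y (j * s + (r - s))
     else if r < 2 * s + N then Z (r - 2 * s) else 0) \<noteq> 0)"
proof -
  have "\<not> some_nonzero P n Map.empty (map (\<lambda>i. Insert (s + i) [s + i + s, Z i]) [0..<N])"
    using some_nonzero_map[of N "\<lambda>i. Insert (s + i) [s + i + s, Z i]" "\<lambda>i. base i 0"] Z_step
    by (simp add: base_start)
  moreover have "\<not> some_nonzero P n (base N 0) (map (\<lambda>r. Insert (s + N + r) [r mod s, step r]) [0..<g * s])"
    using some_nonzero_map[of "g * s" "\<lambda>r. Insert (s + N + r) [r mod s, step r]" "base N"] X_step by simp
  moreover have "some_nonzero P n (base N (g * s)) (round_ops j) \<longleftrightarrow>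
    (\<exists>i<g. hit_count d n (\<lambda>r. if r < s then X (i * s + r) else if r < 2 * s then Y (j * s + (r - s))
     else if r < 2 * s + N then Z (r - 2 * s) else 0) \<noteq> 0)" for j
  proof -
    have "\<not> some_nonzero P n (base N (g * s)) (map (\<lambda>p. Insert p [s + p, Y (j * s + p)]) [0..<s])"
      using some_nonzero_map[of s "\<lambda>p. Insert p [s + p, Y (j * s + p)]" "filled j"] Y_insert_step
      by (simp add: filled_0)
    moreover have "\<not> some_nonzero P n (filled j s) (map Delete [0..<s])"
      using some_nonzero_map[of s Delete "emptied j"] Y_delete_step by (simp add: emptied_0)
    moreover have "some_nonzero P n (filled j s) (map (\<lambda>i. Query_Prefix (s + N + (i * s + s)) []) [0..<g]) \<longleftrightarrow>
      (\<exists>i<g. nonzero_answer P n (filled j s) (Query_Prefix (s + N + (i * s + s)) []))"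
      by (rule some_nonzero_map) simp
    moreover have "nonzero_answer P n (filled j s) (Query_Prefix (s + N + (i * s + s)) []) \<longleftrightarrow>
      hit_count d n (\<lambda>r. if r < s then X (i * s + r) else if r < 2 * s then Y (j * s + (r - s))
       else if r < 2 * s + N then Z (r - 2 * s) else 0) \<noteq> 0" if "i < g" for i
    proof -
      have fin: "finite (dom (filled j s))"
        by (rule finite_subset[of _ "{..<s + N + g * s}"]) (auto simp: filled_def base_def split: if_splits)
      have "r mod s < n" for r
        using mod_less_divisor[of s r] s N by linarith
      then have "x \<in> updates P n" if "filled j s t = Some x" for t x
        using that N Y Z step_less
        by (auto simp: filled_def base_def triple_problem_def M[symmetric] split: if_splits)
      then have "ran (filled j s) \<subseteq> updates P n" by (auto simp: ran_def)
      note * = answer_prefix_state[OF fin this]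
      have "hit_count d n (\<lambda>p. cell (filled j s) {t' \<in> dom (filled j s). t' < s + N + (i * s + s)} p mod modulus d n) =
       hit_count d n (\<lambda>r. if r < s then X (i * s + r) else if r < 2 * s then Y (j * s + (r - s))
       else if r < 2 * s + N then Z (r - 2 * s) else 0)"
        unfolding hit_count_def M[symmetric]
        by (intro hits_cong cell_filled[OF that]) (auto dest: group_subset)
      then show ?thesis by (simp add: *)
    qed
    ultimately show ?thesis
      by (simp add: round_ops_def some_nonzero_append after_Y_insert after_queries) blast
  qed
  ultimately show ?thesis
    unfolding reduction_ops_eq
    by (simp add: some_nonzero_append after_Z after_X some_nonzero_concat after_round)
qed

end

section \<open>Initialization of the 3-SUM program\<close>

text \<open>Repeated doubling finds the power of two above register 16. Its \<open>c\<close>-th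
  power is \<open>2 ^ w\<close>, the modulus of the simulation, which no instruction provides
  directly.\<close>

definition two_power_code :: com where
  "two_power_code = Seq (Const 17 1) (for_loop 12 16 13 (seqs
     [Oper 14 Less 16 17, If 14 Skip (Oper 17 Add 17 17)]))"

lemma wp_two_power_code:
  assumes "reg \<sigma> 16 = x" "1 \<le> x" "4 * x < 2 ^ v"
  shows "wp v two_power_code (\<lambda>k \<sigma>'. k \<le> 7 * x + 4 \<and> mem \<sigma>' = mem \<sigma> \<and>
    reg \<sigma>' 17 = 2 ^ (floor_log x + 1) \<and> (\<forall>r. r \<notin> {12, 13, 14, 17} \<longrightarrow> reg \<sigma>' r = reg \<sigma> r)) \<sigma>"
proof -
  define l where "l = floor_log x + 1"
  define I where "I = (\<lambda>j (\<sigma>' :: config) (e :: nat). e = 0 \<and> mem \<sigma>' = mem \<sigma> \<and> reg \<sigma>' 17 = 2 ^ min j l \<and>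
    (\<forall>r. r \<notin> {12, 13, 14, 17} \<longrightarrow> reg \<sigma>' r = reg \<sigma> r))"
  have l: "2 ^ l \<le> 2 * x" "x < 2 ^ l"
    using floor_log_exp2_le[of x] floor_log_exp2_gt[of x] assms(2) by (simp_all add: l_def)
  have two_l: "2 ^ j \<le> x \<longleftrightarrow> j < l" for j
  proof
    assume "j < l"
    then have "(2::nat) ^ j \<le> 2 ^ (l - 1)" by (intro power_increasing) auto
    also have "\<dots> \<le> x" using floor_log_exp2_le[of x] assms(2) by (simp add: l_def)
    finally show "2 ^ j \<le> x" .
  next
    assume "2 ^ j \<le> x"
    then have "(2::nat) ^ j < 2 ^ l" using l(2) by linarith
    then show "j < l" by simp
  qed
  \<comment> \<open>The loop simply runs \<open>x\<close> rounds; this shows that they suffice for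
    all \<open>l\<close> doublings.\<close>
  have "l \<le> x"
  proof -
    have "l - 1 < 2 ^ (l - 1)" by (rule less_exp)
    also have "\<dots> \<le> x" using two_l[of "l - 1"] by (simp add: l_def)
    finally show ?thesis by linarith
  qed
  have one: "(1::nat) < 2 ^ v" "v \<noteq> 0" using assms by (auto intro!: gr0I)
  let ?\<sigma> = "\<sigma>\<lparr>reg := (reg \<sigma>)(17 := 1)\<rparr>"
  have "wp v (for_loop 12 16 13 (seqs [Oper 14 Less 16 17, If 14 Skip (Oper 17 Add 17 17)]))
    (\<lambda>k \<sigma>'. reg \<sigma>' 16 = x \<and> (\<exists>e'. I x \<sigma>' e' \<and> k + e' \<le> 0 + (3 + 4) * x + 3)) ?\<sigma>"
  proof (rule wp_for_loop)
    show "I 0 ?\<sigma> 0" by (simp add: I_def)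
    show "\<And>j s e r v. I j s e \<Longrightarrow> r = 12 \<or> r = 13 \<Longrightarrow> I j (s\<lparr>reg := (reg s)(r := v)\<rparr>) e"
      by (auto simp: I_def)
    fix j \<sigma>' e
    assume j: "j < x" "I j \<sigma>' e" "reg \<sigma>' 12 = j" "reg \<sigma>' 16 = x"
    show "wp v (seqs [Oper 14 Less 16 17, If 14 Skip (Oper 17 Add 17 17)])
      (\<lambda>k s'. reg s' 12 = j \<and> reg s' 16 = x \<and> (\<exists>e'. I (Suc j) s' e' \<and> k + e' \<le> e + 3)) \<sigma>'"
    proof (cases "j < l")
      case True
      then have "\<not> x < 2 ^ j" "(2::nat) ^ j + 2 ^ j < 2 ^ v" using two_l[of j] assms(3) by linarith+
      then show ?thesis
        using j True by (simp cong: wp_cong add: wp_simps eval_binop_small I_def)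
    next
      case False
      then show ?thesis
        using j l by (simp cong: wp_cong add: wp_simps eval_binop_small I_def)
    qed
  qed (use assms in auto)
  then have "wp v (for_loop 12 16 13 (seqs [Oper 14 Less 16 17, If 14 Skip (Oper 17 Add 17 17)]))
    (\<lambda>k \<sigma>'. 1 + k \<le> 7 * x + 4 \<and> mem \<sigma>' = mem \<sigma> \<and>
    reg \<sigma>' 17 = 2 ^ (floor_log x + 1) \<and> (\<forall>r. r \<notin> {12, 13, 14, 17} \<longrightarrow> reg \<sigma>' r = reg \<sigma> r)) ?\<sigma>"
    unfolding l_def[symmetric]
    by (rule wp_mono) (use \<open>l \<le> x\<close> in \<open>auto simp: I_def min_def\<close>)
  moreover have "1 mod 2 ^ v = (1::nat)" using one(1) by (rule mod_less)
  ultimately show ?thesis by (simp only: two_power_code_def wp_Seq wp_Const)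
qed

definition sizes_code :: "nat \<Rightarrow> nat \<Rightarrow> com" where
  "sizes_code q K = seqs
     [Oper 1 And 0 0, Const 0 0, Const 16 K, Oper 3 Mul 16 1, side_code,
      Const 2 1, Oper 12 Add 3 2, power_code 5 12 (q + 3), power_code 7 1 q]"

text \<open>With \<open>R * N = max n m\<close>, registers 16 and 17 lead to \<open>2 ^ w\<close> in
  register 38. Register 39 places the simulated memory behind the three input arrays, and register
  40 passes \<open>n\<close> to the initialization code.\<close>

definition layout_code :: "nat \<Rightarrow> nat \<Rightarrow> com" where
  "layout_code R c = seqs
     [Oper 6 Add 7 2, Oper 6 Add 6 2, Oper 8 Sub 5 7, Oper 8 Sub 8 7, Oper 8 Sub 8 2,
      Oper 9 Div 1 4, Oper 9 Add 9 2, Oper 10 Mul 9 4, Oper 11 Add 4 1,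
      Const 16 R, Oper 16 Mul 16 1, two_power_code, power_code 38 17 c,
      Oper 39 Add 1 1, Oper 39 Add 39 1, Oper 40 Mod 3 38]"

definition three_sum_code :: "nat \<Rightarrow> nat \<Rightarrow> nat \<Rightarrow> nat \<Rightarrow> implementation \<Rightarrow> com" where
  "three_sum_code q K R c D = seqs
     [sizes_code q K, layout_code R c, embed (init_code D), phases_code D]"

lemma wp_sizes_code:
  assumes \<sigma>: "reg \<sigma> 0 = N" "\<And>r. 0 < r \<Longrightarrow> reg \<sigma> r = 0" and n: "n = K * N" "1 \<le> n"
    and word: "4 * n * n < 2 ^ v" "n + 1 < 2 ^ v" "modulus (q + 3) n < 2 ^ v" "N ^ q < 2 ^ v"
  shows "wp v (sizes_code q K) (\<lambda>k \<sigma>'. k \<le> 10 * n + 2 * q + 20 \<and> mem \<sigma>' = mem \<sigma> \<and> reg \<sigma>' 0 = 0 \<and>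
    reg \<sigma>' 1 = N \<and> reg \<sigma>' 2 = 1 \<and> reg \<sigma>' 3 = n \<and> reg \<sigma>' 4 = side n \<and> reg \<sigma>' 5 = modulus (q + 3) n \<and>
    reg \<sigma>' 7 = N ^ q \<and> (\<forall>r\<ge>40. reg \<sigma>' r = 0)) \<sigma>"
proof -
  have K: "K < 2 ^ v"
  proof -
    have "K * 1 \<le> K * N" using n by (intro mult_le_mono2) (cases N, auto)
    then show ?thesis using n word by linarith
  qed
  have v: "v \<noteq> 0" using word n by (intro notI) simp
  let ?\<sigma> = "\<sigma>\<lparr>reg := (reg \<sigma>)(1 := N, 0 := 0, 16 := K, 3 := n)\<rparr>"
  have pow: "(n + 1) ^ (q + 3) = modulus (q + 3) n" by (simp add: modulus_def)
  have "wp v side_code (\<lambda>k \<sigma>'. k \<le> 10 * n + 3 \<and> mem \<sigma>' = mem ?\<sigma> \<and> reg \<sigma>' 4 = side n \<and>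
    (\<forall>r. r \<notin> {4, 12, 13, 14, 15} \<longrightarrow> reg \<sigma>' r = reg ?\<sigma> r)) ?\<sigma>"
    by (rule wp_side_code) (use \<sigma> n word in auto)
  note side = this
  have K_eval: "eval_binop v Mul K N = n" using n word(2) by (simp add: eval_binop_small)
  have prefix: "wp v (sizes_code q K) Q \<sigma> \<longleftrightarrow> wp v side_code (\<lambda>k'. wp v (Seq (Const 2 (Suc 0))
      (Seq (Oper 12 Add 3 2) (Seq (power_code 5 12 (q + 3)) (power_code 7 (Suc 0) q))))
      (\<lambda>k. Q (Suc (Suc (Suc (Suc (k' + k))))))) ?\<sigma>" for Q
    unfolding sizes_code_def using \<sigma> K v
    by (simp cong: wp_cong add: wp_Seq wp_Const wp_Oper eval_binop_small(7) K_eval)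
  show ?thesis
    unfolding prefix
  proof (rule wp_mono[OF side], elim conjE)
    fix k1 :: nat and \<sigma>1 :: config
    assume 1: "k1 \<le> 10 * n + 3" "mem \<sigma>1 = mem ?\<sigma>" "reg \<sigma>1 4 = side n"
      "\<forall>r. r \<notin> {4, 12, 13, 14, 15} \<longrightarrow> reg \<sigma>1 r = reg ?\<sigma> r"
    then have regs: "reg \<sigma>1 3 = n" "reg \<sigma>1 0 = 0" "reg \<sigma>1 1 = N" "\<forall>r\<ge>40. reg \<sigma>1 r = 0"
      using \<sigma>(2) by auto
    show "wp v (Seq (Const 2 (Suc 0)) (Seq (Oper 12 Add 3 2) (Seq (power_code 5 12 (q + 3)) (power_code 7 (Suc 0) q))))
     (\<lambda>k \<sigma>'. Suc (Suc (Suc (Suc (k1 + k)))) \<le> 10 * n + 2 * q + 20 \<and> mem \<sigma>' = mem \<sigma> \<and> reg \<sigma>' 0 = 0 \<and>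
    reg \<sigma>' 1 = N \<and> reg \<sigma>' 2 = 1 \<and> reg \<sigma>' 3 = n \<and> reg \<sigma>' 4 = side n \<and> reg \<sigma>' 5 = modulus (q + 3) n \<and>
    reg \<sigma>' 7 = N ^ q \<and> (\<forall>r\<ge>40. reg \<sigma>' r = 0)) \<sigma>1"
      unfolding wp_Seq wp_Const wp_Oper
      by (rule wp_power_code, simp, rule wp_power_code, simp)
         (use 1 regs word v pow in \<open>simp add: eval_binop_small\<close>)
  qed
qed

lemma wp_layout_code:
  assumes \<sigma>: "reg \<sigma> 0 = 0" "reg \<sigma> 1 = N" "reg \<sigma> 2 = 1" "reg \<sigma> 3 = n" "reg \<sigma> 4 = s" "reg \<sigma> 5 = M" "reg \<sigma> 7 = U"
      "\<forall>r\<ge>40. reg \<sigma> r = 0"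
    and R: "1 \<le> R * N" and N: "1 \<le> N" and s: "1 \<le> s"
    and w: "w = word_size c (R * N)" and M: "2 * U + 1 \<le> M"
    and word: "(2::nat) ^ w < 2 ^ v" "M + N + R * N * 4 + s + n + 4 < 2 ^ v"
  shows "wp v (layout_code R c) (\<lambda>k \<sigma>'. k \<le> 7 * (R * N) + c + 30 \<and> mem \<sigma>' = mem \<sigma> \<and> reg \<sigma>' 0 = 0 \<and>
    reg \<sigma>' 1 = N \<and> reg \<sigma>' 4 = s \<and> reg \<sigma>' 5 = M \<and> reg \<sigma>' 6 = U + 2 \<and> reg \<sigma>' 7 = U \<and>
    reg \<sigma>' 8 = M - (2 * U + 1) \<and> reg \<sigma>' 9 = N div s + 1 \<and> reg \<sigma>' 10 = (N div s + 1) * s \<and>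
    reg \<sigma>' 11 = s + N \<and> reg \<sigma>' 38 = 2 ^ w \<and> reg \<sigma>' 39 = 3 * N \<and> reg \<sigma>' 40 = n mod 2 ^ w \<and>
    (\<forall>r>40. reg \<sigma>' r = 0)) \<sigma>"
proof -
  define y where "y = R * N"
  have "R * 1 \<le> R * N" using N by (intro mult_le_mono2)
  then have R': "R < 2 ^ v" using word by linarith
  have "N div s * s \<le> N" by (rule div_times_less_eq_dividend)
  then have gs: "(N div s + 1) * s \<le> N + s" by simp
  have "N div s \<le> N" by (rule div_le_dividend)
  then have words: "U + 1 < 2 ^ v" "U + 2 < 2 ^ v" "N div s + 1 < 2 ^ v" "(N div s + 1) * s < 2 ^ v" "s + N < 2 ^ v"
    "R * N < 2 ^ v" "M < 2 ^ v"
    using word M gs by linarith+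
  have pow: "(2 ^ (floor_log (R * N) + 1)) ^ c = (2::nat) ^ w"
    unfolding w word_size_def by (metis power_mult mult.commute)
  define g where "g = N div s + 1"
  \<comment> \<open>Intermediate results of the three subtractions that form
    \<open>M - (2 * U + 1)\<close>; as names they keep their shape while the program is
    evaluated.\<close>
  define z1 where "z1 = M - U"
  define z2 where "z2 = M - U - U"
  define z3 where "z3 = M - (2 * U + 1)"
  have z: "U \<le> M" "U \<le> z1" "z1 - U = z2" "1 \<le> z2" "z2 - 1 = z3" "z1 < 2 ^ v" "z2 < 2 ^ v" "M - U = z1"
    using M words(7) by (auto simp: z1_def z2_def z3_def)
  let ?\<sigma> = "\<sigma>\<lparr>reg := (reg \<sigma>)(6 := U + 2, 8 := z3, 9 := g,
    10 := g * s, 11 := s + N, 16 := y)\<rparr>"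
  have "wp v two_power_code (\<lambda>k \<sigma>'. k \<le> 7 * y + 4 \<and> mem \<sigma>' = mem ?\<sigma> \<and>
    reg \<sigma>' 17 = 2 ^ (floor_log y + 1) \<and> (\<forall>r. r \<notin> {12, 13, 14, 17} \<longrightarrow> reg \<sigma>' r = reg ?\<sigma> r)) ?\<sigma>"
    by (rule wp_two_power_code) (use R word in \<open>simp_all add: y_def\<close>)
  note two_power = this
  have evals: "eval_binop v Mul R N = y" "eval_binop v Div N s = N div s" "eval_binop v Add (N div s) 1 = g"
    "eval_binop v Add U 1 = U + 1" "eval_binop v Add (U + 1) 1 = U + 2" "eval_binop v Sub M U = z1"
    "eval_binop v Sub z1 U = z2" "eval_binop v Sub z2 1 = z3" "eval_binop v Mul g s = g * s"
    "eval_binop v Add s N = s + N"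
    using words z by (simp_all add: eval_binop_small y_def g_def)
  have prefix: "wp v (layout_code R c) Q \<sigma> \<longleftrightarrow> wp v two_power_code (\<lambda>k'. wp v (Seq (power_code 38 17 c)
      (Seq (Oper 39 Add (Suc 0) (Suc 0)) (Seq (Oper 39 Add 39 (Suc 0)) (Oper 40 Mod 3 38))))
      (\<lambda>k. Q (Suc (Suc (Suc (Suc (Suc (Suc (Suc (Suc (Suc (Suc (Suc (k' + k)))))))))))))) ?\<sigma>" for Q
    unfolding layout_code_def using \<sigma> R'
    by (simp cong: wp_cong add: wp_Seq wp_Const wp_Oper evals[unfolded One_nat_def, simplified])
  show ?thesis
    unfolding prefix
  proof (rule wp_mono[OF two_power], elim conjE)
    fix k1 :: nat and \<sigma>1 :: config
    assume 1: "k1 \<le> 7 * y + 4" "mem \<sigma>1 = mem ?\<sigma>" "reg \<sigma>1 17 = 2 ^ (floor_log y + 1)"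
      "\<forall>r. r \<notin> {12, 13, 14, 17} \<longrightarrow> reg \<sigma>1 r = reg ?\<sigma> r"
    have "reg \<sigma>1 17 ^ c mod 2 ^ v = 2 ^ w" using 1(3) pow word(1) by (simp add: y_def)
    moreover have "N + N < 2 ^ v" "N + N + N < 2 ^ v"
    proof -
      have "1 * N \<le> R * N" using R by (intro mult_le_mono1) (cases R, auto)
      then show "N + N < 2 ^ v" "N + N + N < 2 ^ v" using word(2) by linarith+
    qed
    ultimately show "wp v (Seq (power_code 38 17 c)
      (Seq (Oper 39 Add (Suc 0) (Suc 0)) (Seq (Oper 39 Add 39 (Suc 0)) (Oper 40 Mod 3 38))))
      (\<lambda>k \<sigma>'. Suc (Suc (Suc (Suc (Suc (Suc (Suc (Suc (Suc (Suc (Suc (k1 + k))))))))))) \<le> 7 * (R * N) + c + 30 \<and>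
        mem \<sigma>' = mem \<sigma> \<and> reg \<sigma>' 0 = 0 \<and> reg \<sigma>' 1 = N \<and> reg \<sigma>' 4 = s \<and> reg \<sigma>' 5 = M \<and>
        reg \<sigma>' 6 = U + 2 \<and> reg \<sigma>' 7 = U \<and> reg \<sigma>' 8 = M - (2 * U + 1) \<and> reg \<sigma>' 9 = N div s + 1 \<and>
        reg \<sigma>' 10 = (N div s + 1) * s \<and> reg \<sigma>' 11 = s + N \<and> reg \<sigma>' 38 = 2 ^ w \<and> reg \<sigma>' 39 = 3 * N \<and>
        reg \<sigma>' 40 = n mod 2 ^ w \<and> (\<forall>r>40. reg \<sigma>' r = 0)) \<sigma>1"
      unfolding wp_Seq wp_Oper
      by (intro wp_power_code) (use 1 \<sigma> in \<open>simp_all add: eval_binop_small y_def g_def z3_def\<close>)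
  qed
qed

section \<open>Correctness and running time of the 3-SUM program\<close>

text \<open>Two's complement respects addition modulo \<open>2 ^ v\<close>: an offset that makes the
  integer nonnegative also turns its word into the intended number.\<close>

lemma word_of_int_add:
  assumes "0 \<le> a + int b" "a + int b < 2 ^ v"
  shows "(word_of_int v a mod 2 ^ v + b) mod 2 ^ v = nat (a + int b)"
proof -
  have "int ((word_of_int v a mod 2 ^ v + b) mod 2 ^ v) = (a mod 2 ^ v mod 2 ^ v + int b) mod 2 ^ v"
    by (simp add: word_of_int_def zmod_int)
  also have "\<dots> = a + int b" using assms by (simp add: mod_simps)
  finally show ?thesis by linarith
qed

text \<open>\<open>x + 1\<close> lies strictly between \<open>- M\<close> and \<open>M\<close>; if
  it is negative, its residue is 1 only for \<open>x = - M\<close>, which the bound on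
  \<open>x\<close> excludes.\<close>

lemma nat_mod_eq_one_iff:
  fixes x :: int and M :: nat
  assumes "\<bar>x\<bar> \<le> 3 * int U" "3 * U + 1 < M"
  shows "nat (int M + 1 + x) mod M = 1 \<longleftrightarrow> x = 0"
proof -
  have "int (nat (int M + 1 + x) mod M) = (int M + 1 + x) mod int M"
    using assms by (simp add: zmod_int)
  also have "\<dots> = (if x + 1 < 0 then x + 1 + int M else x + 1)"
  proof (cases "x + 1 < 0")
    case True
    then show ?thesis using assms by (simp add: mod_pos_pos_trivial)
  next
    case False
    have "(int M + 1 + x) mod int M = (x + 1 + int M) mod int M" by (simp add: algebra_simps)
    also have "\<dots> = x + 1" using False assms by simp
    finally show ?thesis using False by simp
  qed
  finally have "int (nat (int M + 1 + x) mod M) = 1 \<longleftrightarrow> x = 0" using assms by auto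
  then show ?thesis by linarith
qed

locale three_sum_instance =
  fixes q k N U n s g M :: nat and as bs cs :: "int list"
  assumes N: "1 \<le> N" and k: "2 \<le> k" and U: "U = N ^ q" and n: "n = k * k * N" and s: "s = side n"
    and g: "g = N div s + 1" and M: "M = modulus (q + 3) n"
    and len: "length as = N" "length bs = N" "length cs = N"
    and bounds: "\<And>x. x \<in> set as \<union> set bs \<union> set cs \<Longrightarrow> \<bar>x\<bar> \<le> int U"
begin

text \<open>The three offsets sum to \<open>M + 1\<close>, so the target residue 1 corresponds to
  integer sum 0. The 2 belongs to \<open>X\<close> to make \<open>X a + Y b\<close> at least 2, out
  of reach for padding zeros.\<close>

definition X :: "nat \<Rightarrow> nat" where "X r = nat (as ! (r mod N) + int (U + 2))"
definition Y :: "nat \<Rightarrow> nat" where "Y r = nat (bs ! (r mod N) + int U)"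
definition Z :: "nat \<Rightarrow> nat" where "Z i = nat (cs ! i + int (M - (2 * U + 1)))"

lemma n_bounds: "4 * N \<le> n" "k * N + N \<le> n"
proof -
  have "2 * 2 * N \<le> k * k * N" using k by (intro mult_le_mono) auto
  then show "4 * N \<le> n" by (simp add: n)
  have "k * N + N \<le> k * N + k * N" using k by simp
  also have "\<dots> = 2 * (k * N)" by simp
  also have "\<dots> \<le> k * (k * N)" using k by (intro mult_le_mono1)
  finally show "k * N + N \<le> n" by (simp add: n mult.assoc)
qed

lemma s_pos: "1 \<le> s"
  using n_bounds N by (simp add: s le_side_iff)

text \<open>From \<open>4 * s * s \<le> k * k * N \<le> (k * N) ^ 2\<close>. It keeps the timeline
  short compared with \<open>n\<close>.\<close>

lemma s_le: "2 * s \<le> k * N"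
proof -
  have "4 * s * s \<le> n" unfolding s using le_side_iff by blast
  also have "\<dots> \<le> k * k * (N * N)" unfolding n using N by (intro mult_le_mono2) simp
  finally have "(2 * s) ^ 2 \<le> (k * N) ^ 2" by (simp add: power2_eq_square mult_ac)
  then show ?thesis by (rule power2_le_imp_le) simp
qed

text \<open>\<open>n < 4 * (s + 1) * (s + 1)\<close> and \<open>4 * N \<le> n\<close> give
  \<open>N < (s + 1) * (s + 1)\<close>, which is at most \<open>(2 * s) ^ 2\<close>. Blocks of
  length at least half the root of \<open>N\<close> are what makes the number of queries
  linear.\<close>

lemma s_square: "N \<le> 4 * s * s"
proof -
  have "\<not> 4 * (s + 1) * (s + 1) \<le> n" unfolding s le_side_iff[symmetric] by simp
  then have "n < 4 * ((s + 1) * (s + 1))" by (simp only: mult.assoc not_le)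
  then have "N < (s + 1) * (s + 1)" using n_bounds by linarith
  also have "(s + 1) * (s + 1) \<le> (2 * s) * (2 * s)" using s_pos by (intro mult_le_mono) auto
  finally show ?thesis by simp
qed

text \<open>\<open>g * g\<close> is the number of queries: \<open>N div s \<le> 4 * s\<close> bounds
  the square of \<open>N div s\<close> by \<open>4 * N\<close>, and the increment by 1 in
  \<open>g\<close> adds at most \<open>3 * N\<close>.\<close>

lemma block_count_bounds: "N \<le> g * s" "g * s \<le> N + s" "g * s \<le> (k + 1) * N" "g \<le> N + 1" "g * g \<le> 7 * N"
proof -
  have "N div s * s \<le> N" by (rule div_times_less_eq_dividend)
  then show "g * s \<le> N + s" by (simp add: g)
  then show "g * s \<le> (k + 1) * N" using s_le by simp
  have "N div s * s + N mod s = N" by (rule div_mult_mod_eq)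
  moreover have "N mod s < s" using s_pos by simp
  moreover have "g * s = N div s * s + s" by (simp add: g)
  ultimately show "N \<le> g * s" by linarith
  have a: "N div s \<le> N" by (rule div_le_dividend)
  then show "g \<le> N + 1" by (simp add: g)
  have "N div s \<le> 4 * s * s div s" by (rule div_le_mono[OF s_square])
  then have "N div s \<le> 4 * s" using s_pos by simp
  then have "N div s * (N div s) \<le> N div s * (4 * s)" by (intro mult_le_mono2)
  also have "\<dots> = 4 * (N div s * s)" by simp
  finally have "N div s * (N div s) \<le> 4 * N" using \<open>N div s * s \<le> N\<close> by linarith
  then have "N div s * (N div s) + 2 * (N div s) + 1 \<le> 7 * N" using a N by linarith
  then show "g * g \<le> 7 * N" by (simp add: g)
qed

text \<open>The three surplus factors of the modulus give \<open>5 ^ 3 = 125\<close>, because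
  \<open>n + 1 \<ge> 5\<close>.\<close>

lemma U_bounds: "125 * U \<le> M" "1 \<le> U"
proof -
  have "5 \<le> n + 1" using n_bounds N by simp
  then have "5 ^ 3 \<le> (n + 1) ^ 3" by (intro power_mono) auto
  moreover have "N ^ q \<le> (n + 1) ^ q" using n_bounds by (intro power_mono) auto
  ultimately have "N ^ q * 5 ^ 3 \<le> (n + 1) ^ q * (n + 1) ^ 3" by (intro mult_le_mono)
  then show "125 * U \<le> M" by (simp add: U M modulus_def power_add)
  show "1 \<le> U" using N by (simp add: U)
qed

lemma entry_bounds:
  "\<bar>as ! (r mod N)\<bar> \<le> int U" "\<bar>bs ! (r mod N)\<bar> \<le> int U" "i < N \<Longrightarrow> \<bar>cs ! i\<bar> \<le> int U"
  using bounds len N by (simp_all add: nth_mem)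

lemma int_XYZ:
  "int (X r) = as ! (r mod N) + int U + 2"
  "int (Y r) = bs ! (r mod N) + int U"
  "i < N \<Longrightarrow> int (Z i) = cs ! i + int M - 2 * int U - 1"
proof -
  have "0 \<le> as ! (r mod N) + int (U + 2)" "0 \<le> bs ! (r mod N) + int U"
    using entry_bounds[of r] by linarith+
  then show "int (X r) = as ! (r mod N) + int U + 2" "int (Y r) = bs ! (r mod N) + int U"
    by (simp_all add: X_def Y_def)
  assume "i < N"
  then have "0 \<le> cs ! i + int (M - (2 * U + 1))" using entry_bounds(3)[of i] U_bounds by linarith
  moreover have "int (M - (2 * U + 1)) = int M - 2 * int U - 1" using U_bounds by linarith
  ultimately show "int (Z i) = cs ! i + int M - 2 * int U - 1" by (simp add: Z_def)
qed

sublocale red: reduction "q + 3" n N s g M X Y Z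
proof
  show "X r < M" for r using entry_bounds[of r] int_XYZ(1)[of r] U_bounds by linarith
  show "Y r < M" for r using entry_bounds[of r] int_XYZ(2)[of r] U_bounds by linarith
  show "Z i < M" if "i < N" for i using that entry_bounds(3)[of i] int_XYZ(3)[of i] U_bounds by linarith
  show "2 * s + N \<le> n" using s_le n_bounds by linarith
qed (use N M s s_pos block_count_bounds in auto)

text \<open>Every pair of positions falls into some pair of blocks, hence some query. Cyclic
  continuation only repeats elements, which can raise counts but cannot create a new
  solution.\<close>

lemma some_nonzero_iff_three_sum:
  "some_nonzero (triple_problem (q + 3)) n Map.empty (reduction_ops N s g M X Y Z) \<longleftrightarrow>
    (\<exists>x\<in>set as. \<exists>y\<in>set bs. \<exists>z\<in>set cs. x + y + z = 0)"
proof -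
  define f where "f = (\<lambda>i j r. if r < s then X (i * s + r) else if r < 2 * s then Y (j * s + (r - s))
     else if r < 2 * s + N then Z (r - 2 * s) else 0)"
  have nonzero: "some_nonzero (triple_problem (q + 3)) n Map.empty (reduction_ops N s g M X Y Z) \<longleftrightarrow>
    (\<exists>j<g. \<exists>i<g. \<exists>a\<in>group n 0. \<exists>b\<in>group n 1. \<exists>c\<in>group n 2. (f i j a + f i j b + f i j c) mod M = 1)"
    unfolding red.some_nonzero_reduction_ops hit_count_def hits_pos_iff[OF finite_group finite_group finite_group]
      M[symmetric] f_def by (rule refl)
  have sum: "(X a + Y b + Z i) mod M = 1 \<longleftrightarrow> as ! (a mod N) + bs ! (b mod N) + cs ! i = 0" if "i < N" for a b i
  proof -
    let ?t = "as ! (a mod N) + bs ! (b mod N) + cs ! i"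
    have "int (X a + Y b + Z i) = int M + 1 + ?t"
      using int_XYZ(1)[of a] int_XYZ(2)[of b] int_XYZ(3)[OF that] by simp
    then have "X a + Y b + Z i = nat (int M + 1 + ?t)" by linarith
    moreover have "\<bar>?t\<bar> \<le> 3 * int U"
      using entry_bounds(1)[of a] entry_bounds(2)[of b] entry_bounds(3)[OF that] by linarith
    ultimately show ?thesis using nat_mod_eq_one_iff[of ?t U M] U_bounds by simp
  qed
  \<comment> \<open>Words of the large group beyond the \<open>N\<close> loaded ones remain 0 and
    must not complete a hit.\<close>
  have dummy: "(X a + Y b) mod M \<noteq> 1" for a b
  proof -
    have "X a + Y b < M" "2 \<le> X a + Y b"
      using int_XYZ(1)[of a] int_XYZ(2)[of b] entry_bounds(1)[of a] entry_bounds(2)[of b] U_bounds by linarith+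
    then show ?thesis by simp
  qed
  show ?thesis
  proof
    assume "some_nonzero (triple_problem (q + 3)) n Map.empty (reduction_ops N s g M X Y Z)"
    then obtain i j a b c where abc: "a \<in> group n 0" "b \<in> group n 1" "c \<in> group n 2"
      "(f i j a + f i j b + f i j c) mod M = 1"
      unfolding nonzero by blast
    then have r: "a < s" "s \<le> b" "b < 2 * s" "2 * s \<le> c" by (auto simp: group_def s)
    show "\<exists>x\<in>set as. \<exists>y\<in>set bs. \<exists>z\<in>set cs. x + y + z = 0"
    proof (cases "c < 2 * s + N")
      case True
      then have "(X (i * s + a) + Y (j * s + (b - s)) + Z (c - 2 * s)) mod M = 1"
        using abc(4) r by (simp add: f_def)
      moreover have c: "c - 2 * s < N" using True r by linarith
      ultimately have "as ! ((i * s + a) mod N) + bs ! ((j * s + (b - s)) mod N) + cs ! (c - 2 * s) = 0"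
        using sum by blast
      moreover have "(i * s + a) mod N < N" "(j * s + (b - s)) mod N < N" using N by simp_all
      ultimately show ?thesis using len c nth_mem by metis
    next
      case False
      then show ?thesis using abc(4) r dummy[of "i * s + a" "j * s + (b - s)"] by (simp add: f_def)
    qed
  next
    assume "\<exists>x\<in>set as. \<exists>y\<in>set bs. \<exists>z\<in>set cs. x + y + z = 0"
    then obtain a b c where abc: "a < N" "b < N" "c < N" "as ! a + bs ! b + cs ! c = 0"
      using len by (auto simp: in_set_conv_nth)
    define i where "i = a div s"
    define j where "j = b div s"
    have ij: "i < g" "j < g" using abc block_count_bounds(1) by (auto simp: i_def j_def intro!: less_mult_imp_div_less)
    have mods: "a mod s < s" "b mod s < s" using s_pos by simp_all
    have "s + b mod s < 2 * s" "2 * s + c < n" using mods abc N s_le n_bounds by linarith+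
    have "(X (i * s + a mod s) + Y (j * s + b mod s) + Z c) mod M = 1"
      using sum[OF abc(3), of a b] abc by (simp add: i_def j_def)
    then have "(f i j (a mod s) + f i j (s + b mod s) + f i j (2 * s + c)) mod M = 1"
      using mods abc(3) by (simp add: f_def)
    moreover have "a mod s \<in> group n 0" "s + b mod s \<in> group n 1" "2 * s + c \<in> group n 2"
      using mods \<open>2 * s + c < n\<close> by (auto simp: group_def s[symmetric])
    ultimately show "some_nonzero (triple_problem (q + 3)) n Map.empty (reduction_ops N s g M X Y Z)"
      unfolding nonzero using ij by blast
  qed
qed

lemma length_reduction_ops: "length (reduction_ops N s g M X Y Z) \<le> (11 + 3 * k) * N"
proof -
  have "length (reduction_ops N s g M X Y Z) = N + g * s + g * (s + (g + s))"
    by (simp add: reduction_ops_def length_concat comp_def sum_list_triv)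
  also have "\<dots> = N + 3 * (g * s) + g * g" by (simp add: algebra_simps)
  also have "\<dots> \<le> N + 3 * ((k + 1) * N) + 7 * N" using block_count_bounds by linarith
  finally show ?thesis by (simp add: algebra_simps)
qed

text \<open>The length of the timeline grows only linearly in \<open>k\<close>, while
  \<open>n\<close> grows quadratically; so \<open>m / n\<close> can be made as small as
  desired.\<close>

lemma times_le: "s + N + g * s \<le> (k + 2) * N"
  using block_count_bounds(2) s_le by (simp add: algebra_simps)

text \<open>The linear overhead: \<open>10 * k * k\<close> and \<open>7 * R\<close> come from the
  searches for the side and the power of two, \<open>2 * q + c\<close> from computing powers,
  \<open>78 * k\<close> from the loops with \<open>g * s\<close> rounds in total, and 500 absorbs
  the rest.\<close>

lemma wp_three_sum_code:
  assumes R: "k * k \<le> R" and w: "w = word_size c (R * N)"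
    and word: "2 ^ w + 100 * M + 200 * (R * N) \<le> 2 ^ v"
    and serves: "serves_from_start (triple_problem (q + 3)) D w n (reduction_ops N s g M X Y Z) k0 ks"
  shows "wp v (three_sum_code q (k * k) R c D) (\<lambda>t \<sigma>.
      t \<le> 2 * (k0 + sum_list ks) + (10 * k * k + 7 * R + 2 * q + c + 78 * k + 500) * N \<and>
      reg \<sigma> 0 = (if \<exists>x\<in>set as. \<exists>y\<in>set bs. \<exists>z\<in>set cs. x + y + z = 0 then 1 else 0))
    (start_config v N (map (word_of_int v) (as @ bs @ cs)))"
proof -
  let ?\<sigma> = "start_config v N (map (word_of_int v) (as @ bs @ cs))"
  define inp where "inp = mem ?\<sigma>"
  define G where "G \<longleftrightarrow> (\<exists>x\<in>set as. \<exists>y\<in>set bs. \<exists>z\<in>set cs. x + y + z = 0)"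
  have s_n: "2 * s \<le> n" using s_le n_bounds by linarith
  have nR: "n \<le> R * N" unfolding n using R by (intro mult_le_mono1)
  have "1 \<le> n" "N \<le> n" using n_bounds N by linarith+
  have nM: "n * n < M" "n < M"
  proof -
    have "n * (n * n) < M" "n < M" using modulus_gt_cube[of "q + 3" n] \<open>1 \<le> n\<close> M by auto
    moreover have "1 * (n * n) \<le> n * (n * n)" using \<open>1 \<le> n\<close> by (intro mult_le_mono1)
    ultimately show "n * n < M" "n < M" by linarith+
  qed
  have pos: "(0::nat) < 2 ^ w" by simp
  have words: "M + N + R * N * 4 + s + n + 4 < 2 ^ v" "3 * N < 2 ^ v" "N < 2 ^ v"
    "(2::nat) ^ w < 2 ^ v" "4 * n * n < 2 ^ v" "n + 1 < 2 ^ v" "M < 2 ^ v" "N ^ q < 2 ^ v"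
    using word nR nM \<open>N \<le> n\<close> \<open>1 \<le> n\<close> U_bounds s_n unfolding U[symmetric] mult.assoc by linarith+
  have inp_eq: "inp (r mod N) = word_of_int v (as ! (r mod N)) mod 2 ^ v"
    "inp (r mod N + N) = word_of_int v (bs ! (r mod N)) mod 2 ^ v"
    "i < N \<Longrightarrow> inp (i + N + N) = word_of_int v (cs ! i) mod 2 ^ v" for r i
  proof -
    have "r mod N < N" using N by simp
    then show "inp (r mod N) = word_of_int v (as ! (r mod N)) mod 2 ^ v"
      "inp (r mod N + N) = word_of_int v (bs ! (r mod N)) mod 2 ^ v"
      using len words(2) by (simp_all add: inp_def start_config_def nth_append)
    show "i < N \<Longrightarrow> inp (i + N + N) = word_of_int v (cs ! i) mod 2 ^ v"
      using len words(2) by (simp add: inp_def start_config_def nth_append)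
  qed
  have M_int: "int M < 2 ^ v" using words(7) by (metis of_nat_less_iff of_nat_numeral of_nat_power)
  interpret dr: driver "triple_problem (q + 3)" D w v N n s g M "U + 2" U "M - (2 * U + 1)" X Y Z inp G
  proof
    show "2 ^ w + 100 * M + 100 * n + 100 * N \<le> 2 ^ v"
      using word nR \<open>N \<le> n\<close> by linarith
    show "w \<le> v" using words(4) by simp
    have "(2::nat) < 2 ^ v" using \<open>1 \<le> n\<close> nM(2) words(7) by linarith
    then show "1 < v" using power_strict_increasing_iff[of "2::nat" 1 v] by simp
    show "g \<le> n" using block_count_bounds(4) n_bounds N by linarith
    show "(inp (r mod N) + (U + 2)) mod 2 ^ v = X r" for r
      unfolding inp_eq X_def using entry_bounds[of r] U_bounds M_int by (intro word_of_int_add; linarith)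
    show "(inp (r mod N + N) + U) mod 2 ^ v = Y r" for r
      unfolding inp_eq Y_def using entry_bounds[of r] U_bounds M_int by (intro word_of_int_add; linarith)
    show "(inp (i + N + N) + (M - (2 * U + 1))) mod 2 ^ v = Z i" if "i < N" for i
      unfolding inp_eq(3)[OF that] Z_def using entry_bounds(3)[OF that] U_bounds M_int
      by (intro word_of_int_add; linarith)
  qed (use s_pos s_n N block_count_bounds red.X in auto)
  obtain c0 where c0: "exec w (init_code D) (start_config w n []) k0 c0"
    "serves (triple_problem (q + 3)) D w n Map.empty c0 (reduction_ops N s g M X Y Z) ks"
    using serves unfolding serves_from_start_def by blast
  show ?thesis
    unfolding three_sum_code_def seqs.simps wp_Seq
  proof (rule wp_mono[OF wp_sizes_code[where N = N and n = n]], goal_cases)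
    case (9 k1 \<sigma>1)
    then have 1: "k1 \<le> 10 * n + 2 * q + 20" "mem \<sigma>1 = inp" "reg \<sigma>1 0 = 0" "reg \<sigma>1 1 = N" "reg \<sigma>1 2 = 1"
      "reg \<sigma>1 3 = n" "reg \<sigma>1 4 = s" "reg \<sigma>1 5 = M" "reg \<sigma>1 7 = U" "\<forall>r\<ge>40. reg \<sigma>1 r = 0"
      by (simp_all add: inp_def s M U)
    have RN: "1 \<le> R * N" "2 * U + 1 \<le> M" using nR \<open>1 \<le> n\<close> U_bounds by linarith+
    show ?case
    proof (rule wp_mono[OF wp_layout_code[OF 1(3-10) RN(1) N s_pos w RN(2) words(4) words(1)]], elim conjE)
      fix k2 :: nat and \<sigma>2 :: config
      assume 2: "k2 \<le> 7 * (R * N) + c + 30" "mem \<sigma>2 = mem \<sigma>1" "reg \<sigma>2 0 = 0" "reg \<sigma>2 1 = N"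
        "reg \<sigma>2 4 = s" "reg \<sigma>2 5 = M" "reg \<sigma>2 6 = U + 2" "reg \<sigma>2 7 = U" "reg \<sigma>2 8 = M - (2 * U + 1)"
        "reg \<sigma>2 9 = N div s + 1" "reg \<sigma>2 10 = (N div s + 1) * s" "reg \<sigma>2 11 = s + N"
        "reg \<sigma>2 38 = 2 ^ w" "reg \<sigma>2 39 = 3 * N" "reg \<sigma>2 40 = n mod 2 ^ w" "\<forall>r>40. reg \<sigma>2 r = 0"
      have "dr.layout \<sigma>2" using 1 2 g unfolding dr.layout_def by simp
      have "n mod 2 ^ w < 2 ^ max w (Suc 0)" by (rule less_le_trans[of _ "2 ^ w"]) simp_all
      \<comment> \<open>Memory behind the input is zero, as the simulated machine expects at its
        start.\<close>
      moreover have "inp (a + 3 * N) = 0" for a using len by (simp add: inp_def start_config_def)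
      ultimately have "sim w (3 * N) (start_config w n []) \<sigma>2"
        using 1 2 by (auto simp: sim_def start_config_def)
      from exec_embed[OF c0(1) this dr.wv dr.memory_fits]
      show "wp v (embed (init_code D)) (\<lambda>k3. wp v (phases_code D) (\<lambda>k4 \<sigma>.
        k1 + (k2 + (k3 + k4)) \<le> 2 * (k0 + sum_list ks) + (10 * k * k + 7 * R + 2 * q + c + 78 * k + 500) * N \<and>
        reg \<sigma> 0 = (if \<exists>x\<in>set as. \<exists>y\<in>set bs. \<exists>z\<in>set cs. x + y + z = 0 then 1 else 0))) \<sigma>2"
      proof (rule wp_mono, elim conjE)
        fix k3 :: nat and \<sigma>3 :: config
        assume 3: "k3 \<le> 2 * k0" "sim w (3 * N) c0 \<sigma>3" "frame (3 * N) \<sigma>2 \<sigma>3"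
        have "reg \<sigma>3 0 = 0" using 3(3) 2(3) by (simp add: frame_def)
        then have verdict: "reg \<sigma>3 0 \<le> 1" "reg \<sigma>3 0 \<noteq> 0 \<or>
            some_nonzero (triple_problem (q + 3)) n Map.empty (reduction_ops N s g M X Y Z) \<longleftrightarrow> G"
          by (simp_all add: G_def some_nonzero_iff_three_sum)
        have "dr.layout \<sigma>3" by (rule dr.layout_frame[OF \<open>dr.layout \<sigma>2\<close> 3(3)])
        then have "dr.pending (reduction_ops N s g M X Y Z) \<sigma>3 (2 * sum_list ks)"
          using 3(2) c0(2) refl verdict by (rule dr.pendingI)
        from dr.wp_phases[OF this]
        show "wp v (phases_code D) (\<lambda>k4 \<sigma>.
          k1 + (k2 + (k3 + k4)) \<le> 2 * (k0 + sum_list ks) + (10 * k * k + 7 * R + 2 * q + c + 78 * k + 500) * N \<and>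
          reg \<sigma> 0 = (if \<exists>x\<in>set as. \<exists>y\<in>set bs. \<exists>z\<in>set cs. x + y + z = 0 then 1 else 0)) \<sigma>3"
        proof (rule wp_mono, elim conjE)
          fix k4 :: nat and \<sigma>4 :: config
          assume 4: "reg \<sigma>4 0 = (if G then 1 else 0)"
            "k4 \<le> 2 * sum_list ks + 24 * N + 30 * (g * s) + (48 * s + 24 * g + 10 + 4) * g + 9"
          have round: "(48 * s + 24 * g + 10 + 4) * g = 48 * (g * s) + 24 * (g * g) + 14 * g"
            by (simp add: algebra_simps)
          have "k4 \<le> 2 * sum_list ks + 24 * N + 78 * (g * s) + 24 * (g * g) + 14 * g + 9"
            using 4(2) unfolding round by linarith
          moreover have "g * s \<le> k * N + N" using block_count_bounds(3) by simp
          ultimately have "k4 \<le> 2 * sum_list ks + 24 * N + 78 * (k * N) + 78 * N + 168 * N + 14 * N + 23"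
            using block_count_bounds(4,5) by linarith
          moreover have "q \<le> q * N" "c \<le> c * N" using N by simp_all
          ultimately have "k1 + (k2 + (k3 + k4)) \<le> 2 * k0 + 2 * sum_list ks +
              (10 * n + 7 * (R * N) + 2 * (q * N) + c * N + 78 * (k * N) + 500 * N)"
            using 1(1) 2(1) 3(1) N by linarith
          then show "k1 + (k2 + (k3 + k4)) \<le> 2 * (k0 + sum_list ks) + (10 * k * k + 7 * R + 2 * q + c + 78 * k + 500) * N \<and>
            reg \<sigma>4 0 = (if \<exists>x\<in>set as. \<exists>y\<in>set bs. \<exists>z\<in>set cs. x + y + z = 0 then 1 else 0)"
            using 4(1) by (simp add: G_def n algebra_simps)
        qed
      qed
    qed
  qed (use words n \<open>1 \<le> n\<close> M in \<open>auto simp: start_config_def\<close>)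
qed

end

section \<open>Choice of parameters and the final contradiction\<close>

definition word_factor :: "nat \<Rightarrow> nat \<Rightarrow> nat \<Rightarrow> nat" where
  "word_factor q c R = (2 * R + 1) * (c + q + 3) + 9"

text \<open>\<open>F = (N + 1) ^ (2 * R + 1)\<close> exceeds \<open>2 * R * N\<close> already for
  \<open>N = 1\<close>, so a constant factor becomes an exponent. Then \<open>F ^ c\<close> covers
  \<open>2 ^ w\<close>, \<open>F ^ (q + 3)\<close> the modulus, and the summand 9 supplies a factor
  512 for the coefficients.\<close>

lemma word_factor_sufficient:
  assumes N: "1 \<le> N" and R: "1 \<le> R" "K \<le> R" and w: "w = word_size c (R * N)"
    and v: "v = word_size (word_factor q c R) N"
  shows "2 ^ w + 100 * modulus (q + 3) (K * N) + 200 * (R * N) \<le> 2 ^ v"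
proof -
  define F where "F = (N + 1) ^ (2 * R + 1)"
  define Q where "Q = F ^ (c + q + 3)"
  have "1 * 1 \<le> R * N" using N R by (intro mult_le_mono) auto
  then have RN: "1 \<le> R * N" by simp
  have "2 * R \<le> 2 ^ (2 * R)" using less_exp[of "2 * R"] by simp
  also have "(2::nat) ^ (2 * R) \<le> (N + 1) ^ (2 * R)" using N by (intro power_mono) auto
  finally have "2 * R * N \<le> (N + 1) ^ (2 * R) * (N + 1)" by (intro mult_le_mono) auto
  then have F: "2 * (R * N) \<le> F" by (simp add: F_def mult_ac)
  have F1: "1 \<le> F" using F RN by linarith
  have "2 ^ floor_log (R * N) \<le> R * N" using RN by (intro floor_log_exp2_le) simp
  then have "2 ^ (floor_log (R * N) + 1) \<le> F" using F by simp
  then have "(2 ^ (floor_log (R * N) + 1)) ^ c \<le> F ^ c" by (intro power_mono) auto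
  also have "\<dots> \<le> Q" unfolding Q_def using F1 by (intro power_increasing) auto
  finally have 1: "2 ^ w \<le> Q" unfolding w word_size_def by (metis power_mult mult.commute)
  have "K * N \<le> R * N" using R by (intro mult_le_mono1)
  then have "K * N + 1 \<le> F" using F RN by linarith
  then have "modulus (q + 3) (K * N) \<le> F ^ (q + 3)" unfolding modulus_def by (intro power_mono) auto
  also have "\<dots> \<le> Q" unfolding Q_def using F1 by (intro power_increasing) auto
  finally have 2: "modulus (q + 3) (K * N) \<le> Q" .
  have "F ^ 1 \<le> Q" unfolding Q_def using F1 by (intro power_increasing) auto
  then have 3: "2 * (R * N) \<le> Q" using F by simp
  have "(2::nat) ^ 9 \<le> (N + 1) ^ 9" using N by (intro power_mono) auto
  then have "512 * Q \<le> (N + 1) ^ 9 * Q" by (intro mult_le_mono1) simp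
  also have "\<dots> = (N + 1) ^ word_factor q c R"
    unfolding Q_def F_def word_factor_def power_add[of _ _ 9] power_mult by (rule mult.commute)
  also have "\<dots> \<le> 2 ^ v" unfolding v by (rule word_size_ge)
  finally show ?thesis using 1 2 3 by linarith
qed

text \<open>The structure is used with \<open>m = L * N\<close> alone. Then
  \<open>max n m = R * N\<close> is a fixed multiple of \<open>N\<close>, so the word size to be
  simulated is computable from \<open>N\<close>. The factor 2 before \<open>T\<close> is the cost of
  the simulation.\<close>

lemma three_sum_solver:
  assumes full: "fully_retroactive_amortized (triple_problem (q + 3)) h Ms D c T"
    and h: "1 \<le> h" and k: "2 \<le> k" and L: "k + 2 \<le> L" and Ms: "\<And>N. 1 \<le> N \<Longrightarrow> L * N \<in> Ms (k * k * N)"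
    and R: "R = max (k * k) L"
  shows "solves_three_sum q (three_sum_code q (k * k) R c D) (word_factor q c R)
    (\<lambda>N. 2 * T (k * k * N) * real ((k * k + 3 * k + 11) * N) +
      real ((10 * k * k + 7 * R + 2 * q + c + 78 * k + 500) * N))"
  unfolding solves_three_sum_def Let_def
proof (intro allI impI, elim conjE)
  fix N :: nat and A B C :: "int set" and as bs cs :: "int list"
  assume N: "1 \<le> N" and cards: "card A = N" "card B = N" "card C = N"
    and ranges: "A \<subseteq> {- (int N ^ q)..int N ^ q}" "B \<subseteq> {- (int N ^ q)..int N ^ q}"
      "C \<subseteq> {- (int N ^ q)..int N ^ q}"
    and enum: "enumerates as A" "enumerates bs B" "enumerates cs C"
  have sets: "set as = A" "set bs = B" "set cs = C" using enum by (auto simp: enumerates_def)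
  have len: "length as = N" "length bs = N" "length cs = N"
    using enum cards by (auto simp: enumerates_def distinct_card)
  have abs_le: "\<bar>x\<bar> \<le> int (N ^ q)" if "x \<in> set as \<union> set bs \<union> set cs" for x
  proof -
    have "x \<in> {- (int N ^ q)..int N ^ q}" using that ranges sets by blast
    then show ?thesis by (auto simp: abs_le_iff)
  qed
  define n where "n = k * k * N"
  define w where "w = word_size c (R * N)"
  define v where "v = word_size (word_factor q c R) N"
  interpret three_sum_instance q k N "N ^ q" n "side n" "N div side n + 1" "modulus (q + 3) n" as bs cs
    by unfold_locales (use N k len abs_le in \<open>simp_all add: n_def\<close>)
  let ?xs = "reduction_ops N (side n) (N div side n + 1) (modulus (q + 3) n) X Y Z"
  have max: "max n (L * N) = R * N" by (simp add: n_def R nat_mult_max_left)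
  have "1 \<le> n" using n_bounds N by linarith
  have "L * N \<le> max n (L * N) ^ 1" by simp
  also have "\<dots> \<le> max n (L * N) ^ h" using h \<open>1 \<le> n\<close> by (intro power_increasing) auto
  finally have H: "L * N \<le> max n (L * N) ^ h" .
  have "(k + 2) * N \<le> L * N" using L by (intro mult_le_mono1)
  with times_le have "side n + N + (N div side n + 1) * side n \<le> L * N" by linarith
  then have "legal_ops (triple_problem (q + 3)) n (L * N) (max n (L * N) ^ h) Map.empty ?xs"
    using H by (rule red.legal_reduction_ops)
  then obtain k0 ks where ks: "serves_from_start (triple_problem (q + 3)) D w n ?xs k0 ks"
    "real (k0 + sum_list ks) \<le> T n * real (n + length ?xs)"
    using full[unfolded fully_retroactive_amortized_def, rule_format, of n "L * N" ?xs]
      red.full_reduction_ops Ms[OF N] \<open>1 \<le> n\<close>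
    unfolding max w_def n_def[symmetric] by blast
  have "wp v (three_sum_code q (k * k) R c D) (\<lambda>t \<sigma>.
      t \<le> 2 * (k0 + sum_list ks) + (10 * k * k + 7 * R + 2 * q + c + 78 * k + 500) * N \<and>
      reg \<sigma> 0 = (if \<exists>x\<in>set as. \<exists>y\<in>set bs. \<exists>z\<in>set cs. x + y + z = 0 then 1 else 0))
    (start_config v N (map (word_of_int v) (as @ bs @ cs)))"
  proof (rule wp_three_sum_code[OF _ w_def _ ks(1)])
    show "k * k \<le> R" by (simp add: R)
    show "2 ^ w + 100 * modulus (q + 3) n + 200 * (R * N) \<le> 2 ^ v"
      unfolding n_def
    proof (rule word_factor_sufficient[OF N _ _ w_def v_def])
      have "1 * 1 \<le> k * k" using k by (intro mult_le_mono) auto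
      then show "1 \<le> R" by (simp add: R le_max_iff_disj)
      show "k * k \<le> R" by (simp add: R)
    qed
  qed
  then obtain t \<sigma> where t: "exec v (three_sum_code q (k * k) R c D)
      (start_config v N (map (word_of_int v) (as @ bs @ cs))) t \<sigma>"
    "t \<le> 2 * (k0 + sum_list ks) + (10 * k * k + 7 * R + 2 * q + c + 78 * k + 500) * N"
    "reg \<sigma> 0 = (if \<exists>x\<in>A. \<exists>y\<in>B. \<exists>z\<in>C. x + y + z = 0 then 1 else 0)"
    unfolding wp_def sets by blast
  \<comment> \<open>\<open>T\<close> is an arbitrary real function; its sign is obtained from the
    fact that it bounds a running time.\<close>
  have "0 \<le> T n * real (n + length ?xs)" using ks(2) by (rule order_trans[rotated]) simp
  then have T: "0 \<le> T n" using \<open>1 \<le> n\<close> by (simp add: zero_le_mult_iff)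
  have "n + length ?xs \<le> (k * k + 3 * k + 11) * N"
    using length_reduction_ops by (simp add: n_def algebra_simps)
  then have "T n * real (n + length ?xs) \<le> T n * real ((k * k + 3 * k + 11) * N)"
    using T by (intro mult_left_mono) (simp_all only: of_nat_le_iff)
  with ks(2) have cost: "real (k0 + sum_list ks) \<le> T n * real ((k * k + 3 * k + 11) * N)"
    by (rule order_trans)
  have "real t \<le> 2 * real (k0 + sum_list ks) + real ((10 * k * k + 7 * R + 2 * q + c + 78 * k + 500) * N)"
  proof -
    have "real t \<le> real (2 * (k0 + sum_list ks) + (10 * k * k + 7 * R + 2 * q + c + 78 * k + 500) * N)"
      using t(2) by (simp only: of_nat_le_iff)
    then show ?thesis by (simp only: of_nat_add of_nat_mult of_nat_numeral)
  qed
  then have "real t \<le> 2 * T n * real ((k * k + 3 * k + 11) * N) +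
      real ((10 * k * k + 7 * R + 2 * q + c + 78 * k + 500) * N)"
    unfolding mult.assoc[of 2 "T n"]
    by (rule order_trans[OF _ add_right_mono[OF mult_left_mono[OF cost]]]) simp
  with t show "\<exists>t \<sigma>. exec (word_size (word_factor q c R) N) (three_sum_code q (k * k) R c D)
      (start_config (word_size (word_factor q c R) N) N
        (map (word_of_int (word_size (word_factor q c R) N)) (as @ bs @ cs))) t \<sigma> \<and>
      real t \<le> 2 * T (k * k * N) * real ((k * k + 3 * k + 11) * N) +
        real ((10 * k * k + 7 * R + 2 * q + c + 78 * k + 500) * N) \<and>
      reg \<sigma> 0 = (if \<exists>x\<in>A. \<exists>y\<in>B. \<exists>z\<in>C. x + y + z = 0 then 1 else 0)"
    unfolding v_def n_def by blast
qed

text \<open>The overhead of the reduction is linear in \<open>N\<close>, so no exponent below 1 can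
  be reached; hence \<epsilon> is capped at 1.\<close>

lemma solver_time_bound:
  fixes T :: "nat \<Rightarrow> real" and \<epsilon> :: real and K a b :: nat
  assumes T: "T \<in> O(\<lambda>n. real n powr (1 - \<epsilon>))" and K: "1 \<le> K"
  shows "(\<lambda>N. 2 * T (K * N) * real (a * N) + real (b * N)) \<in> O(\<lambda>N. real N powr (2 - min \<epsilon> 1))"
proof -
  define \<epsilon>' where "\<epsilon>' = min \<epsilon> 1"
  have \<epsilon>': "\<epsilon>' \<le> \<epsilon>" "\<epsilon>' \<le> 1" by (auto simp: \<epsilon>'_def)
  obtain C where C: "0 < C" "\<forall>\<^sub>F n in sequentially. norm (T n) \<le> C * norm (real n powr (1 - \<epsilon>))"
    using T by (elim landau_o.bigE)
  have "filterlim (\<lambda>N. K * N) sequentially sequentially"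
    by (rule filterlim_at_top_mono[OF filterlim_ident]) (use K in \<open>auto intro!: always_eventually\<close>)
  then have "\<forall>\<^sub>F N in sequentially. norm (T (K * N)) \<le> C * norm (real (K * N) powr (1 - \<epsilon>))"
    using C(2) by (rule eventually_compose_filterlim[rotated])
  then have "\<forall>\<^sub>F N in sequentially. norm (2 * T (K * N) * real (a * N) + real (b * N)) \<le>
      (2 * C * real K powr (1 - \<epsilon>') * real a + real b) * norm (real N powr (2 - \<epsilon>'))"
    using eventually_ge_at_top[of 1]
  proof eventually_elim
    case (elim N)
    have "1 * 1 \<le> K * N" using K elim by (intro mult_le_mono) auto
    then have "1 \<le> real (K * N)" by linarith
    then have "real (K * N) powr (1 - \<epsilon>) \<le> real (K * N) powr (1 - \<epsilon>')"
      using \<epsilon>' by (intro powr_mono) auto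
    then have "\<bar>T (K * N)\<bar> \<le> C * real (K * N) powr (1 - \<epsilon>')"
      using elim(1) C(1) by (simp add: order_trans[OF _ mult_left_mono])
    also have "\<dots> = C * real K powr (1 - \<epsilon>') * real N powr (1 - \<epsilon>')" by (simp add: powr_mult)
    finally have "\<bar>T (K * N)\<bar> * (2 * real a * real N) \<le>
        C * real K powr (1 - \<epsilon>') * real N powr (1 - \<epsilon>') * (2 * real a * real N)"
      by (intro mult_right_mono) auto
    also have "\<dots> = 2 * C * real K powr (1 - \<epsilon>') * real a * (real N powr (1 - \<epsilon>') * real N powr 1)"
      using elim by simp
    also have "real N powr (1 - \<epsilon>') * real N powr 1 = real N powr (2 - \<epsilon>')"
      by (simp only: powr_add[symmetric]) simp
    finally have 1: "\<bar>T (K * N)\<bar> * (2 * real a * real N) \<le>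
        2 * C * real K powr (1 - \<epsilon>') * real a * real N powr (2 - \<epsilon>')" .
    have "real N powr 1 \<le> real N powr (2 - \<epsilon>')" using elim \<epsilon>' by (intro powr_mono) auto
    then have 2: "real b * real N \<le> real b * real N powr (2 - \<epsilon>')"
      using elim by (intro mult_left_mono) auto
    have "norm (2 * T (K * N) * real (a * N) + real (b * N)) \<le> \<bar>T (K * N)\<bar> * (2 * real a * real N) + real b * real N"
      by (rule order_trans[OF norm_triangle_ineq]) (simp add: abs_mult)
    with 1 2 show ?case by (simp add: algebra_simps)
  qed
  then show ?thesis unfolding \<epsilon>'_def by (rule bigoI)
qed

text \<open>\<open>L / (k * k)\<close> is the ratio \<open>m / n\<close> of the reduction. It has to
  lie in the given window although \<open>L\<close> is an integer and must leave room for the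
  \<open>(k + 2) * N\<close> updates.\<close>

lemma block_parameters:
  fixes \<delta> \<Delta> :: real
  assumes "0 < \<delta>" "\<delta> < \<Delta>"
  obtains k L :: nat where "2 \<le> k" "k + 2 \<le> L" "\<delta> * real (k * k) \<le> real L" "real L \<le> \<Delta> * real (k * k)"
proof -
  \<comment> \<open>The term \<open>1 / (\<Delta> - \<delta>)\<close> makes the window for
    \<open>L\<close> at least 1 long, so that it contains an integer; \<open>4 / \<Delta>\<close>
    pushes its upper end to \<open>4 * k\<close>, whence \<open>L \<ge> k + 2\<close> after rounding
    down.\<close>
  define k where "k = nat \<lceil>2 + 1 / (\<Delta> - \<delta>) + 4 / \<Delta>\<rceil>"
  define L where "L = nat \<lfloor>\<Delta> * real (k * k)\<rfloor>"
  have "2 + 1 / (\<Delta> - \<delta>) + 4 / \<Delta> \<le> real k" unfolding k_def by (rule real_nat_ceiling_ge)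
  moreover have "0 < 1 / (\<Delta> - \<delta>)" "0 < 4 / \<Delta>" using assms by auto
  ultimately have k: "2 \<le> real k" "1 / (\<Delta> - \<delta>) \<le> real k" "4 / \<Delta> \<le> real k" by linarith+
  have "1 \<le> (\<Delta> - \<delta>) * real k" "4 \<le> \<Delta> * real k"
    using k assms by (simp_all add: field_simps)
  moreover have "real k * 1 \<le> real k * real k" using k by (intro mult_left_mono) auto
  ultimately have "1 \<le> (\<Delta> - \<delta>) * (real k * real k)" "4 * real k \<le> (\<Delta> * real k) * real k"
    using assms mult_left_mono[of "real k" "real k * real k" "\<Delta> - \<delta>"]
      mult_right_mono[of 4 "\<Delta> * real k" "real k"] by linarith+
  then have kk: "1 \<le> (\<Delta> - \<delta>) * real (k * k)" "4 * real k \<le> \<Delta> * real (k * k)"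
    by (simp_all add: mult_ac)
  have "0 \<le> \<Delta> * real (k * k)" using assms by simp
  then have L: "real L \<le> \<Delta> * real (k * k)" "\<Delta> * real (k * k) - 1 < real L" unfolding L_def by linarith+
  show thesis
  proof (rule that)
    show "2 \<le> k" using k by linarith
    have "real k + 2 \<le> real L" using kk k L by linarith
    then show "k + 2 \<le> L" by linarith
    show "\<delta> * real (k * k) \<le> real L" using kk L by (simp add: algebra_simps)
  qed (rule L)
qed

theorem theorem3:
  assumes three_sum_conjecture
  shows "\<exists>P. ds_problem P \<and>
    (\<forall>h\<ge>1.
      (\<exists>D c T. partially_retroactive P h D c T \<and> T \<in> O(\<lambda>n. sqrt (real n))) \<and>
      (\<forall>\<delta> \<Delta> :: real. 0 < \<delta> \<and> \<delta> < \<Delta> \<longrightarrow>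
        (\<forall>D c T. fully_retroactive_amortized P h
              (\<lambda>n. {m. \<delta> * real n \<le> real m \<and> real m \<le> \<Delta> * real n}) D c T \<longrightarrow>
          (\<forall>\<epsilon>>0. T \<notin> O(\<lambda>n. real n powr (1 - \<epsilon>))))))"
proof -
  obtain q where q: "\<And>p c T \<epsilon>. solves_three_sum q p c T \<Longrightarrow> 0 < \<epsilon> \<Longrightarrow> T \<notin> O(\<lambda>n. real n powr (2 - \<epsilon>))"
    using assms unfolding three_sum_conjecture_def by blast
  show ?thesis
  \<comment> \<open>The problem depends only on the exponent \<open>q\<close> of the conjecture; the
    window for \<open>m\<close> determines just \<open>k\<close> and \<open>L\<close> in the
    reduction.\<close>
  proof (intro exI[of _ "triple_problem (q + 3)"] conjI allI impI, goal_cases)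
    case 1
    show ?case by (rule ds_problem_triple_problem) simp
  next
    case (2 h)
    then show ?case
      using partially_retroactive_triple_problem[of "q + 3" h] time_bound_sqrt by fastforce
  next
    case (3 h \<delta> \<Delta> D c T \<epsilon>)
    show ?case
    proof
      assume T: "T \<in> O(\<lambda>n. real n powr (1 - \<epsilon>))"
      obtain k L :: nat where k: "2 \<le> k" "k + 2 \<le> L"
        "\<delta> * real (k * k) \<le> real L" "real L \<le> \<Delta> * real (k * k)"
        using block_parameters 3(2) by metis
      define R where "R = max (k * k) L"
      have Ms: "L * N \<in> {m. \<delta> * real (k * k * N) \<le> real m \<and> real m \<le> \<Delta> * real (k * k * N)}" for N
        using mult_right_mono[OF k(3), of "real N"] mult_right_mono[OF k(4), of "real N"] by (simp add: mult_ac)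
      have "1 \<le> k * k" using k(1) by (cases k) auto
      have "0 < min \<epsilon> 1" using 3(4) by simp
      with q[OF three_sum_solver[OF 3(3,1) k(1,2) Ms R_def]] solver_time_bound[OF T \<open>1 \<le> k * k\<close>]
      show False by blast
    qed
  qed
qed

end
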